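(* Suppose that Assumption A, stated in the context, holds. Let $r\in\mathbb{R}$ be a positive constant such that $\|\tilde v_0-T\tilde v_0\|_\xi\le r$. Given $\epsilon>0$, assume that the total number of iterations, $k$, in the modified policy iteration (PI) algorithm described in the context satisfies $$k\tau^k<\frac{(1-\tau)^2}{2r}\epsilon,$$ where $\tau:=\alpha\beta\in(0,1)$. Then $\tilde\pi:=\pi_k$ obtained by the modified PI algorithm is an $\epsilon$-optimal policy, i.e., $\|v^{\tilde\pi}-v^\star\|_\xi<\epsilon$.
   Context: Setting. $\mathcal{X}\subseteq\mathbb{R}^n$, $\mathcal{U}\subseteq\mathbb{R}^m$, $\mathcal{W}\subseteq\mathbb{R}^l$ are Borel sets; the system is $x_{t+1}=f(x_t,u_t,w_t)$ with $x_t\in\mathcal{X}$, $u_t\in\mathcal{U}(x_t)\subseteq\mathcal{U}$, $w_t\in\mathcal{W}$ random. $\mathbb{K}:=\{(\boldsymbol{x},\boldsymbol{u})\in\mathcal{X}\times\mathcal{U}\mid\boldsymbol{u}\in\mathcal{U}(\boldsymbol{x})\}$; $c:\mathcal{X}\times\mathcal{U}\to\mathbb{R}$ is the stage cost; $\alpha\in(0,1)$. Given samples $\hat w^{(1)},\ldots,\hat w^{(N)}\in\mathcal{W}$, $\nu_N:=\frac1N\sum_i\delta_{\hat w^{(i)}}$; $W_p$ ($p\in[1,\infty)$) is the Wasserstein distance of order $p$ for a metric $d$ on $\mathcal{W}$; $\mathcal{D}:=\{\mu\in\mathcal{P}(\mathcal{W})\mid W_p(\mu,\nu_N)\le\theta\}$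 with $\theta>0$. Game. Histories are $h_t=(x_0,u_0,\ldots,x_{t-1},u_{t-1},x_t)\in H_t$; extended histories are $h_t^e=(x_0,u_0,\mu_0,\ldots,x_{t-1},u_{t-1},\mu_{t-1},x_t,u_t)\in H_t^e$. $\Pi$: sequences of stochastic kernels $\pi_t$ from $H_t$ to $\mathbb{R}^m$ with $\pi_t(\mathcal{U}(x_t)|h_t)=1$. $\Gamma$: sequences of stochastic kernels $\gamma_t$ from $H_t^e$ to $\mathcal{P}(\mathcal{W})$ with $\gamma_t(\mathcal{D}|h_t^e)=1$ (Player II chooses the law $\mu_t$ of $w_t$). $J_{\boldsymbol{x}}(\pi,\gamma):=\mathbb{E}^{\pi,\gamma}[\sum_{t\ge0}\alpha^tc(x_t,u_t)\mid x_0=\boldsymbol{x}]$. $v^\star(\boldsymbol{x}):=\inf_{\pi\in\Pi}\sup_{\gamma\in\Gamma}J_{\boldsymbol{x}}(\pi,\gamma)$ and $v^\pi(\boldsymbol{x}):=\sup_{\gamma\in\Gamma}J_{\boldsymbol{x}}(\pi,\gamma)$. $\Pi^{DS}$ is the set of measurable $\pi:\mathcal{X}\to\mathcal{U}$ with $\pi(\boldsymbol{x})\in\mathcal{U}(\boldsymbol{x})$ (deterministic stationary policies). Assumption A. (1) $c$ is lower semicontinuous on $\mathbb{K}$ and $|c(\boldsymbol{x},\boldsymbol{u})|\le b\,\xi(\boldsymbol{x})$ on $\mathbb{K}$ for some constant $b\ge0$ and continuous $\xi:\mathcal{X}\to[1,\infty)$ such that $\xi'(\boldsymbol{x},\boldsymbol{u}):=\int_{\mathcal{W}}\xi(f(\boldsymbol{x},\boldsymbol{u},w))\boldsymbol{\mu}(\mathrm{d}w)$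 is continuous on $\mathbb{K}$ for every $\boldsymbol{\mu}\in\mathcal{D}$; and there is a constant $\beta\in[1,1/\alpha)$ with $\xi'(\boldsymbol{x},\boldsymbol{u})\le\beta\xi(\boldsymbol{x})$ for all $(\boldsymbol{x},\boldsymbol{u})\in\mathbb{K}$ (and every $\boldsymbol{\mu}\in\mathcal{D}$). (2) For each continuous bounded $\chi:\mathcal{X}\to\mathbb{R}$, $(\boldsymbol{x},\boldsymbol{u})\mapsto\int_{\mathcal{W}}\chi(f(\boldsymbol{x},\boldsymbol{u},w))\boldsymbol{\mu}(\mathrm{d}w)$ is continuous on $\mathbb{K}$ for every $\boldsymbol{\mu}\in\mathcal{D}$. (3) $\mathcal{U}(\boldsymbol{x})$ is compact for every $\boldsymbol{x}$ and $\boldsymbol{x}\mapsto\mathcal{U}(\boldsymbol{x})$ is upper semicontinuous. Norm and operators. $\|v\|_\xi:=\sup_{\boldsymbol{x}\in\mathcal{X}}|v(\boldsymbol{x})|/\xi(\boldsymbol{x})$; $\mathbb{B}_\xi(\mathcal{X})$ is the Banach space of measurable functions with $\|v\|_\xi<\infty$; $\mathbb{B}_{lsc}(\mathcal{X})$ is the set of lower semicontinuous functions in it. $(Tv)(\boldsymbol{x}):=\inf_{\boldsymbol{u}\in\mathcal{U}(\boldsymbol{x})}\sup_{\boldsymbol{\mu}\in\mathcal{D}}[c(\boldsymbol{x},\boldsymbol{u})+\alpha\int_{\mathcal{W}}v(f(\boldsymbol{x},\boldsymbol{u},w))\boldsymbol{\mu}(\mathrm{d}w)]$, which is computed by the semi-infinite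 program: minimize $\lambda\theta^p+c(\boldsymbol{x},\boldsymbol{u})+\frac1N\sum_{i=1}^N\ell_i$ over $\boldsymbol{u}\in\mathcal{U}(\boldsymbol{x})$, $\lambda\ge0$, $\ell\in\mathbb{R}^N$ subject to $\alpha v(f(\boldsymbol{x},\boldsymbol{u},w))-\lambda d(w,\hat w^{(i)})^p\le\ell_i$ for all $w\in\mathcal{W}$, $i=1,\ldots,N$. For $\pi\in\Pi^{DS}$, $(T^\pi v)(\boldsymbol{x}):=\sup_{\boldsymbol{\mu}\in\mathcal{D}}[c(\boldsymbol{x},\pi(\boldsymbol{x}))+\alpha\int_{\mathcal{W}}v(f(\boldsymbol{x},\pi(\boldsymbol{x}),w))\boldsymbol{\mu}(\mathrm{d}w)]$. Modified PI algorithm. Initialize $\tilde v_0$ as an arbitrary function in $\mathbb{B}_{lsc}(\mathcal{X})$ and $\{M_j\}$ as a sequence of positive integers. For $j=1,2,\ldots$: (policy improvement) for each $\boldsymbol{x}\in\mathcal{X}$ set $\pi_j(\boldsymbol{x}):=\tilde{\boldsymbol{u}}$, where $\tilde{\boldsymbol{u}}$ is an optimal $\boldsymbol{u}$ of the semi-infinite program computing $(T\tilde v_{j-1})(\boldsymbol{x})$ (with $\pi_j\in\Pi^{DS}$); (policy evaluation) $\tilde v_j:=(T^{\pi_j})^{M_j}\tilde v_{j-1}$. After iteration $k$, stop and set $\tilde\pi:=\pi_k$. *)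

theory Defs
  imports "HOL-Probability.Probability"
begin

definition lsc_on :: "'a::topological_space set \<Rightarrow> ('a \<Rightarrow> real) \<Rightarrow> bool" where
  "lsc_on S g \<longleftrightarrow> (\<forall>x\<in>S. \<forall>a<g x. \<forall>\<^sub>F y in at x within S. a < g y)"

definition usc_correspondence_on ::
  "'a::topological_space set \<Rightarrow> ('a \<Rightarrow> 'b::topological_space set) \<Rightarrow> bool" where
  "usc_correspondence_on S F \<longleftrightarrow>
     (\<forall>x\<in>S. \<forall>V. open V \<and> F x \<subseteq> V \<longrightarrow> (\<forall>\<^sub>F y in at x within S. F y \<subseteq> V))"

definition couplings :: "'a measure \<Rightarrow> 'a measure \<Rightarrow> 'a measure \<Rightarrow> ('a \<times> 'a) measure set" where
  "couplings B \<mu> \<nu> = {\<kappa> \<in> space (prob_algebra (B \<Otimes>\<^sub>M B)). distr \<kappa> B fst = \<mu> \<and> distr \<kappa> B snd = \<nu>}"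

text \<open>Values in the extended half line; the case distinction is the extension of the \<open>p\<close>-th root.\<close>

definition wasserstein ::
  "'a measure \<Rightarrow> ('a \<Rightarrow> 'a \<Rightarrow> real) \<Rightarrow> real \<Rightarrow> 'a measure \<Rightarrow> 'a measure \<Rightarrow> ennreal" where
  "wasserstein B d p \<mu> \<nu> =
     (let I = (INF \<kappa>\<in>couplings B \<mu> \<nu>. \<integral>\<^sup>+z. ennreal (d (fst z) (snd z) powr p) \<partial>\<kappa>)
      in if I = \<infinity> then \<infinity> else ennreal (enn2real I powr (1 / p)))"

text \<open>
  The worst-case operators below are iterated, and even for Borel measurable \<open>v\<close> the function
  \<open>T\<^sup>\<pi> v\<close>, a supremum over uncountably many laws, need not be Borel measurable again, whereas
  \<^const>\<open>lebesgue_integral\<close> is 0 on non-measurable integrands.  The upper integral is the usual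
  integral on every integrable function (lemma \<open>upper_integral_eq_lebesgue_integral\<close>) and keeps
  the iterates meaningful without imposing measurability on them.
\<close>

definition upper_integral :: "'a measure \<Rightarrow> ('a \<Rightarrow> real) \<Rightarrow> real" where
  "upper_integral M g =
     Inf {integral\<^sup>L M h | h. integrable M h \<and> (\<forall>w\<in>space M. g w \<le> h w)}"

lemma upper_integral_eq_lebesgue_integral:
  assumes "integrable M g"
  shows "upper_integral M g = integral\<^sup>L M g"
  unfolding upper_integral_def
proof (rule cInf_eq_minimum)
  show "integral\<^sup>L M g \<in> {integral\<^sup>L M h | h. integrable M h \<and> (\<forall>w\<in>space M. g w \<le> h w)}"
    using assms by blast
next
  fix y assume "y \<in> {integral\<^sup>L M h | h. integrable M h \<and> (\<forall>w\<in>space M. g w \<le> h w)}"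
  then show "integral\<^sup>L M g \<le> y"
    using assms by (auto intro: integral_mono)
qed

record ('n, 'm, 'l) control_problem =
  state_set :: "(real ^ 'n) set"
  input_set :: "(real ^ 'm) set"
  admissible :: "real ^ 'n \<Rightarrow> (real ^ 'm) set"
  dist_set :: "(real ^ 'l) set"
  dyn :: "real ^ 'n \<Rightarrow> real ^ 'm \<Rightarrow> real ^ 'l \<Rightarrow> real ^ 'n"
  cost :: "real ^ 'n \<Rightarrow> real ^ 'm \<Rightarrow> real"
  discount :: real
  dist_metric :: "real ^ 'l \<Rightarrow> real ^ 'l \<Rightarrow> real"
  wass_order :: real
  radius :: real
  sample_size :: nat
  sample :: "nat \<Rightarrow> real ^ 'l"  \<comment> \<open>indexed by \<open>{1..sample_size}\<close>\<close>

definition state_space :: "('n::finite, 'm::finite, 'l::finite) control_problem \<Rightarrow> (real ^ 'n) measure" where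
  "state_space S = restrict_space borel (state_set S)"

definition input_space :: "('n::finite, 'm::finite, 'l::finite) control_problem \<Rightarrow> (real ^ 'm) measure" where
  "input_space S = restrict_space borel (input_set S)"

definition dist_space :: "('n::finite, 'm::finite, 'l::finite) control_problem \<Rightarrow> (real ^ 'l) measure" where
  "dist_space S = restrict_space borel (dist_set S)"

text \<open>
  Only Borel measurability of the metric is required; in particular every metric inducing the
  usual topology of the disturbance set is allowed.
\<close>

definition well_posed :: "('n::finite, 'm::finite, 'l::finite) control_problem \<Rightarrow> bool" where
  "well_posed S \<longleftrightarrow>
     state_set S \<in> sets borel \<and> input_set S \<in> sets borel \<and> dist_set S \<in> sets borel \<and>
     (\<forall>x\<in>state_set S. admissible S x \<subseteq> input_set S) \<and>
     (\<lambda>(x, u, w). dyn S x u w)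
        \<in> state_space S \<Otimes>\<^sub>M (input_space S \<Otimes>\<^sub>M dist_space S) \<rightarrow>\<^sub>M state_space S \<and>
     (\<lambda>(x, u). cost S x u) \<in> borel_measurable (state_space S \<Otimes>\<^sub>M input_space S) \<and>
     0 < discount S \<and> discount S < 1 \<and>
     Metric_space (dist_set S) (dist_metric S) \<and>
     (\<lambda>(w, w'). dist_metric S w w') \<in> borel_measurable (dist_space S \<Otimes>\<^sub>M dist_space S) \<and>
     1 \<le> wass_order S \<and> 0 < radius S \<and>
     1 \<le> sample_size S \<and> (\<forall>i\<in>{1..sample_size S}. sample S i \<in> dist_set S)"

definition graph_set :: "('n::finite, 'm::finite, 'l::finite) control_problem \<Rightarrow> ((real ^ 'n) \<times> (real ^ 'm)) set" where
  "graph_set S = {(x, u). x \<in> state_set S \<and> u \<in> input_set S \<and> u \<in> admissible S x}"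

text \<open>The law of \<open>sample S i\<close> for a uniformly random index \<open>i\<close>, i.e. the average of the Dirac measures.\<close>

definition empirical :: "('n::finite, 'm::finite, 'l::finite) control_problem \<Rightarrow> (real ^ 'l) measure" where
  "empirical S = distr (uniform_count_measure {1..sample_size S}) (dist_space S) (sample S)"

definition ambiguity_set :: "('n::finite, 'm::finite, 'l::finite) control_problem \<Rightarrow> (real ^ 'l) measure set" where
  "ambiguity_set S =
     {\<mu> \<in> space (prob_algebra (dist_space S)).
        wasserstein (dist_space S) (dist_metric S) (wass_order S) \<mu> (empirical S)
          \<le> ennreal (radius S)}"

text \<open>
  A step of the play is \<open>(x\<^sub>t, u\<^sub>t, \<mu>\<^sub>t)\<close>.  A history \<open>h\<^sub>t\<close> is a pair of the family
  \<open>(x\<^sub>i, u\<^sub>i)\<close>, \<open>i < t\<close>, and the current state \<open>x\<^sub>t\<close>; an extended history is a pair of the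
  family \<open>(x\<^sub>i, u\<^sub>i, \<mu>\<^sub>i)\<close>, \<open>i < t\<close>, and \<open>(x\<^sub>t, u\<^sub>t)\<close>.
\<close>

type_synonym ('n, 'm, 'l) play_step = "(real ^ 'n) \<times> (real ^ 'm) \<times> (real ^ 'l) measure"
type_synonym ('n, 'm) history = "(nat \<Rightarrow> (real ^ 'n) \<times> (real ^ 'm)) \<times> (real ^ 'n)"
type_synonym ('n, 'm, 'l) ext_history =
  "(nat \<Rightarrow> ('n, 'm, 'l) play_step) \<times> (real ^ 'n) \<times> (real ^ 'm)"
type_synonym ('n, 'm) policy = "nat \<Rightarrow> ('n, 'm) history \<Rightarrow> (real ^ 'm) measure"
type_synonym ('n, 'm, 'l) adversary = "nat \<Rightarrow> ('n, 'm, 'l) ext_history \<Rightarrow> (real ^ 'l) measure measure"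

definition step_space ::
  "('n::finite, 'm::finite, 'l::finite) control_problem \<Rightarrow> ('n, 'm, 'l) play_step measure" where
  "step_space S = state_space S \<Otimes>\<^sub>M (input_space S \<Otimes>\<^sub>M prob_algebra (dist_space S))"

definition history_space ::
  "('n::finite, 'm::finite, 'l::finite) control_problem \<Rightarrow> nat \<Rightarrow> ('n, 'm) history measure" where
  "history_space S t = PiM {0..<t} (\<lambda>_. state_space S \<Otimes>\<^sub>M input_space S) \<Otimes>\<^sub>M state_space S"

definition ext_history_space ::
  "('n::finite, 'm::finite, 'l::finite) control_problem \<Rightarrow> nat \<Rightarrow> ('n, 'm, 'l) ext_history measure" where
  "ext_history_space S t =
     PiM {0..<t} (\<lambda>_. step_space S) \<Otimes>\<^sub>M (state_space S \<Otimes>\<^sub>M input_space S)"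

text \<open>
  A law on \<open>\<real>\<^sup>m\<close> giving mass 1 to \<open>admissible S x\<close>, a subset of \<open>input_set S\<close>, is the same as a
  law on \<open>input_set S\<close> with this property.
\<close>

definition policies :: "('n::finite, 'm::finite, 'l::finite) control_problem \<Rightarrow> ('n, 'm) policy set" where
  "policies S = {\<pi>. \<forall>t. \<pi> t \<in> history_space S t \<rightarrow>\<^sub>M prob_algebra (input_space S) \<and>
     (\<forall>h\<in>space (history_space S t). AE u in \<pi> t h. u \<in> admissible S (snd h))}"

definition adversaries :: "('n::finite, 'm::finite, 'l::finite) control_problem \<Rightarrow> ('n, 'm, 'l) adversary set" where
  "adversaries S = {\<gamma>. \<forall>t. \<gamma> t \<in> ext_history_space S t \<rightarrow>\<^sub>M prob_algebra (prob_algebra (dist_space S)) \<and>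
     (\<forall>h\<in>space (ext_history_space S t). AE \<mu> in \<gamma> t h. \<mu> \<in> ambiguity_set S)}"

definition next_state_law ::
  "('n::finite, 'm::finite, 'l::finite) control_problem \<Rightarrow> real ^ 'n \<Rightarrow> nat \<Rightarrow>
     (nat \<Rightarrow> ('n, 'm, 'l) play_step) \<Rightarrow> (real ^ 'n) measure" where
  "next_state_law S x\<^sub>0 t \<omega> =
     (case t of 0 \<Rightarrow> return (state_space S) x\<^sub>0
      | Suc s \<Rightarrow> (case \<omega> s of (x, u, \<mu>) \<Rightarrow> distr \<mu> (state_space S) (dyn S x u)))"

definition input_history :: "nat \<Rightarrow> (nat \<Rightarrow> ('n, 'm, 'l) play_step) \<Rightarrow> nat \<Rightarrow> (real ^ 'n) \<times> (real ^ 'm)" where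
  "input_history t \<omega> = (\<lambda>i\<in>{0..<t}. (fst (\<omega> i), fst (snd (\<omega> i))))"

definition step_kernel ::
  "('n::finite, 'm::finite, 'l::finite) control_problem \<Rightarrow> ('n, 'm) policy \<Rightarrow> ('n, 'm, 'l) adversary \<Rightarrow>
     real ^ 'n \<Rightarrow> nat \<Rightarrow> (nat \<Rightarrow> ('n, 'm, 'l) play_step) \<Rightarrow> ('n, 'm, 'l) play_step measure" where
  "step_kernel S \<pi> \<gamma> x\<^sub>0 t \<omega> =
     next_state_law S x\<^sub>0 t \<omega> \<bind> (\<lambda>x.
       \<pi> t (input_history t \<omega>, x) \<bind> (\<lambda>u.
         \<gamma> t (\<omega>, x, u) \<bind> (\<lambda>\<mu>.
           return (step_space S) (x, u, \<mu>))))"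

text \<open>The law of the whole play, obtained from the step kernels by the Ionescu-Tulcea theorem.\<close>

definition play_law ::
  "('n::finite, 'm::finite, 'l::finite) control_problem \<Rightarrow> ('n, 'm) policy \<Rightarrow> ('n, 'm, 'l) adversary \<Rightarrow>
     real ^ 'n \<Rightarrow> (nat \<Rightarrow> ('n, 'm, 'l) play_step) measure" where
  "play_law S \<pi> \<gamma> x\<^sub>0 =
     projective_family.lim UNIV
       (Ionescu_Tulcea.CI (step_kernel S \<pi> \<gamma> x\<^sub>0) (\<lambda>_. step_space S)) (\<lambda>_. step_space S)"

definition total_cost ::
  "('n::finite, 'm::finite, 'l::finite) control_problem \<Rightarrow> ('n, 'm) policy \<Rightarrow> ('n, 'm, 'l) adversary \<Rightarrow>
     real ^ 'n \<Rightarrow> real" where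
  "total_cost S \<pi> \<gamma> x\<^sub>0 =
     (\<integral>\<omega>. (\<Sum>t. discount S ^ t * cost S (fst (\<omega> t)) (fst (snd (\<omega> t)))) \<partial>play_law S \<pi> \<gamma> x\<^sub>0)"

definition policy_value ::
  "('n::finite, 'm::finite, 'l::finite) control_problem \<Rightarrow> ('n, 'm) policy \<Rightarrow> real ^ 'n \<Rightarrow> real" where
  "policy_value S \<pi> x = (SUP \<gamma>\<in>adversaries S. total_cost S \<pi> \<gamma> x)"

definition optimal_value :: "('n::finite, 'm::finite, 'l::finite) control_problem \<Rightarrow> real ^ 'n \<Rightarrow> real" where
  "optimal_value S x = (INF \<pi>\<in>policies S. SUP \<gamma>\<in>adversaries S. total_cost S \<pi> \<gamma> x)"

definition det_stationary ::
  "('n::finite, 'm::finite, 'l::finite) control_problem \<Rightarrow> (real ^ 'n \<Rightarrow> real ^ 'm) set" where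
  "det_stationary S =
     {\<pi>. \<pi> \<in> state_space S \<rightarrow>\<^sub>M input_space S \<and> (\<forall>x\<in>state_set S. \<pi> x \<in> admissible S x)}"

definition stationary_policy ::
  "('n::finite, 'm::finite, 'l::finite) control_problem \<Rightarrow> (real ^ 'n \<Rightarrow> real ^ 'm) \<Rightarrow> ('n, 'm) policy" where
  "stationary_policy S \<pi> = (\<lambda>t h. return (input_space S) (\<pi> (snd h)))"

text \<open>Integrability of \<open>\<xi> \<circ> f\<close> is the requirement that \<open>\<xi>'\<close> is finite.\<close>

definition assumption_A ::
  "('n::finite, 'm::finite, 'l::finite) control_problem \<Rightarrow> (real ^ 'n \<Rightarrow> real) \<Rightarrow> real \<Rightarrow> bool" where
  "assumption_A S \<xi> \<beta> \<longleftrightarrow>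
     lsc_on (graph_set S) (\<lambda>(x, u). cost S x u) \<and>
     (\<exists>b\<ge>0. \<forall>(x, u)\<in>graph_set S. \<bar>cost S x u\<bar> \<le> b * \<xi> x) \<and>
     continuous_on (state_set S) \<xi> \<and> (\<forall>x\<in>state_set S. 1 \<le> \<xi> x) \<and>
     1 \<le> \<beta> \<and> \<beta> < 1 / discount S \<and>
     (\<forall>\<mu>\<in>ambiguity_set S.
        (\<forall>(x, u)\<in>graph_set S. integrable \<mu> (\<lambda>w. \<xi> (dyn S x u w))) \<and>
        continuous_on (graph_set S) (\<lambda>(x, u). \<integral>w. \<xi> (dyn S x u w) \<partial>\<mu>) \<and>
        (\<forall>(x, u)\<in>graph_set S. (\<integral>w. \<xi> (dyn S x u w) \<partial>\<mu>) \<le> \<beta> * \<xi> x)) \<and>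
     (\<forall>g :: real ^ 'n \<Rightarrow> real. continuous_on (state_set S) g \<and> bounded (g ` state_set S) \<longrightarrow>
        (\<forall>\<mu>\<in>ambiguity_set S.
           continuous_on (graph_set S) (\<lambda>(x, u). \<integral>w. g (dyn S x u w) \<partial>\<mu>))) \<and>
     (\<forall>x\<in>state_set S. compact (admissible S x)) \<and>
     usc_correspondence_on (state_set S) (admissible S)"

definition weighted_norm ::
  "('n::finite, 'm::finite, 'l::finite) control_problem \<Rightarrow> (real ^ 'n \<Rightarrow> real) \<Rightarrow> (real ^ 'n \<Rightarrow> real) \<Rightarrow> ennreal" where
  "weighted_norm S \<xi> v = (SUP x\<in>state_set S. ennreal (\<bar>v x\<bar> / \<xi> x))"

definition B_space ::
  "('n::finite, 'm::finite, 'l::finite) control_problem \<Rightarrow> (real ^ 'n \<Rightarrow> real) \<Rightarrow> (real ^ 'n \<Rightarrow> real) set" where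
  "B_space S \<xi> = {v. v \<in> borel_measurable (state_space S) \<and> weighted_norm S \<xi> v < \<infinity>}"

definition B_lsc ::
  "('n::finite, 'm::finite, 'l::finite) control_problem \<Rightarrow> (real ^ 'n \<Rightarrow> real) \<Rightarrow> (real ^ 'n \<Rightarrow> real) set" where
  "B_lsc S \<xi> = {v \<in> B_space S \<xi>. lsc_on (state_set S) v}"

definition worst_case ::
  "('n::finite, 'm::finite, 'l::finite) control_problem \<Rightarrow> (real ^ 'n \<Rightarrow> real) \<Rightarrow> real ^ 'n \<Rightarrow> real ^ 'm \<Rightarrow> real" where
  "worst_case S v x u =
     (SUP \<mu>\<in>ambiguity_set S. cost S x u + discount S * upper_integral \<mu> (\<lambda>w. v (dyn S x u w)))"

definition bellman ::
  "('n::finite, 'm::finite, 'l::finite) control_problem \<Rightarrow> (real ^ 'n \<Rightarrow> real) \<Rightarrow> real ^ 'n \<Rightarrow> real" where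
  "bellman S v x = (INF u\<in>admissible S x. worst_case S v x u)"

definition policy_bellman ::
  "('n::finite, 'm::finite, 'l::finite) control_problem \<Rightarrow> (real ^ 'n \<Rightarrow> real ^ 'm) \<Rightarrow>
     (real ^ 'n \<Rightarrow> real) \<Rightarrow> real ^ 'n \<Rightarrow> real" where
  "policy_bellman S \<pi> v x = worst_case S v x (\<pi> x)"

definition sip_feasible ::
  "('n::finite, 'm::finite, 'l::finite) control_problem \<Rightarrow> (real ^ 'n \<Rightarrow> real) \<Rightarrow> real ^ 'n \<Rightarrow>
     real ^ 'm \<Rightarrow> real \<Rightarrow> (nat \<Rightarrow> real) \<Rightarrow> bool" where
  "sip_feasible S v x u \<rho> l \<longleftrightarrow>
     u \<in> admissible S x \<and> 0 \<le> \<rho> \<and>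
     (\<forall>w\<in>dist_set S. \<forall>i\<in>{1..sample_size S}.
        discount S * v (dyn S x u w) - \<rho> * dist_metric S w (sample S i) powr wass_order S \<le> l i)"

definition sip_objective ::
  "('n::finite, 'm::finite, 'l::finite) control_problem \<Rightarrow> real ^ 'n \<Rightarrow>
     real ^ 'm \<Rightarrow> real \<Rightarrow> (nat \<Rightarrow> real) \<Rightarrow> real" where
  "sip_objective S x u \<rho> l =
     \<rho> * radius S powr wass_order S + cost S x u + (\<Sum>i=1..sample_size S. l i) / real (sample_size S)"

definition sip_optimal_input ::
  "('n::finite, 'm::finite, 'l::finite) control_problem \<Rightarrow> (real ^ 'n \<Rightarrow> real) \<Rightarrow> real ^ 'n \<Rightarrow>
     real ^ 'm \<Rightarrow> bool" where
  "sip_optimal_input S v x u \<longleftrightarrow>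
     (\<exists>\<rho> l. sip_feasible S v x u \<rho> l \<and>
        (\<forall>u' \<rho>' l'. sip_feasible S v x u' \<rho>' l' \<longrightarrow>
           sip_objective S x u \<rho> l \<le> sip_objective S x u' \<rho>' l'))"

text \<open>
  \<open>v\<close> and \<open>\<pi>\<close> record the value functions and policies of a run of \<open>k\<close> iterations with evaluation
  depths \<open>M\<close>; any choice among several optimal inputs is allowed, as long as \<open>\<pi> j\<close> is measurable.
\<close>

definition modified_PI ::
  "('n::finite, 'm::finite, 'l::finite) control_problem \<Rightarrow> (real ^ 'n \<Rightarrow> real) \<Rightarrow> (nat \<Rightarrow> nat) \<Rightarrow> nat \<Rightarrow>
     (nat \<Rightarrow> real ^ 'n \<Rightarrow> real) \<Rightarrow> (nat \<Rightarrow> real ^ 'n \<Rightarrow> real ^ 'm) \<Rightarrow> bool" where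
  "modified_PI S \<xi> M k v \<pi> \<longleftrightarrow>
     v 0 \<in> B_lsc S \<xi> \<and> (\<forall>j\<ge>1. 0 < M j) \<and>
     (\<forall>j\<in>{1..k}.
        \<pi> j \<in> det_stationary S \<and>
        (\<forall>x\<in>state_set S. sip_optimal_input S (v (j - 1)) x (\<pi> j x)) \<and>
        (\<forall>x\<in>state_set S. v j x = (policy_bellman S (\<pi> j) ^^ M j) (v (j - 1)) x))"

end

theory Submission
  imports Defs
begin

text \<open>
  On functions bounded by a multiple of \<open>\<xi>\<close>, the operators \<open>T\<close> and \<open>T\<^sup>\<pi>\<close> are monotone, and
  adding \<open>a \<xi>\<close> to the argument raises the result by at most \<open>\<tau> a \<xi>\<close>.  Strong duality turns the optimal input of
  the semi-infinite program into \<open>T\<^sup>\<pi> v = T v\<close> for \<open>v = v\<^sub>j\<close> and \<open>\<pi> = \<pi>\<^sub>j\<^sub>+\<^sub>1\<close>.  Hence the residuals satisfy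
  \<open>T v\<^sub>j \<le> v\<^sub>j + \<tau>\<^sup>j r \<xi>\<close>, and comparing \<open>v\<^sub>j\<close> with \<open>w = T\<^sup>n v\<^sub>0\<close> gives
  \<open>v\<^sub>j \<le> w + ((j + 1) \<tau>\<^sup>j + \<tau>\<^sup>n) r / (1 - \<tau>) \<xi>\<close>.

  The value of \<open>\<pi>\<^sub>k\<close> is bounded above by supersolutions of \<open>T\<^sup>\<pi>\<close>, which need not be measurable:
  the costs-to-go of a fixed play are measurable and are compared with them pointwise, by backward
  induction.  The optimal value is bounded below by \<open>w\<close>, up to \<open>O(\<tau>\<^sup>n)\<close>: since \<open>T\<close> preserves lower
  semicontinuity, an adversary has a measurable nearly worst-case response against \<open>w\<close>, whatever the
  policy.  Letting \<open>n\<close> tend to infinity bounds the error of \<open>\<pi>\<^sub>k\<close> by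
  \<open>(k + 1) \<tau>\<^sup>k r / (1 - \<tau>) \<le> 2 k \<tau>\<^sup>k r / (1 - \<tau>)\<^sup>2 < \<epsilon>\<close>.
\<close>

text \<open>The factor \<open>k\<close> in the error bound comes from the evaluation steps.
  Evaluating a greedy policy, to whatever depth, gives at most \<open>T v_j\<close> plus a surplus
  \<open>\<tau> / (1 - \<tau>) * \<tau>^j * r * \<xi>\<close>. The later iterations contract by
  \<open>\<tau>\<close> each, so every one of the \<open>k\<close> surpluses arrives at the end with
  the same weight \<open>\<tau>^k * r / (1 - \<tau>)\<close>; the initial distance between
  \<open>v_0\<close> and the limit contributes it once more. The iterates are not monotone, because
  \<open>T v_0 \<le> v_0\<close> is not assumed; only upper residuals are propagated. This is
  enough, since the value of \<open>\<pi>_k\<close> is trivially at least the optimal value and only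
  the opposite inequality needs work. The obstacle is measurability. Neither value function is
  identified as a fixed point of an operator. Wherever a possibly non-measurable function has to be
  integrated along a play, measurable minorants stand in for it; wherever Player II has to react
  measurably, only iterates of \<open>T\<close> itself occur, which stay lower
  semicontinuous.\<close>

section \<open>Integration against kernels\<close>

text \<open>In the applications \<open>f\<close> is unbounded and need not be integrable against
  every \<open>N x\<close>. Finiteness of the iterated integral of the modulus confines the failures
  to a null set, and the formula for nonnegative integrands is applied to the positive and the
  negative part.\<close>

lemma
  fixes f :: "'b \<Rightarrow> real"
  assumes N[measurable]: "N \<in> M \<rightarrow>\<^sub>M subprob_algebra B"
    and f[measurable]: "f \<in> borel_measurable B"
    and fin: "(\<integral>\<^sup>+x. \<integral>\<^sup>+y. ennreal \<bar>f y\<bar> \<partial>N x \<partial>M) < \<infinity>"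
  shows integrable_integral_kernel: "integrable M (\<lambda>x. \<integral>y. f y \<partial>N x)"
    and integral_bind_kernel: "(\<integral>y. f y \<partial>(M \<bind> N)) = (\<integral>x. \<integral>y. f y \<partial>N x \<partial>M)"
proof -
  have int: "integrable (M \<bind> N) f"
  proof (cases "space M = {}")
    case True
    then show ?thesis by (simp add: bind_empty integrable_count_space)
  next
    case False
    then have "f \<in> borel_measurable (M \<bind> N)"
      using f by (simp add: measurable_cong_sets[OF sets_bind_measurable[OF N] refl])
    moreover have "(\<integral>\<^sup>+y. ennreal \<bar>f y\<bar> \<partial>(M \<bind> N)) < \<infinity>"
      using fin by (simp add: nn_integral_bind[where B=B])
    ultimately show ?thesis
      by (intro integrableI_bounded) auto
  qed
  define p where "p x = (\<integral>\<^sup>+y. ennreal (f y) \<partial>N x)" for x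
  define q where "q x = (\<integral>\<^sup>+y. ennreal (- f y) \<partial>N x)" for x
  have [measurable]: "p \<in> borel_measurable M" "q \<in> borel_measurable M"
    unfolding p_def q_def
    by (auto intro!: measurable_compose[OF N] nn_integral_measurable_subprob_algebra)
  have bp: "(\<integral>\<^sup>+x. p x \<partial>M) < \<infinity>" and bq: "(\<integral>\<^sup>+x. q x \<partial>M) < \<infinity>"
    unfolding p_def q_def
    by (rule le_less_trans[OF _ fin], intro nn_integral_mono ennreal_leI, simp)+
  have fp: "AE x in M. p x \<noteq> \<infinity>" using bp by (intro nn_integral_PInf_AE) auto
  have fq: "AE x in M. q x \<noteq> \<infinity>" using bq by (intro nn_integral_PInf_AE) auto
  have "AE x in M. (\<integral>\<^sup>+y. ennreal \<bar>f y\<bar> \<partial>N x) \<noteq> \<infinity>"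
    using fin by (intro nn_integral_PInf_AE)
      (auto intro!: measurable_compose[OF N] nn_integral_measurable_subprob_algebra)
  then have eq: "AE x in M. (\<integral>y. f y \<partial>N x) = enn2real (p x) - enn2real (q x)"
    using AE_space
  proof eventually_elim
    case (elim x)
    then have "f \<in> borel_measurable (N x)"
      using f by (simp add: measurable_cong_sets[OF sets_kernel[OF N] refl])
    then have "integrable (N x) f"
      using elim by (intro integrableI_bounded) (auto simp: top.not_eq_extremum)
    then show ?case unfolding p_def q_def by (rule real_lebesgue_integral_def)
  qed
  have enn: "(\<integral>\<^sup>+x. ennreal (enn2real (g x)) \<partial>M) = (\<integral>\<^sup>+x. g x \<partial>M)"
    if "AE x in M. g x \<noteq> \<infinity>" for g
    using that by (intro nn_integral_cong_AE) (auto simp: top.not_eq_extremum)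
  have ip: "integrable M (\<lambda>x. enn2real (p x))" and iq: "integrable M (\<lambda>x. enn2real (q x))"
    using bp bq by (auto intro!: integrableI_nonneg simp: enn[OF fp] enn[OF fq])
  have meas: "(\<lambda>x. \<integral>y. f y \<partial>N x) \<in> borel_measurable M"
    by (rule measurable_compose[OF N integral_measurable_subprob_algebra[OF f]])
  show "integrable M (\<lambda>x. \<integral>y. f y \<partial>N x)"
    using Bochner_Integration.integrable_diff[OF ip iq] eq meas
    by (subst integrable_cong_AE[OF _ _ eq]) auto
  have "(\<integral>y. f y \<partial>(M \<bind> N)) = enn2real (\<integral>\<^sup>+x. p x \<partial>M) - enn2real (\<integral>\<^sup>+x. q x \<partial>M)"
    unfolding real_lebesgue_integral_def[OF int] p_def q_def
    by (simp add: nn_integral_bind[where B=B])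
  also have "\<dots> = (\<integral>x. enn2real (p x) \<partial>M) - (\<integral>x. enn2real (q x) \<partial>M)"
    using ip iq by (simp add: integral_eq_nn_integral enn[OF fp] enn[OF fq])
  also have "\<dots> = (\<integral>x. enn2real (p x) - enn2real (q x) \<partial>M)"
    using ip iq by simp
  also have "\<dots> = (\<integral>x. \<integral>y. f y \<partial>N x \<partial>M)"
    using eq meas by (intro integral_cong_AE) auto
  finally show "(\<integral>y. f y \<partial>(M \<bind> N)) = (\<integral>x. \<integral>y. f y \<partial>N x \<partial>M)" .
qed

text \<open>
  \<open>P\<close> need not be a measurable predicate; this is what makes almost-sure membership in
  the ambiguity set and in the sets of admissible inputs provable for Dirac kernels.
\<close>

lemma AE_return_singleton:
  assumes "x \<in> space M" "{x} \<in> sets M" "P x"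
  shows "AE y in return M x. P y"
proof (rule AE_I'[of "space M - {x}"])
  show "space M - {x} \<in> null_sets (return M x)"
    using assms by (auto simp: null_sets_def)
  show "{y \<in> space (return M x). \<not> P y} \<subseteq> space M - {x}"
    using assms by auto
qed

text \<open>A law is determined by its values on the finite intersections of basic open sets, a
  countable generator stable under intersection. So the singleton is a countable intersection of
  level sets of evaluation maps. It is needed for point masses at laws in
  \<open>adversaries\<close>.\<close>

lemma sets_prob_algebra_singleton:
  fixes A :: "'a::second_countable_topology set"
  assumes A: "A \<in> sets borel" and \<mu>: "\<mu> \<in> space (prob_algebra (restrict_space borel A))"
  shows "{\<mu>} \<in> sets (prob_algebra (restrict_space borel A))"
proof -
  let ?B = "restrict_space borel A :: 'a measure"
  obtain G :: "'a set set" where G: "countable G" "topological_basis G"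
    using ex_countable_basis by blast
  define E where "E = (\<lambda>F. A \<inter> \<Inter>F) ` {F. finite F \<and> F \<subseteq> G}"
  have op: "open g" if "g \<in> G" for g using G(2) that by (rule topological_basis_open)
  have "countable E"
    unfolding E_def by (intro countable_image countable_Collect_finite_subset G)
  have EB: "E \<subseteq> sets ?B"
    unfolding E_def sets_restrict_space using op by (force intro!: imageI borel_open)
  have Int: "Int_stable E"
  proof (rule Int_stableI)
    fix a b assume "a \<in> E" "b \<in> E"
    then obtain F F' where "finite F" "F \<subseteq> G" "a = A \<inter> \<Inter>F" "finite F'" "F' \<subseteq> G" "b = A \<inter> \<Inter>F'"
      unfolding E_def by auto
    then show "a \<inter> b \<in> E"
      unfolding E_def by (intro image_eqI[of _ _ "F \<union> F'"]) auto
  qed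
  have sE: "sets ?B = sigma_sets A E"
  proof -
    have b: "sets (borel :: 'a measure) = sigma_sets UNIV G"
      by (subst borel_eq_countable_basis[OF G]) simp
    have "sets ?B = sigma_sets A ((\<inter>) A ` G)"
      unfolding sets_restrict_space b
      using restricted_sigma[of A UNIV G] A b by simp
    also have "\<dots> = sigma_sets A E"
    proof (rule sigma_sets_eqI)
      fix a assume "a \<in> (\<inter>) A ` G"
      then obtain g where "g \<in> G" "a = A \<inter> \<Inter>{g}" by auto
      then have "a \<in> E" unfolding E_def by (auto intro!: image_eqI[of _ _ "{g}"])
      then show "a \<in> sigma_sets A E" by auto
    next
      fix b assume "b \<in> E"
      then have "b \<in> sets ?B" using EB by auto
      then show "b \<in> sigma_sets A ((\<inter>) A ` G)" using calculation by simp
    qed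
    finally show ?thesis .
  qed
  \<comment> \<open>The empty family contributes \<open>A\<close> itself.\<close>
  have Epow: "E \<subseteq> Pow A" "A \<in> E"
    unfolding E_def by (auto intro!: image_eqI[of _ _ "{}"])
  have "{\<mu>} = space (prob_algebra ?B) \<inter>
      (\<Inter>e\<in>E. {\<nu> \<in> space (prob_algebra ?B). measure \<nu> e = measure \<mu> e})" (is "_ = ?R")
  proof (intro set_eqI iffI)
    fix \<nu> assume \<nu>: "\<nu> \<in> ?R"
    have "\<nu> = \<mu>"
    proof (rule measure_eqI_generator_eq[OF Int Epow(1)])
      interpret n: prob_space \<nu> using \<nu> by (simp add: space_prob_algebra)
      interpret m: prob_space \<mu> using \<mu> by (simp add: space_prob_algebra)
      show "emeasure \<nu> X = emeasure \<mu> X" if "X \<in> E" for X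
        using \<nu> that by (simp add: n.emeasure_eq_measure m.emeasure_eq_measure)
      show "sets \<nu> = sigma_sets A E" "sets \<mu> = sigma_sets A E"
        using \<nu> \<mu> sE by (auto simp: space_prob_algebra)
      show "range (\<lambda>_::nat. A) \<subseteq> E" using Epow by auto
      show "emeasure \<nu> A \<noteq> \<infinity>" by simp
    qed auto
    then show "\<nu> \<in> {\<mu>}" by simp
  qed (use \<mu> in auto)
  also have "\<dots> \<in> sets (prob_algebra ?B)"
  proof (intro sets.Int sets.top sets.countable_INT' image_subsetI)
    show "countable E" "E \<noteq> {}" using \<open>countable E\<close> Epow by auto
  next
    fix e assume "e \<in> E"
    then have [measurable]: "e \<in> sets ?B" using EB by auto
    show "{\<nu> \<in> space (prob_algebra ?B). measure \<nu> e = measure \<mu> e} \<in> sets (prob_algebra ?B)"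
      by measurable
  qed
  finally show ?thesis .
qed

section \<open>Upper integrals and the worst-case operators\<close>

text \<open>The minorant \<open>l\<close> bounds the competing integrals from below; the infimum of
  a set of reals unbounded below would carry no information.\<close>

lemma upper_integral_le:
  assumes "integrable M h" "\<And>w. w \<in> space M \<Longrightarrow> g w \<le> h w"
    and "integrable M l" "\<And>w. w \<in> space M \<Longrightarrow> l w \<le> g w"
  shows "upper_integral M g \<le> integral\<^sup>L M h"
  unfolding upper_integral_def
proof (rule cInf_lower)
  show "bdd_below {integral\<^sup>L M h | h. integrable M h \<and> (\<forall>w\<in>space M. g w \<le> h w)}"
    using assms(3,4) by (intro bdd_belowI[of _ "integral\<^sup>L M l"])
      (auto intro!: integral_mono intro: order_trans)
qed (use assms in auto)

text \<open>The majorant \<open>h\<^sub>0\<close> makes the set of competitors nonempty.\<close>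

lemma le_upper_integral:
  assumes "integrable M h\<^sub>0" "\<And>w. w \<in> space M \<Longrightarrow> g w \<le> h\<^sub>0 w"
    and "\<And>h. integrable M h \<Longrightarrow> (\<And>w. w \<in> space M \<Longrightarrow> g w \<le> h w) \<Longrightarrow> a \<le> integral\<^sup>L M h"
  shows "a \<le> upper_integral M g"
  unfolding upper_integral_def
  by (rule cInf_greatest) (use assms in auto)

section \<open>Couplings and the Wasserstein ball\<close>

lemma wasserstein_leI:
  assumes "\<kappa> \<in> couplings B \<mu> \<nu>" "(\<integral>\<^sup>+z. ennreal (d (fst z) (snd z) powr p) \<partial>\<kappa>) \<le> ennreal (r powr p)"
    and "0 < p" "0 < r"
  shows "wasserstein B d p \<mu> \<nu> \<le> ennreal r"
proof -
  define I where "I = (INF \<kappa>\<in>couplings B \<mu> \<nu>. \<integral>\<^sup>+z. ennreal (d (fst z) (snd z) powr p) \<partial>\<kappa>)"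
  have I: "I \<le> ennreal (r powr p)"
    unfolding I_def using assms by (meson INF_lower order_trans)
  then have fin: "I \<noteq> \<infinity>" by (auto simp: top_unique)
  have "enn2real I \<le> r powr p"
    using I by (intro enn2real_leI) auto
  then have "enn2real I powr (1/p) \<le> (r powr p) powr (1/p)"
    using assms by (intro powr_mono2) auto
  also have "\<dots> = r" using assms by (simp add: powr_powr)
  finally show ?thesis
    using fin unfolding wasserstein_def I_def[symmetric] by (simp add: ennreal_leI)
qed

text \<open>The infimum over couplings is not known to be attained, hence the slack
  \<open>e\<close>, which is sent to zero in the application.\<close>

lemma wasserstein_leD:
  assumes "wasserstein B d p \<mu> \<nu> \<le> ennreal r" "0 < p" "0 < r" "0 < e"
  obtains \<kappa> where "\<kappa> \<in> couplings B \<mu> \<nu>"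
    "(\<integral>\<^sup>+z. ennreal (d (fst z) (snd z) powr p) \<partial>\<kappa>) < ennreal (r powr p + e)"
proof -
  define I where "I = (INF \<kappa>\<in>couplings B \<mu> \<nu>. \<integral>\<^sup>+z. ennreal (d (fst z) (snd z) powr p) \<partial>\<kappa>)"
  have fin: "I \<noteq> \<infinity>" and le: "enn2real I powr (1/p) \<le> r"
    using assms unfolding wasserstein_def I_def[symmetric]
    by (auto simp: Let_def top_unique split: if_splits)
  have "enn2real I = (enn2real I powr (1/p)) powr p"
    using assms by (simp add: powr_powr)
  also have "\<dots> \<le> r powr p" using assms le by (intro powr_mono2) auto
  finally have "ennreal (enn2real I) < ennreal (r powr p + e)"
    using assms by (intro ennreal_lessI) (auto intro: add_nonneg_pos)
  then have "I < ennreal (r powr p + e)"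
    using fin by (simp add: top.not_eq_extremum)
  then show ?thesis
    using that unfolding I_def by (auto simp: INF_less_iff)
qed

text \<open>\<open>b\<close> is the witness of the existential in Assumption A.
  \<open>admissible_nonempty\<close> makes the infimum in \<open>T\<close> meaningful; a run with at
  least one iteration provides it, because its policies choose an admissible input at every
  state.\<close>

locale robust_control =
  fixes S :: "('n::finite, 'm::finite, 'l::finite) control_problem"
    and \<xi> :: "real ^ 'n \<Rightarrow> real" and \<beta> b :: real
  assumes wp: "well_posed S" and assm: "assumption_A S \<xi> \<beta>"
    and b_nonneg: "0 \<le> b"
    and cost_bound: "\<And>x u. (x, u) \<in> graph_set S \<Longrightarrow> \<bar>cost S x u\<bar> \<le> b * \<xi> x"
    and admissible_nonempty: "\<And>x. x \<in> state_set S \<Longrightarrow> admissible S x \<noteq> {}"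
begin

abbreviation "X \<equiv> state_set S"
abbreviation "U \<equiv> input_set S"
abbreviation "W \<equiv> dist_set S"
abbreviation "K \<equiv> graph_set S"
abbreviation "Xs \<equiv> state_space S"
abbreviation "Us \<equiv> input_space S"
abbreviation "Ws \<equiv> dist_space S"
abbreviation "D \<equiv> ambiguity_set S"
abbreviation "\<alpha> \<equiv> discount S"
abbreviation "f \<equiv> dyn S"
definition "\<tau> = \<alpha> * \<beta>"

lemma space_simps[simp]: "space Xs = X" "space Us = U" "space Ws = W"
  by (simp_all add: state_space_def input_space_def dist_space_def space_restrict_space)

lemma borel_sets: "X \<in> sets borel" "U \<in> sets borel" "W \<in> sets borel"
  using wp by (auto simp: well_posed_def)

lemma dyn_measurable[measurable]:
  "(\<lambda>(x, u, w). f x u w) \<in> Xs \<Otimes>\<^sub>M (Us \<Otimes>\<^sub>M Ws) \<rightarrow>\<^sub>M Xs"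
  and cost_measurable[measurable]: "(\<lambda>(x, u). cost S x u) \<in> borel_measurable (Xs \<Otimes>\<^sub>M Us)"
  using wp by (auto simp: well_posed_def)

lemma discount: "0 < \<alpha>" "\<alpha> < 1" and beta: "1 \<le> \<beta>" and tau: "0 < \<tau>" "\<tau> < 1"
  using wp assm by (auto simp: well_posed_def assumption_A_def \<tau>_def field_simps)

lemma xi_ge_1: "x \<in> X \<Longrightarrow> 1 \<le> \<xi> x"
  using assm by (auto simp: assumption_A_def)

lemma xi_cont: "continuous_on X \<xi>"
  using assm by (auto simp: assumption_A_def)

lemma xi_measurable[measurable]: "\<xi> \<in> borel_measurable Xs"
  unfolding state_space_def by (rule borel_measurable_continuous_on_restrict[OF xi_cont])

lemma K_iff: "(x, u) \<in> K \<longleftrightarrow> x \<in> X \<and> u \<in> admissible S x"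
  using wp by (auto simp: well_posed_def graph_set_def)

lemma K_input: "(x, u) \<in> K \<Longrightarrow> u \<in> U"
  by (auto simp: graph_set_def)

lemma K_state: "(x, u) \<in> K \<Longrightarrow> x \<in> X"
  by (auto simp: graph_set_def)

lemma dyn_in: "x \<in> X \<Longrightarrow> u \<in> U \<Longrightarrow> w \<in> W \<Longrightarrow> f x u w \<in> X"
  using measurable_space[OF dyn_measurable, of "(x, u, w)"] by (simp add: space_pair_measure)

lemma dyn_section[measurable]:
  assumes "x \<in> X" "u \<in> U" shows "f x u \<in> Ws \<rightarrow>\<^sub>M Xs"
proof -
  have "(\<lambda>w. (x, u, w)) \<in> Ws \<rightarrow>\<^sub>M Xs \<Otimes>\<^sub>M (Us \<Otimes>\<^sub>M Ws)"
    using assms by (intro measurable_Pair measurable_const) auto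
  from measurable_compose[OF this dyn_measurable] show ?thesis by simp
qed

lemma D_prob: "\<mu> \<in> D \<Longrightarrow> \<mu> \<in> space (prob_algebra Ws)"
  by (simp add: ambiguity_set_def)

lemma D_D: assumes "\<mu> \<in> D" shows "prob_space \<mu>" "sets \<mu> = sets Ws" "space \<mu> = W"
  using D_prob[OF assms] by (auto simp: space_prob_algebra dest: sets_eq_imp_space_eq)

lemma xi_integrable: "\<mu> \<in> D \<Longrightarrow> (x, u) \<in> K \<Longrightarrow> integrable \<mu> (\<lambda>w. \<xi> (f x u w))"
  and xi_integral_le: "\<mu> \<in> D \<Longrightarrow> (x, u) \<in> K \<Longrightarrow> (\<integral>w. \<xi> (f x u w) \<partial>\<mu>) \<le> \<beta> * \<xi> x"
  using assm by (auto simp: assumption_A_def)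

lemma params: "1 \<le> wass_order S" "0 < radius S" "1 \<le> sample_size S"
   "\<And>i. i \<in> {1..sample_size S} \<Longrightarrow> sample S i \<in> W"
   "Metric_space W (dist_metric S)"
   "(\<lambda>(w, w'). dist_metric S w w') \<in> borel_measurable (Ws \<Otimes>\<^sub>M Ws)"
  using wp by (auto simp: well_posed_def)

lemma sample_measurable: "sample S \<in> uniform_count_measure {1..sample_size S} \<rightarrow>\<^sub>M Ws"
  using params(4) by (auto simp: uniform_count_measure_def)

lemma empirical_prob: "prob_space (empirical S)"
  unfolding empirical_def using params(3)
  by (intro prob_space.prob_space_distr prob_space_uniform_count_measure sample_measurable) auto

lemma sets_empirical[simp, measurable_cong]: "sets (empirical S) = sets Ws"
  by (simp add: empirical_def)

text \<open>The diagonal coupling transports the empirical law to itself at zero cost. This makes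
  the suprema over \<open>D\<close> range over a nonempty set.\<close>

lemma empirical_in_D: "empirical S \<in> D"
proof -
  interpret Metric_space W "dist_metric S" by (rule params)
  interpret e: prob_space "empirical S" by (rule empirical_prob)
  let ?d = "\<lambda>w. (w, w)"
  have [measurable]: "?d \<in> empirical S \<rightarrow>\<^sub>M Ws \<Otimes>\<^sub>M Ws" by measurable
  let ?k = "distr (empirical S) (Ws \<Otimes>\<^sub>M Ws) ?d"
  have "distr ?k Ws fst = empirical S" "distr ?k Ws snd = empirical S"
    by (subst distr_distr; auto simp: comp_def intro!: distr_id2)+
  then have "?k \<in> couplings Ws (empirical S) (empirical S)"
    by (auto simp: couplings_def space_prob_algebra intro!: e.prob_space_distr)
  moreover have "(\<integral>\<^sup>+z. ennreal (dist_metric S (fst z) (snd z) powr wass_order S) \<partial>?k) = 0"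
  proof -
    note params(6)[measurable]
    have "(\<integral>\<^sup>+z. ennreal (dist_metric S (fst z) (snd z) powr wass_order S) \<partial>?k)
       = (\<integral>\<^sup>+w. ennreal (dist_metric S w w powr wass_order S) \<partial>empirical S)"
      by (subst nn_integral_distr) (auto simp: split_beta')
    also have "\<dots> = (\<integral>\<^sup>+w. 0 \<partial>empirical S)"
      using sets_eq_imp_space_eq[OF sets_empirical] by (intro nn_integral_cong) auto
    finally show ?thesis by simp
  qed
  ultimately show ?thesis
    using params(1,2) empirical_prob
    by (auto simp: ambiguity_set_def space_prob_algebra intro!: wasserstein_leI)
qed

lemma D_nonempty: "D \<noteq> {}" using empirical_in_D by auto

text \<open>No measurability is required, so that the class is closed under the operators \<open>T\<^sup>\<pi>\<close>.\<close>

definition bounded_by :: "real \<Rightarrow> (real ^ 'n \<Rightarrow> real) \<Rightarrow> bool"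
  where "bounded_by C v \<longleftrightarrow> 0 \<le> C \<and> (\<forall>x\<in>X. \<bar>v x\<bar> \<le> C * \<xi> x)"

section \<open>The operators on functions bounded by a multiple of the weight\<close>

lemma xi_integral_scaled:
  assumes "\<mu> \<in> D" "(x, u) \<in> K" "0 \<le> a"
  shows "\<alpha> * (a * (\<integral>w. \<xi> (f x u w) \<partial>\<mu>)) \<le> \<tau> * a * \<xi> x"
proof -
  have "a * (\<integral>w. \<xi> (f x u w) \<partial>\<mu>) \<le> a * (\<beta> * \<xi> x)"
    using xi_integral_le[OF assms(1,2)] assms(3) by (intro mult_left_mono)
  from mult_left_mono[OF this, of \<alpha>]
  have "\<alpha> * (a * (\<integral>w. \<xi> (f x u w) \<partial>\<mu>)) \<le> \<alpha> * (a * (\<beta> * \<xi> x))"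
    using discount by simp
  then show ?thesis by (simp add: \<tau>_def algebra_simps)
qed

lemma bounded_by_dyn:
  assumes "bounded_by C v" "(x, u) \<in> K" "w \<in> W"
  shows "v (f x u w) \<le> C * \<xi> (f x u w)" "- (C * \<xi> (f x u w)) \<le> v (f x u w)"
  using assms(1) dyn_in[OF K_state[OF assms(2)] K_input[OF assms(2)] assms(3)]
  by (auto simp: bounded_by_def abs_le_iff minus_le_iff)

lemma upper_integral_bounds:
  assumes v: "bounded_by C v" and \<mu>: "\<mu> \<in> D" and k: "(x, u) \<in> K"
  shows "\<bar>\<alpha> * upper_integral \<mu> (\<lambda>w. v (f x u w))\<bar> \<le> \<tau> * C * \<xi> x"
proof -
  have int: "integrable \<mu> (\<lambda>w. C * \<xi> (f x u w))" "integrable \<mu> (\<lambda>w. - (C * \<xi> (f x u w)))"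
    using xi_integrable[OF \<mu> k] by auto
  note b = bounded_by_dyn[OF v k]
  have 1: "upper_integral \<mu> (\<lambda>w. v (f x u w)) \<le> C * (\<integral>w. \<xi> (f x u w) \<partial>\<mu>)"
    using upper_integral_le[OF int(1) _ int(2), of "\<lambda>w. v (f x u w)"] b D_D[OF \<mu>] by simp
  have 2: "- (C * (\<integral>w. \<xi> (f x u w) \<partial>\<mu>)) \<le> upper_integral \<mu> (\<lambda>w. v (f x u w))"
  proof (rule le_upper_integral[OF int(1)])
    fix h assume h: "integrable \<mu> h" "\<And>w. w \<in> space \<mu> \<Longrightarrow> v (f x u w) \<le> h w"
    have "(\<integral>w. - (C * \<xi> (f x u w)) \<partial>\<mu>) \<le> integral\<^sup>L \<mu> h"
      using int h b D_D[OF \<mu>] by (intro integral_mono) (auto intro: order_trans)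
    then show "- (C * (\<integral>w. \<xi> (f x u w) \<partial>\<mu>)) \<le> integral\<^sup>L \<mu> h" by simp
  qed (use b D_D[OF \<mu>] in auto)
  have "\<bar>upper_integral \<mu> (\<lambda>w. v (f x u w))\<bar> \<le> C * (\<integral>w. \<xi> (f x u w) \<partial>\<mu>)" using 1 2 by auto
  then have "\<alpha> * \<bar>upper_integral \<mu> (\<lambda>w. v (f x u w))\<bar> \<le> \<alpha> * (C * (\<integral>w. \<xi> (f x u w) \<partial>\<mu>))"
    using discount by (intro mult_left_mono) auto
  also have "\<dots> \<le> \<tau> * C * \<xi> x"
    using v by (intro xi_integral_scaled \<mu> k) (auto simp: bounded_by_def)
  finally show ?thesis using discount by (simp add: abs_mult)
qed

lemma objective_bounds:
  assumes "bounded_by C v" "\<mu> \<in> D" "(x, u) \<in> K"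
  shows "\<bar>cost S x u + \<alpha> * upper_integral \<mu> (\<lambda>w. v (f x u w))\<bar> \<le> (b + \<tau> * C) * \<xi> x"
  using upper_integral_bounds[OF assms] cost_bound[OF assms(3)] by (simp add: algebra_simps)

lemma worst_case_upper:
  assumes "bounded_by C v" "\<mu> \<in> D" "(x, u) \<in> K"
  shows "cost S x u + \<alpha> * upper_integral \<mu> (\<lambda>w. v (f x u w)) \<le> worst_case S v x u"
  unfolding worst_case_def using objective_bounds[OF assms(1) _ assms(3)]
  by (intro cSUP_upper assms bdd_aboveI2[of _ _ "(b + \<tau> * C) * \<xi> x"]) (auto simp: abs_le_iff)

lemma worst_case_least:
  assumes "\<And>\<mu>. \<mu> \<in> D \<Longrightarrow> cost S x u + \<alpha> * upper_integral \<mu> (\<lambda>w. v (f x u w)) \<le> a"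
  shows "worst_case S v x u \<le> a"
  unfolding worst_case_def using assms D_nonempty by (intro cSUP_least)

lemma worst_case_bounds:
  assumes "bounded_by C v" "(x, u) \<in> K"
  shows "\<bar>worst_case S v x u\<bar> \<le> (b + \<tau> * C) * \<xi> x"
proof -
  have "worst_case S v x u \<le> (b + \<tau> * C) * \<xi> x"
    using objective_bounds[OF assms(1) _ assms(2)] by (intro worst_case_least) (auto simp: abs_le_iff)
  moreover have "- ((b + \<tau> * C) * \<xi> x) \<le> worst_case S v x u"
    using worst_case_upper[OF assms(1) empirical_in_D assms(2)]
      objective_bounds[OF assms(1) empirical_in_D assms(2)] by linarith
  ultimately show ?thesis by linarith
qed

text \<open>If \<open>h\<close> majorizes \<open>v'\<close> along the dynamics, then
  \<open>h + a * \<xi>\<close> majorizes \<open>v\<close>. The perturbation is integrable, so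
  additivity is used only for ordinary integrals and never for upper ones.\<close>

lemma worst_case_mono:
  assumes v: "bounded_by C v" and v': "bounded_by C' v'" and k: "(x, u) \<in> K" and a: "0 \<le> a"
    and le: "\<And>x. x \<in> X \<Longrightarrow> v x \<le> v' x + a * \<xi> x"
  shows "worst_case S v x u \<le> worst_case S v' x u + \<tau> * a * \<xi> x"
proof (rule worst_case_least)
  fix \<mu> assume \<mu>: "\<mu> \<in> D"
  note W = D_D(3)[OF \<mu>]
  let ?x = "\<lambda>w. \<xi> (f x u w)"
  have xi: "integrable \<mu> ?x" by (rule xi_integrable[OF \<mu> k])
  have "upper_integral \<mu> (\<lambda>w. v (f x u w)) - a * integral\<^sup>L \<mu> ?x \<le> upper_integral \<mu> (\<lambda>w. v' (f x u w))"
  proof (rule le_upper_integral)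
    show "integrable \<mu> (\<lambda>w. C' * ?x w)" using xi by simp
    show "v' (f x u w) \<le> C' * ?x w" if "w \<in> space \<mu>" for w
      using bounded_by_dyn[OF v' k] that W by auto
    fix h assume h: "integrable \<mu> h" "\<And>w. w \<in> space \<mu> \<Longrightarrow> v' (f x u w) \<le> h w"
    have "upper_integral \<mu> (\<lambda>w. v (f x u w)) \<le> (\<integral>w. h w + a * ?x w \<partial>\<mu>)"
    proof (rule upper_integral_le)
      show "v (f x u w) \<le> h w + a * ?x w" if "w \<in> space \<mu>" for w
        using h(2)[OF that] le[OF dyn_in[OF K_state[OF k] K_input[OF k]], of w] that W by auto
      show "- (C * ?x w) \<le> v (f x u w)" if "w \<in> space \<mu>" for w
        using bounded_by_dyn[OF v k] that W by auto
    qed (use xi h in auto)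
    also have "\<dots> = integral\<^sup>L \<mu> h + a * integral\<^sup>L \<mu> ?x" using xi h by simp
    finally show "upper_integral \<mu> (\<lambda>w. v (f x u w)) - a * integral\<^sup>L \<mu> ?x \<le> integral\<^sup>L \<mu> h" by simp
  qed
  then have "\<alpha> * upper_integral \<mu> (\<lambda>w. v (f x u w))
     \<le> \<alpha> * (upper_integral \<mu> (\<lambda>w. v' (f x u w)) + a * integral\<^sup>L \<mu> ?x)"
    using discount by (intro mult_left_mono) auto
  then show "cost S x u + \<alpha> * upper_integral \<mu> (\<lambda>w. v (f x u w)) \<le> worst_case S v' x u + \<tau> * a * \<xi> x"
    using xi_integral_scaled[OF \<mu> k a] worst_case_upper[OF v' \<mu> k] by (simp add: algebra_simps)
qed

lemma bellman_lower:
  assumes "bounded_by C v" "(x, u) \<in> K"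
  shows "bellman S v x \<le> worst_case S v x u"
  unfolding bellman_def
proof (rule cINF_lower)
  show "bdd_below (worst_case S v x ` admissible S x)"
    using worst_case_bounds[OF assms(1), of x] assms(2)
    by (intro bdd_belowI2[of _ "- ((b + \<tau> * C) * \<xi> x)"]) (auto simp: K_iff abs_le_iff minus_le_iff)
qed (use assms(2) K_iff in auto)

lemma bellman_greatest:
  assumes "x \<in> X" "\<And>u. u \<in> admissible S x \<Longrightarrow> a \<le> worst_case S v x u"
  shows "a \<le> bellman S v x"
  unfolding bellman_def using admissible_nonempty assms by (intro cINF_greatest) auto

lemma bellman_bounded_by:
  assumes "bounded_by C v" shows "bounded_by (b + \<tau> * C) (bellman S v)"
  unfolding bounded_by_def
proof safe
  show "0 \<le> b + \<tau> * C" using assms b_nonneg tau by (auto simp: bounded_by_def)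
  fix x assume x: "x \<in> X"
  obtain u where "u \<in> admissible S x" using admissible_nonempty[OF x] by blast
  then have "(x, u) \<in> K" using x K_iff by auto
  then have "bellman S v x \<le> (b + \<tau> * C) * \<xi> x"
    using bellman_lower[OF assms] worst_case_bounds[OF assms] by (fastforce simp: abs_le_iff)
  moreover have "- ((b + \<tau> * C) * \<xi> x) \<le> bellman S v x"
  proof (rule bellman_greatest[OF x])
    fix u assume "u \<in> admissible S x"
    then have "(x, u) \<in> K" using x K_iff by auto
    then show "- ((b + \<tau> * C) * \<xi> x) \<le> worst_case S v x u"
      using worst_case_bounds[OF assms] by (fastforce simp: abs_le_iff)
  qed
  ultimately show "\<bar>bellman S v x\<bar> \<le> (b + \<tau> * C) * \<xi> x" by auto
qed

lemma bellman_mono: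
  assumes "bounded_by C v" "bounded_by C' v'" "0 \<le> a" "x \<in> X"
    and "\<And>x. x \<in> X \<Longrightarrow> v x \<le> v' x + a * \<xi> x"
  shows "bellman S v x \<le> bellman S v' x + \<tau> * a * \<xi> x"
proof -
  have "bellman S v x - \<tau> * a * \<xi> x \<le> bellman S v' x"
  proof (rule bellman_greatest[OF assms(4)])
    fix u assume "u \<in> admissible S x"
    then have k: "(x, u) \<in> K" using assms(4) K_iff by auto
    show "bellman S v x - \<tau> * a * \<xi> x \<le> worst_case S v' x u"
      using worst_case_mono[OF assms(1,2) k assms(3,5)] bellman_lower[OF assms(1) k] by linarith
  qed
  then show ?thesis by simp
qed

end

section \<open>Strong duality of the semi-infinite program\<close>

text \<open>The quadrant is unbounded towards small \<open>s\<close> and large \<open>t\<close>,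
  which fixes the signs of the normal of a separating line. The point of \<open>H\<close> over
  \<open>0 < s\<^sub>1\<close> acts as a Slater point: it rules out a vertical line, so the normal
  can be scaled to \<open>t - \<rho> * s\<close>.\<close>

lemma separating_quadrant:
  fixes H :: "(real \<times> real) set"
  assumes H: "convex H" "(0, t\<^sub>0) \<in> H" and s: "0 < s\<^sub>1"
    and le: "\<And>s t. (s, t) \<in> H \<Longrightarrow> s < s\<^sub>1 \<Longrightarrow> t \<le> t\<^sub>1"
  obtains \<rho> where "0 \<le> \<rho>" "\<And>s t. (s, t) \<in> H \<Longrightarrow> t - \<rho> * s \<le> t\<^sub>1 - \<rho> * s\<^sub>1"
proof -
  let ?B = "{..<s\<^sub>1} \<times> {t\<^sub>1<..}"
  have "convex ?B" by (intro convex_Times) auto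
  moreover have "?B \<noteq> {}" by auto
  moreover have "H \<inter> ?B = {}" using le by fastforce
  ultimately obtain a c where a: "a \<noteq> 0" "\<forall>x\<in>H. inner a x \<le> c" "\<forall>x\<in>?B. inner a x \<ge> c"
    using separating_hyperplane_sets[of H ?B] H by blast
  obtain a1 a2 where a12: "a = (a1, a2)" by (cases a)
  have hH: "a1 * s + a2 * t \<le> c" if "(s, t) \<in> H" for s t
    using a(2) that by (auto simp: a12)
  have hB: "c \<le> a1 * s + a2 * t" if "s < s\<^sub>1" "t\<^sub>1 < t" for s t
    using a(3) that by (auto simp: a12)
  have shift: "c \<le> a1 * s\<^sub>1 + a2 * t\<^sub>1 - a1 * e + a2 * e'" if "0 < e" "0 < e'" for e e'
    using hB[of "s\<^sub>1 - e" "t\<^sub>1 + e'"] that by (simp add: algebra_simps)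
  define R where "R = a1 * s\<^sub>1 + a2 * t\<^sub>1"
  have a2: "0 \<le> a2"
  proof (rule ccontr)
    assume "\<not> 0 \<le> a2"
    \<comment> \<open>Going up by \<open>y / (- a2)\<close> lowers the linear form by
      \<open>y\<close>, which is more than the separation permits. The sign of \<open>a1\<close> is
      found in the same way.\<close>
    moreover define y where "y = \<bar>c - R + a1\<bar> + 1"
    ultimately have "c \<le> R - a1 - y"
      using shift[of 1 "y / (- a2)"] by (simp add: R_def divide_neg_neg divide_pos_neg)
    then show False by (simp add: y_def)
  qed
  have a1: "a1 \<le> 0"
  proof (rule ccontr)
    assume "\<not> a1 \<le> 0"
    then have "c \<le> R + a2 - (\<bar>c - R - a2\<bar> + 1)"
      using shift[of "(\<bar>c - R - a2\<bar> + 1) / a1" 1] by (simp add: R_def)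
    then show False by linarith
  qed
  have cR: "c \<le> R"
  proof (rule ccontr)
    assume n: "\<not> c \<le> R"
    define k where "k = a2 - a1"
    have k: "0 \<le> k" using a1 a2 by (simp add: k_def)
    \<comment> \<open>A diagonal step of this length from the corner changes the form by less than
      the gap \<open>c - R\<close>, so the corner itself obeys the bound.\<close>
    define y where "y = (c - R) / (k + 1)"
    have "0 < y" using n k by (simp add: y_def)
    from shift[OF this this] have "c \<le> R + k * y" by (simp add: R_def k_def algebra_simps)
    then have "c \<le> R + k * ((c - R) / (k + 1))" by (simp add: y_def)
    then have "(c - R) * (k + 1) \<le> k * (c - R)" using k by (simp add: field_simps)
    then show False using n by (simp add: algebra_simps)
  qed
  \<comment> \<open>A vertical line would have \<open>a1 < 0\<close>, hence
    \<open>a1 * s\<^sub>1 < 0\<close>, but evaluation at the point over \<open>0\<close> gives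
    \<open>0 \<le> c\<close> and \<open>c\<close> is at most this product.\<close>
  have "a2 \<noteq> 0"
  proof
    assume z: "a2 = 0"
    then have "a1 < 0" using a1 a(1) a12 by (cases "a1 = 0") (auto simp: zero_prod_def)
    then have "a1 * s\<^sub>1 < 0" using s by (simp add: mult_neg_pos)
    moreover have "0 \<le> a1 * s\<^sub>1" using hH[OF H(2)] cR by (simp add: R_def z)
    ultimately show False by simp
  qed
  then have a2: "0 < a2" using a2 by simp
  show ?thesis
  proof (rule that[of "- a1 / a2"])
    show "0 \<le> - a1 / a2" using a1 a2 by (intro divide_nonneg_pos) auto
    fix s t assume "(s, t) \<in> H"
    from hH[OF this] have "a1 * s + a2 * t \<le> a1 * s\<^sub>1 + a2 * t\<^sub>1" using cR by (simp add: R_def)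
    then have "(a1 * s + a2 * t) / a2 \<le> (a1 * s\<^sub>1 + a2 * t\<^sub>1) / a2"
      using a2 by (intro divide_right_mono) auto
    then show "t - (- a1 / a2) * s \<le> t\<^sub>1 - (- a1 / a2) * s\<^sub>1"
      using a2 by (simp add: add_divide_distrib)
  qed
qed

context robust_control begin

abbreviation "I \<equiv> {1..sample_size S}"
abbreviation "N \<equiv> sample_size S"
abbreviation "s \<equiv> sample S"
definition "dp w w' = dist_metric S w w' powr wass_order S"
definition "\<theta> = radius S powr wass_order S"

lemma theta_pos: "0 < \<theta>"
  using params by (simp add: \<theta>_def)

lemma dp_measurable[measurable]: "(\<lambda>(w, w'). dp w w') \<in> borel_measurable (Ws \<Otimes>\<^sub>M Ws)"
  using params(6) unfolding dp_def by measurable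

lemma dp_nonneg[simp]: "0 \<le> dp w w'"
  by (simp add: dp_def)

lemma dp_self: "w \<in> W \<Longrightarrow> dp w w = 0"
proof -
  interpret Metric_space W "dist_metric S" by (rule params)
  show "w \<in> W \<Longrightarrow> dp w w = 0" by (simp add: dp_def)
qed

lemma singleton_sets_Ws: "w \<in> W \<Longrightarrow> {w} \<in> sets Ws"
  by (simp add: dist_space_def sets_restrict_space_iff borel_sets)

lemma AE_empirical: "AE w in empirical S. w \<in> s ` I"
proof -
  have "s ` I = (\<Union>i\<in>I. {s i})" by auto
  also have "\<dots> \<in> sets Ws"
    using params(4) by (intro sets.finite_UN) (auto intro: singleton_sets_Ws)
  finally have "s ` I \<in> sets Ws" .
  moreover have "{w \<in> space Ws. w \<in> s ` I} = s ` I" using params(4) by auto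
  ultimately have "{w \<in> space Ws. w \<in> s ` I} \<in> sets Ws" by simp
  then show ?thesis
    unfolding empirical_def
    by (subst AE_distr_iff[OF sample_measurable])
      (auto simp: space_uniform_count_measure intro!: AE_I2)
qed

text \<open>
  Feasibility bounds the possibly non-measurable \<open>\<alpha> v(f(x, u, w))\<close> by the measurable function
  \<open>h w = min\<^sub>i (l\<^sub>i + \<rho> d(w, w\<^sub>i)\<^sup>p)\<close>.  The auxiliary \<open>l'\<close> handles
  samples that coincide.
\<close>

lemma weak_duality:
  assumes v: "bounded_by C v" and x: "x \<in> X" and feas: "sip_feasible S v x u \<rho> l"
  shows "worst_case S v x u \<le> sip_objective S x u \<rho> l"
proof (rule worst_case_least)
  fix \<mu> assume \<mu>: "\<mu> \<in> D"
  have k: "(x, u) \<in> K" and \<rho>: "0 \<le> \<rho>"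
    and feas: "\<And>w i. w \<in> W \<Longrightarrow> i \<in> I \<Longrightarrow> \<alpha> * v (f x u w) \<le> l i + \<rho> * dp w (s i)"
    using feas x unfolding sip_feasible_def K_iff dp_def by (auto simp: algebra_simps)
  have I: "finite I" "I \<noteq> {}" using params(3) by auto
  define L where "L = (\<Sum>i\<in>I. \<bar>l i\<bar>)"
  have L: "l i \<le> L" "- l i \<le> L" if "i \<in> I" for i
    using member_le_sum[of i I "\<lambda>i. \<bar>l i\<bar>"] that by (auto simp: L_def)
  define h where "h w = Min ((\<lambda>i. l i + \<rho> * dp w (s i)) ` I)" for w
  \<comment> \<open>The second marginal of a coupling reveals the sample point but not its index. As
    \<open>L\<close> dominates every \<open>l i\<close>, the value at a sample is the least
    \<open>l i\<close> over all indices with that sample; elsewhere it is \<open>L\<close>.\<close>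
  define l' where "l' w' = Min ((\<lambda>i. if w' = s i then l i else L) ` I)" for w'
  have [measurable]: "(\<lambda>w. dp w (s i)) \<in> borel_measurable Ws" if "i \<in> I" for i
  proof -
    have "(\<lambda>w. (w, s i)) \<in> Ws \<rightarrow>\<^sub>M Ws \<Otimes>\<^sub>M Ws"
      using params(4)[OF that] by (intro measurable_Pair measurable_const) auto
    from measurable_compose[OF this dp_measurable] show ?thesis by simp
  qed
  have h_meas[measurable]: "h \<in> borel_measurable Ws"
    unfolding h_def using I by measurable
  have [measurable]: "Measurable.pred Ws (\<lambda>w. w = s i)" if "i \<in> I" for i
  proof -
    have "{w \<in> space Ws. w = s i} = {s i}" using params(4)[OF that] by auto
    then show ?thesis unfolding pred_def using singleton_sets_Ws params(4)[OF that] by simp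
  qed
  have [measurable]: "l' \<in> borel_measurable Ws"
    unfolding l'_def using I by measurable
  have h_le: "h w \<le> l i + \<rho> * dp w (s i)" if "i \<in> I" for w i
    unfolding h_def using I that by (intro Min_le) auto
  have h_ge: "\<alpha> * v (f x u w) \<le> h w" if "w \<in> W" for w
    unfolding h_def using I feas that by (intro Min.boundedI) auto
  have h_lower: "- (\<alpha> * (C * \<xi> (f x u w))) \<le> h w" if "w \<in> W" for w
  proof -
    have "\<alpha> * - (C * \<xi> (f x u w)) \<le> \<alpha> * v (f x u w)"
      using bounded_by_dyn(2)[OF v k that] discount by (intro mult_left_mono) auto
    then show ?thesis using h_ge[OF that] by simp
  qed
  have l'_ex: "\<exists>i\<in>I. l' w = (if w = s i then l i else L)" for w
  proof -
    have "l' w \<in> (\<lambda>i. if w = s i then l i else L) ` I"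
      unfolding l'_def by (rule Min_in) (use I in blast)+
    then show ?thesis by blast
  qed
  have bound: "(\<integral>w. h w \<partial>\<mu>) \<le> (\<Sum>i\<in>I. l i) / N + \<rho> * (\<theta> + e) \<and> integrable \<mu> h" if e: "0 < e" for e
  proof -
    have "wasserstein Ws (dist_metric S) (wass_order S) \<mu> (empirical S) \<le> ennreal (radius S)"
      using \<mu> by (simp add: ambiguity_set_def)
    from wasserstein_leD[OF this _ _ e] params
    obtain \<kappa> where \<kappa>: "\<kappa> \<in> couplings Ws \<mu> (empirical S)"
      and lt: "(\<integral>\<^sup>+z. ennreal (dp (fst z) (snd z)) \<partial>\<kappa>) < ennreal (\<theta> + e)"
      unfolding dp_def \<theta>_def by auto
    from \<kappa> have sets_k: "sets \<kappa> = sets (Ws \<Otimes>\<^sub>M Ws)" and pk: "prob_space \<kappa>"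
      and d1: "distr \<kappa> Ws fst = \<mu>" and d2: "distr \<kappa> Ws snd = empirical S"
      unfolding couplings_def space_prob_algebra by simp_all

    note sets_k[measurable_cong]
    interpret kp: prob_space \<kappa> by (rule pk)
    have fm: "fst \<in> \<kappa> \<rightarrow>\<^sub>M Ws" "snd \<in> \<kappa> \<rightarrow>\<^sub>M Ws" by measurable
    have sp: "fst z \<in> W" "snd z \<in> W" if "z \<in> space \<kappa>" for z
      using that unfolding sets_eq_imp_space_eq[OF sets_k] space_pair_measure space_simps
      by (simp_all add: mem_Times_iff)
    have dpm[measurable]: "(\<lambda>z. dp (fst z) (snd z)) \<in> borel_measurable \<kappa>"
      using dp_measurable by (simp add: split_beta' measurable_cong_sets[OF sets_k refl])
    have idp: "integrable \<kappa> (\<lambda>z. dp (fst z) (snd z))"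
      using lt by (intro integrableI_nonneg) (auto simp: order_less_trans)
    have "ennreal (\<integral>z. dp (fst z) (snd z) \<partial>\<kappa>) < ennreal (\<theta> + e)"
      using lt by (simp add: nn_integral_eq_integral[OF idp])
    then have dle: "(\<integral>z. dp (fst z) (snd z) \<partial>\<kappa>) \<le> \<theta> + e"
      using e theta_pos by (subst (asm) ennreal_less_iff) (auto intro: integral_nonneg_AE)
    have ixi: "integrable \<kappa> (\<lambda>z. \<xi> (f x u (fst z)))"
      by (rule integrable_distr[where M=\<kappa> and T=fst and M'=Ws])
        (use xi_integrable[OF \<mu> k] d1 fm in auto)
    have AE: "AE z in \<kappa>. snd z \<in> s ` I"
      using AE_empirical unfolding d2[symmetric] by (rule AE_distrD[rotated]) measurable
    have upper: "AE z in \<kappa>. h (fst z) \<le> l' (snd z) + \<rho> * dp (fst z) (snd z)"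
      using AE
    proof eventually_elim
      case (elim z)
      then obtain j where j: "j \<in> I" "snd z = s j" by auto
      \<comment> \<open>If the minimum comes from an index that does not match, its value
        \<open>L\<close> still dominates \<open>l j\<close> for the matching index
        \<open>j\<close>.\<close>
      obtain i where i: "i \<in> I" "l' (snd z) = (if snd z = s i then l i else L)"
        using l'_ex by blast
      show ?case
        using i h_le[OF i(1), of "fst z"] h_le[OF j(1), of "fst z"] L(1)[OF j(1)] j by (auto split: if_splits)
    qed
    have l'_b: "\<bar>l' w\<bar> \<le> L" for w
    proof -
      obtain i where "i \<in> I" "l' w = (if w = s i then l i else L)"
        using l'_ex by blast
      then show ?thesis using L[of i] by (auto simp: L_def sum_nonneg)
    qed
    have il': "integrable \<kappa> (\<lambda>z. l' (snd z))"
      by (rule finite_measure.integrable_const_bound[OF prob_space.finite_measure[OF pk], where B=L]) (use l'_b in auto)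
    have ih: "integrable \<kappa> (\<lambda>z. h (fst z))"
    proof (rule Bochner_Integration.integrable_bound)
      \<comment> \<open>\<open>h\<close> lies between minus the last summand and, almost surely, the
        first two, so their sum dominates its modulus.\<close>
      show "integrable \<kappa> (\<lambda>z. (L + \<rho> * dp (fst z) (snd z)) + \<alpha> * (C * \<xi> (f x u (fst z))))"
        using idp ixi by simp
      show "AE z in \<kappa>. norm (h (fst z)) \<le> norm ((L + \<rho> * dp (fst z) (snd z)) + \<alpha> * (C * \<xi> (f x u (fst z))))"
        using upper AE_space
      proof eventually_elim
        case (elim z)
        have "0 \<le> \<rho> * dp (fst z) (snd z)" using \<rho> by simp
        moreover have "0 \<le> C" using v by (simp add: bounded_by_def)
        moreover have "1 \<le> \<xi> (f x u (fst z))"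
          using sp(1)[OF elim(2)] dyn_in[OF K_state[OF k] K_input[OF k]] by (intro xi_ge_1) auto
        ultimately have "0 \<le> \<alpha> * (C * \<xi> (f x u (fst z)))" using discount by (intro mult_nonneg_nonneg) auto
        moreover have "0 \<le> L" by (simp add: L_def sum_nonneg)
        ultimately show ?case
          using elim(1) l'_b[of "snd z"] h_lower[OF sp(1)[OF elim(2)]] \<open>0 \<le> \<rho> * _\<close> by auto
      qed
    qed measurable
    have "(\<integral>w. h w \<partial>\<mu>) = (\<integral>z. h (fst z) \<partial>\<kappa>)"
      unfolding d1[symmetric] by (rule integral_distr) measurable
    also have "\<dots> \<le> (\<integral>z. l' (snd z) + \<rho> * dp (fst z) (snd z) \<partial>\<kappa>)"
      using upper il' idp ih by (intro integral_mono_AE) auto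
    also have "\<dots> = (\<integral>z. l' (snd z) \<partial>\<kappa>) + \<rho> * (\<integral>z. dp (fst z) (snd z) \<partial>\<kappa>)"
      using il' idp by simp
    also have "(\<integral>z. l' (snd z) \<partial>\<kappa>) = (\<integral>w. l' w \<partial>empirical S)"
      unfolding d2[symmetric] by (rule integral_distr[symmetric]) measurable
    also have "\<dots> = (\<Sum>i\<in>I. l' (s i)) / N"
      unfolding empirical_def
      by (subst integral_distr[OF sample_measurable]) (auto simp: integral_uniform_count_measure)
    also have "\<dots> \<le> (\<Sum>i\<in>I. l i) / N"
    proof (intro divide_right_mono sum_mono)
      fix i assume "i \<in> I"
      then show "l' (s i) \<le> l i"
        unfolding l'_def by (intro Min_le) (auto intro!: image_eqI[of _ _ i])
    qed auto
    finally have "(\<integral>w. h w \<partial>\<mu>) \<le> (\<Sum>i\<in>I. l i) / N + \<rho> * (\<theta> + e)"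
      using mult_left_mono[OF dle \<rho>] by simp
    moreover have "integrable \<mu> h"
      using ih unfolding d1[symmetric] by (subst integrable_distr_eq) auto
    ultimately show ?thesis by simp
  qed
  have ih: "integrable \<mu> h" using bound[of 1] by simp
  have "upper_integral \<mu> (\<lambda>w. v (f x u w)) \<le> (\<integral>w. h w / \<alpha> \<partial>\<mu>)"
  proof (rule upper_integral_le)
    show "v (f x u w) \<le> h w / \<alpha>" if "w \<in> space \<mu>" for w
      using h_ge[of w] that discount D_D(3)[OF \<mu>] by (simp add: field_simps)
    show "integrable \<mu> (\<lambda>w. - (C * \<xi> (f x u w)))" using xi_integrable[OF \<mu> k] by simp
    show "- (C * \<xi> (f x u w)) \<le> v (f x u w)" if "w \<in> space \<mu>" for w
      using bounded_by_dyn(2)[OF v k] that D_D(3)[OF \<mu>] by auto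
  qed (use ih in auto)
  then have 1: "\<alpha> * upper_integral \<mu> (\<lambda>w. v (f x u w)) \<le> (\<integral>w. h w \<partial>\<mu>)"
    using discount by (simp add: field_simps)
  have "(\<integral>w. h w \<partial>\<mu>) \<le> (\<Sum>i\<in>I. l i) / N + \<rho> * \<theta>"
  proof (rule field_le_epsilon)
    fix e :: real assume e: "0 < e"
    \<comment> \<open>The denominator \<open>\<rho> + 1\<close> covers the case of a vanishing
      multiplier.\<close>
    have "\<rho> * (e / (\<rho> + 1)) \<le> e" using \<rho> e by (simp add: field_simps)
    then show "(\<integral>w. h w \<partial>\<mu>) \<le> (\<Sum>i\<in>I. l i) / N + \<rho> * \<theta> + e"
      using bound[of "e / (\<rho> + 1)"] e \<rho> by (simp add: distrib_left)
  qed
  then show "cost S x u + \<alpha> * upper_integral \<mu> (\<lambda>w. v (f x u w)) \<le> sip_objective S x u \<rho> l"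
    using 1 unfolding sip_objective_def \<theta>_def by simp
qed

text \<open>The index \<open>j\<close> of a convex combination is drawn with weight
  \<open>c j\<close>, and independently a sample index \<open>i\<close> uniformly. One probability
  space then carries both marginals of the coupling.\<close>

definition finite_mix :: "nat \<Rightarrow> (nat \<Rightarrow> real) \<Rightarrow> (nat \<times> nat) pmf" where
  "finite_mix k c = pair_pmf (embed_pmf (\<lambda>j. if j \<in> {1..k} then c j else 0)) (pmf_of_set I)"

lemma
  assumes c: "\<And>j. j \<in> {1..k} \<Longrightarrow> 0 \<le> c j" "sum c {1..k} = 1"
  shows set_finite_mix: "set_pmf (finite_mix k c) \<subseteq> {1..k} \<times> I"
    and integral_finite_mix:
      "(\<integral>z. g z \<partial>measure_pmf (finite_mix k c)) = (\<Sum>j=1..k. c j * ((\<Sum>i\<in>I. g (j, i)) / N))"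
proof -
  define e where "e j = (if j \<in> {1..k} then c j else 0)" for j
  have mix: "finite_mix k c = pair_pmf (embed_pmf e) (pmf_of_set I)"
    unfolding finite_mix_def e_def ..
  have nn: "(\<integral>\<^sup>+j. ennreal (e j) \<partial>count_space UNIV) = 1"
  proof -
    have "(\<integral>\<^sup>+j. ennreal (e j) \<partial>count_space UNIV) = (\<Sum>j=1..k. ennreal (e j))"
      by (rule nn_integral_count_space') (auto simp: e_def)
    also have "\<dots> = ennreal (\<Sum>j=1..k. e j)" using c by (intro sum_ennreal) (auto simp: e_def)
    also have "(\<Sum>j=1..k. e j) = 1" using c(2) by (simp add: e_def)
    finally show ?thesis by simp
  qed
  have p: "pmf (embed_pmf e) j = e j" for j
    using c nn by (intro pmf_embed_pmf) (auto simp: e_def)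
  have I: "finite I" "I \<noteq> {}" using params(3) by auto
  have "set_pmf (embed_pmf e) \<subseteq> {1..k}"
    by (auto simp: set_pmf_iff p e_def split: if_splits)
  then show sub: "set_pmf (finite_mix k c) \<subseteq> {1..k} \<times> I"
    unfolding mix using I by auto
  have "(\<integral>z. g z \<partial>measure_pmf (finite_mix k c)) = (\<Sum>z\<in>{1..k} \<times> I. pmf (finite_mix k c) z *\<^sub>R g z)"
    using sub by (intro integral_measure_pmf) auto
  also have "\<dots> = (\<Sum>j=1..k. \<Sum>i\<in>I. c j / N * g (j, i))"
    unfolding sum.cartesian_product using I
    by (intro sum.cong) (auto simp: mix pmf_pair p e_def)
  also have "\<dots> = (\<Sum>j=1..k. c j * ((\<Sum>i\<in>I. g (j, i)) / N))"
    by (simp add: sum_distrib_left sum_divide_distrib)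
  finally show "(\<integral>z. g z \<partial>measure_pmf (finite_mix k c)) = (\<Sum>j=1..k. c j * ((\<Sum>i\<in>I. g (j, i)) / N))" .
qed

lemma integrable_finite_mix:
  assumes c: "\<And>j. j \<in> {1..k} \<Longrightarrow> 0 \<le> c j" "sum c {1..k} = 1"
  shows "integrable (measure_pmf (finite_mix k c)) (g :: _ \<Rightarrow> real)"
  using set_finite_mix[OF c] by (intro integrable_measure_pmf_finite) (auto intro: finite_subset)

text \<open>Under \<open>finite_mix\<close> the pair of \<open>y j i\<close> and \<open>s i\<close>
  couples the law in question with the empirical one, and the sum in the hypothesis is its transport
  cost.\<close>

lemma finite_mix_law:
  assumes c: "\<And>j. j \<in> {1..k} \<Longrightarrow> 0 \<le> c j" "sum c {1..k} = 1"
    and y: "\<And>j i. y j i \<in> W"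
    and le: "(\<Sum>j=1..k. c j * ((\<Sum>i\<in>I. dp (y j i) (s i)) / N)) \<le> \<theta>"
  shows "distr (measure_pmf (finite_mix k c)) Ws (\<lambda>(j, i). y j i) \<in> D"
proof -
  let ?q = "measure_pmf (finite_mix k c)"
  note int = integral_finite_mix[OF c]
  \<comment> \<open>Extending the samples to all indices by a point of \<open>W\<close> makes the
    coupling map take values in \<open>W\<close> everywhere.\<close>
  define s' where "s' i = (if i \<in> I then s i else s 1)" for i
  have s': "s' i \<in> W" for i using params(3,4) by (auto simp: s'_def)
  have ss: "s' i = s i" if "i \<in> I" for i using that by (simp add: s'_def)
  let ?F = "\<lambda>(j, i). (y j i, s' i)"
  let ?k = "distr ?q (Ws \<Otimes>\<^sub>M Ws) ?F"
  have F[measurable]: "?F \<in> ?q \<rightarrow>\<^sub>M Ws \<Otimes>\<^sub>M Ws"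
    using y s' by (auto simp: space_pair_measure)
  have snd: "distr ?q Ws (\<lambda>z. s' (snd z)) = empirical S"
  proof (rule measure_eqI)
    fix A assume "A \<in> sets (distr ?q Ws (\<lambda>z. s' (snd z)))"
    then have A: "A \<in> sets Ws" by simp
    have "emeasure (distr ?q Ws (\<lambda>z. s' (snd z))) A = (\<integral>\<^sup>+z. indicator A z \<partial>distr ?q Ws (\<lambda>z. s' (snd z)))"
      using A by simp
    also have "\<dots> = (\<integral>\<^sup>+z. ennreal (indicator A (s' (snd z))) \<partial>?q)"
      using A s' by (subst nn_integral_distr) (auto simp: ennreal_indicator)
    also have "\<dots> = ennreal (\<integral>z. indicator A (s' (snd z)) \<partial>?q)"
      using integrable_finite_mix[OF c] by (intro nn_integral_eq_integral) auto
    also have "(\<integral>z. indicator A (s' (snd z)) \<partial>?q) = (\<Sum>i\<in>I. indicator A (s i)) / N"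
    proof -
      have "(\<Sum>i\<in>I. indicator A (s' i) :: real) = (\<Sum>i\<in>I. indicator A (s i))"
        by (intro sum.cong) (auto simp: ss)
      then show ?thesis using c(2) by (simp only: int snd_conv flip: sum_distrib_right)
    qed
    also have "(\<Sum>i\<in>I. indicator A (s i)) = real (card (s -` A \<inter> I))"
    proof -
      have "(\<Sum>i\<in>I. indicator A (s i) :: real) = (\<Sum>i\<in>I. if i \<in> s -` A then 1 else 0)"
        by (intro sum.cong) (auto simp: indicator_def)
      also have "\<dots> = (\<Sum>i\<in>I \<inter> s -` A. 1)"
        by (rule sum.inter_restrict[symmetric]) simp
      finally show ?thesis by (simp add: Int_commute)
    qed
    also have "ennreal (card (s -` A \<inter> I) / N) = emeasure (empirical S) A"
      unfolding empirical_def using A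
      by (subst emeasure_distr[OF sample_measurable])
        (auto simp: space_uniform_count_measure emeasure_uniform_count_measure)
    finally show "emeasure (distr ?q Ws (\<lambda>z. s' (snd z))) A = emeasure (empirical S) A" .
  qed simp
  have "distr ?k Ws fst = distr ?q Ws (\<lambda>(j, i). y j i)" "distr ?k Ws snd = distr ?q Ws (\<lambda>z. s' (snd z))"
    unfolding distr_distr[OF measurable_fst F] distr_distr[OF measurable_snd F]
    by (simp_all add: comp_def split_beta')
  moreover have "prob_space ?k" by (intro prob_space.prob_space_distr prob_space_measure_pmf F)
  ultimately have coup: "?k \<in> couplings Ws (distr ?q Ws (\<lambda>(j, i). y j i)) (empirical S)"
    by (simp add: couplings_def space_prob_algebra snd)
  have "(\<integral>\<^sup>+z. ennreal (dist_metric S (fst z) (snd z) powr wass_order S) \<partial>?k)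
     = (\<integral>\<^sup>+z. ennreal (dp (y (fst z) (snd z)) (s' (snd z))) \<partial>?q)"
    using dp_measurable unfolding dp_def[symmetric]
    by (subst nn_integral_distr[OF F]) (auto simp: split_beta')
  also have "\<dots> = ennreal (\<integral>z. dp (y (fst z) (snd z)) (s' (snd z)) \<partial>?q)"
    using integrable_finite_mix[OF c] by (intro nn_integral_eq_integral) auto
  also have "\<dots> \<le> ennreal (radius S powr wass_order S)"
  proof (intro ennreal_leI)
    have "(\<Sum>i\<in>I. dp (y j i) (s' i)) = (\<Sum>i\<in>I. dp (y j i) (s i))" for j
      by (intro sum.cong) (auto simp: ss)
    then show "(\<integral>z. dp (y (fst z) (snd z)) (s' (snd z)) \<partial>?q) \<le> radius S powr wass_order S"
      using le by (simp only: int fst_conv snd_conv \<theta>_def)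
  qed
  finally have "wasserstein Ws (dist_metric S) (wass_order S) (distr ?q Ws (\<lambda>(j, i). y j i)) (empirical S)
      \<le> ennreal (radius S)"
    using params by (intro wasserstein_leI[OF coup]) auto
  moreover have "prob_space (distr ?q Ws (\<lambda>(j, i). y j i))"
    using y by (intro prob_space.prob_space_distr prob_space_measure_pmf) auto
  ultimately show ?thesis by (simp add: ambiguity_set_def space_prob_algebra)
qed

text \<open>
  A convex combination of the points \<open>(1/N \<Sum>\<^sub>i d(z\<^sub>i, w\<^sub>i)\<^sup>p, 1/N \<Sum>\<^sub>i \<phi>(z\<^sub>i))\<close> is the pair of
  transport cost and expected value of a finitely supported law, so the hull misses the quadrant
  \<open>{s < \<theta>\<^sup>p} \<times> {t > V}\<close>; the slope of a separating line is the multiplier \<open>\<rho>\<close>.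
\<close>

lemma strong_duality:
  assumes v: "bounded_by C v" and k: "(x, u) \<in> K"
  obtains \<rho> l where "sip_feasible S v x u \<rho> l" "sip_objective S x u \<rho> l \<le> worst_case S v x u"
proof -
  define \<phi> where "\<phi> w = \<alpha> * v (f x u w)" for w
  define V where "V = worst_case S v x u - cost S x u"
  let ?P = "\<lambda>z. ((\<Sum>i\<in>I. dp (z i) (s i)) / N, (\<Sum>i\<in>I. \<phi> (z i)) / N)"
  define A where "A = {?P z | z. \<forall>i. z i \<in> W}"
  have AI: "?P z \<in> A" if "\<forall>i. z i \<in> W" for z
    unfolding A_def using that by blast
  have N: "0 < real N" and I: "finite I" "I \<noteq> {}" using params(3) by auto
  have s1: "s 1 \<in> W" using params(3,4) by auto
  have le: "t \<le> V" if st: "(\<sigma>, t) \<in> convex hull A" and \<sigma>: "\<sigma> < \<theta>" for \<sigma> t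
  proof -
    from st[unfolded convex_hull_indexed mem_Collect_eq]
    obtain k' :: nat and c a where "\<forall>j\<in>{1..k'}. 0 \<le> c j \<and> a j \<in> A" and ca': "sum c {1..k'} = 1"
      "(\<Sum>j=1..k'. c j *\<^sub>R a j) = (\<sigma>, t)"
      by (elim exE conjE) (rule that; assumption)
    then have ca: "\<And>j. j \<in> {1..k'} \<Longrightarrow> 0 \<le> c j \<and> a j \<in> A" "sum c {1..k'} = 1"
      "(\<Sum>j=1..k'. c j *\<^sub>R a j) = (\<sigma>, t)" by blast+
    have "\<exists>z. (\<forall>i. z i \<in> W) \<and> (j \<in> {1..k'} \<longrightarrow> a j = ?P z)" for j
    proof (cases "j \<in> {1..k'}")
      case True
      then have "a j \<in> A" using ca(1) by blast
      then show ?thesis unfolding A_def by blast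
    next
      case False
      then show ?thesis using s1 by (intro exI[of _ "\<lambda>_. s 1"]) auto
    qed
    from choice[OF allI, OF this]
    obtain y where "\<forall>j. (\<forall>i. y j i \<in> W) \<and> (j \<in> {1..k'} \<longrightarrow> a j = ?P (y j))" by (rule exE)
    then have y: "\<And>j i. y j i \<in> W" "\<And>j. j \<in> {1..k'} \<Longrightarrow> a j = ?P (y j)" by blast+
    have "(\<Sum>j=1..k'. c j *\<^sub>R a j)
       = (\<Sum>j=1..k'. (c j * ((\<Sum>i\<in>I. dp (y j i) (s i)) / N), c j * ((\<Sum>i\<in>I. \<phi> (y j i)) / N)))"
      using y(2) by (intro sum.cong) auto
    then have \<sigma>': "(\<Sum>j=1..k'. c j * ((\<Sum>i\<in>I. dp (y j i) (s i)) / N)) = \<sigma>"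
      and t: "(\<Sum>j=1..k'. c j * ((\<Sum>i\<in>I. \<phi> (y j i)) / N)) = t"
      using ca(3) by (auto simp: sum_prod)
    let ?q = "measure_pmf (finite_mix k' c)"
    let ?\<mu> = "distr ?q Ws (\<lambda>(j, i). y j i)"
    have c: "\<And>j. j \<in> {1..k'} \<Longrightarrow> 0 \<le> c j" "sum c {1..k'} = 1" using ca by auto
    have \<mu>: "?\<mu> \<in> D"
    proof (rule finite_mix_law[OF c y(1)])
      show "(\<Sum>j=1..k'. c j * ((\<Sum>i\<in>I. dp (y j i) (s i)) / N)) \<le> \<theta>"
        unfolding \<sigma>' using \<sigma> by simp
    qed
    \<comment> \<open>Every function is integrable against a finitely supported mixture, even if
      \<open>v\<close> is not measurable on \<open>W\<close>; so the integral on the left lies below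
      that of each competitor \<open>h\<close>.\<close>
    have "(\<integral>z. v (f x u (y (fst z) (snd z))) \<partial>?q) \<le> upper_integral ?\<mu> (\<lambda>w. v (f x u w))"
    proof (rule le_upper_integral)
      show "integrable ?\<mu> (\<lambda>w. C * \<xi> (f x u w))" using xi_integrable[OF \<mu> k] by simp
      show "v (f x u w) \<le> C * \<xi> (f x u w)" if "w \<in> space ?\<mu>" for w
        using bounded_by_dyn[OF v k] that by auto
      fix h assume h: "integrable ?\<mu> h" "\<And>w. w \<in> space ?\<mu> \<Longrightarrow> v (f x u w) \<le> h w"
      then have hm: "h \<in> borel_measurable Ws" by auto
      have "(\<integral>z. v (f x u (y (fst z) (snd z))) \<partial>?q) \<le> (\<integral>z. h (y (fst z) (snd z)) \<partial>?q)"
        using h(2) y by (intro integral_mono integrable_finite_mix c) auto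
      also have "\<dots> = integral\<^sup>L ?\<mu> h"
        using hm y by (subst integral_distr) (auto simp: split_beta')
      finally show "(\<integral>z. v (f x u (y (fst z) (snd z))) \<partial>?q) \<le> integral\<^sup>L ?\<mu> h" .
    qed
    then have "\<alpha> * (\<integral>z. v (f x u (y (fst z) (snd z))) \<partial>?q) \<le> \<alpha> * upper_integral ?\<mu> (\<lambda>w. v (f x u w))"
      using discount by (intro mult_left_mono) auto
    moreover have "\<alpha> * (\<integral>z. v (f x u (y (fst z) (snd z))) \<partial>?q) = t"
    proof -
      have "\<alpha> * (\<integral>z. v (f x u (y (fst z) (snd z))) \<partial>?q) = (\<integral>z. \<phi> (y (fst z) (snd z)) \<partial>?q)"
        by (simp add: \<phi>_def)
      also have "\<dots> = t" by (simp only: integral_finite_mix[OF c] fst_conv snd_conv t)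
      finally show ?thesis .
    qed
    ultimately show "t \<le> V"
      using worst_case_upper[OF v \<mu> k] by (simp add: V_def)
  qed
  \<comment> \<open>Leaving every sample in place costs nothing; since \<open>\<theta>\<close> is
    positive, this is the point that excludes a vertical separating line.\<close>
  have "(0, (\<Sum>i\<in>I. \<phi> (s i)) / N) \<in> A"
    unfolding A_def using params(4) s1 dp_self
    by (intro CollectI exI[of _ "\<lambda>i. if i \<in> I then s i else s 1"]) auto
  then have hull0: "(0, (\<Sum>i\<in>I. \<phi> (s i)) / N) \<in> convex hull A" by (rule hull_inc)
  obtain \<rho> where \<rho>: "0 \<le> \<rho>" "\<And>\<sigma> t. (\<sigma>, t) \<in> convex hull A \<Longrightarrow> t - \<rho> * \<sigma> \<le> V - \<rho> * \<theta>"
    by (rule separating_quadrant[OF convex_convex_hull hull0 theta_pos le]) (assumption+, rule that)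
  define g where "g i w = \<phi> w - \<rho> * dp w (s i)" for i w
  \<comment> \<open>The points \<open>z i\<close> can be chosen independently of each other, so this
    bound on a sum will pass to the sum of the separate suprema.\<close>
  have g: "(\<Sum>i\<in>I. g i (z i)) \<le> N * (V - \<rho> * \<theta>)" if "\<And>i. i \<in> I \<Longrightarrow> z i \<in> W" for z
  proof -
    let ?z = "\<lambda>i. if i \<in> I then z i else s 1"
    have "\<forall>i. ?z i \<in> W" using that s1 by simp
    then have "?P ?z \<in> A" by (rule AI)
    from \<rho>(2)[OF hull_inc, OF this]
    have "(\<Sum>i\<in>I. \<phi> (z i)) / N - \<rho> * ((\<Sum>i\<in>I. dp (z i) (s i)) / N) \<le> V - \<rho> * \<theta>"
    proof -
      have "(\<Sum>i\<in>I. \<phi> (?z i)) = (\<Sum>i\<in>I. \<phi> (z i))"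
        and "(\<Sum>i\<in>I. dp (?z i) (s i)) = (\<Sum>i\<in>I. dp (z i) (s i))"
        by (auto intro!: sum.cong)
      then show ?thesis using \<open>_ \<le> V - \<rho> * \<theta>\<close> by (simp only:)
    qed
    then have "((\<Sum>i\<in>I. \<phi> (z i)) - \<rho> * (\<Sum>i\<in>I. dp (z i) (s i))) / N \<le> V - \<rho> * \<theta>"
      by (simp add: diff_divide_distrib)
    then show ?thesis
      using N by (simp add: g_def sum_subtractf sum_distrib_left divide_le_eq mult.commute)
  qed
  \<comment> \<open>Only coordinate \<open>i\<close> is varied; the others stay at their
    samples.\<close>
  have bdd: "bdd_above (g i ` W)" if i: "i \<in> I" for i
  proof (rule bdd_aboveI2)
    fix w assume w: "w \<in> W"
    have "(\<Sum>j\<in>I. g j (if j = i then w else s j)) = g i w + (\<Sum>j\<in>I - {i}. g j (s j))"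
      using i I by (subst sum.remove[of _ i]) auto
    moreover have "(\<Sum>j\<in>I. g j (if j = i then w else s j)) \<le> N * (V - \<rho> * \<theta>)"
      using w params(4) by (intro g) auto
    ultimately show "g i w \<le> N * (V - \<rho> * \<theta>) - (\<Sum>j\<in>I - {i}. g j (s j))" by simp
  qed
  \<comment> \<open>The least values that satisfy the constraints for the multiplier
    \<open>\<rho>\<close>.\<close>
  define l where "l i = (SUP w\<in>W. g i w)" for i
  have "(\<Sum>i\<in>I. l i) \<le> N * (V - \<rho> * \<theta>)"
  proof (rule field_le_epsilon)
    fix e :: real assume e: "0 < e"
    \<comment> \<open>Suprema need not be attained; the \<open>N\<close> errors \<open>e / N\<close>
      add up to \<open>e\<close>.\<close>
    have "\<exists>w\<in>W. l i - e / N < g i w" if "i \<in> I" for i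
    proof -
      have "W \<noteq> {}" using s1 by blast
      moreover have "l i - e / N < (SUP w\<in>W. g i w)" using e N by (simp add: l_def)
      ultimately show ?thesis using less_cSUP_iff[OF _ bdd[OF that]] by simp
    qed
    then have "\<forall>i\<in>I. \<exists>w. w \<in> W \<and> l i - e / N < g i w" by blast
    from bchoice[OF this] obtain z where
      z: "\<And>i. i \<in> I \<Longrightarrow> z i \<in> W" "\<And>i. i \<in> I \<Longrightarrow> l i - e / N < g i (z i)" by blast
    have "(\<Sum>i\<in>I. l i) \<le> (\<Sum>i\<in>I. g i (z i) + e / N)"
      using z(2) by (intro sum_mono) (fastforce intro: less_imp_le simp: less_diff_eq diff_less_eq)
    also have "\<dots> = (\<Sum>i\<in>I. g i (z i)) + e" using N by (simp add: sum.distrib)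
    also have "(\<Sum>i\<in>I. g i (z i)) \<le> N * (V - \<rho> * \<theta>)"
      by (intro g z(1))
    finally show "(\<Sum>i\<in>I. l i) \<le> N * (V - \<rho> * \<theta>) + e" by simp
  qed
  then have "(\<Sum>i\<in>I. l i) / N \<le> V - \<rho> * \<theta>" using N by (simp add: divide_le_eq mult.commute)
  then have "sip_objective S x u \<rho> l \<le> worst_case S v x u"
    by (simp add: sip_objective_def V_def \<theta>_def)
  moreover have "sip_feasible S v x u \<rho> l"
    unfolding sip_feasible_def
  proof safe
    fix w i assume "w \<in> W" "i \<in> I"
    then have "g i w \<le> l i" unfolding l_def by (intro cSUP_upper bdd)
    then show "\<alpha> * v (f x u w) - \<rho> * dist_metric S w (s i) powr wass_order S \<le> l i"
      by (simp add: g_def \<phi>_def dp_def)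
  qed (use k K_iff \<rho> in auto)
  ultimately show ?thesis using that by blast
qed

text \<open>Weak duality is applied at the optimal \<open>u\<close> and strong duality at an
  arbitrary competitor \<open>u'\<close>. The two objective values in between are compared by
  optimality, so \<open>u\<close> minimizes \<open>worst_case\<close> itself.\<close>

lemma sip_optimal_worst_case:
  assumes v: "bounded_by C v" and x: "x \<in> X" and opt: "sip_optimal_input S v x u"
  shows "worst_case S v x u = bellman S v x"
proof (rule antisym)
  obtain \<rho> l where f: "sip_feasible S v x u \<rho> l"
    and o: "\<And>u' \<rho>' l'. sip_feasible S v x u' \<rho>' l' \<Longrightarrow> sip_objective S x u \<rho> l \<le> sip_objective S x u' \<rho>' l'"
    using opt unfolding sip_optimal_input_def by blast
  show "worst_case S v x u \<le> bellman S v x"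
  proof (rule bellman_greatest[OF x])
    fix u' assume "u' \<in> admissible S x"
    then have "(x, u') \<in> K" using x K_iff by auto
    from strong_duality[OF v this] obtain \<rho>' l' where
      "sip_feasible S v x u' \<rho>' l'" "sip_objective S x u' \<rho>' l' \<le> worst_case S v x u'" .
    then show "worst_case S v x u \<le> worst_case S v x u'"
      using weak_duality[OF v x f] o by fastforce
  qed
  show "bellman S v x \<le> worst_case S v x u"
    using f x by (intro bellman_lower[OF v]) (auto simp: K_iff sip_feasible_def)
qed

end

section \<open>Lower semicontinuity of the Bellman operator\<close>

lemma lsc_on_iff_openin:
  "lsc_on A g \<longleftrightarrow> (\<forall>a. openin (top_of_set A) {x \<in> A. a < g x})"
proof
  assume l: "lsc_on A g"
  show "\<forall>a. openin (top_of_set A) {x \<in> A. a < g x}"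
  proof
    fix a
    show "openin (top_of_set A) {x \<in> A. a < g x}"
    proof (subst openin_subopen, safe)
      fix x assume x: "x \<in> A" "a < g x"
      then have "\<forall>\<^sub>F y in at x within A. a < g y" using l by (auto simp: lsc_on_def)
      then obtain T where "open T" "x \<in> T" "\<And>y. y \<in> T \<Longrightarrow> y \<noteq> x \<Longrightarrow> y \<in> A \<Longrightarrow> a < g y"
        unfolding eventually_at_topological by blast
      then show "\<exists>T. openin (top_of_set A) T \<and> x \<in> T \<and> T \<subseteq> {x \<in> A. a < g x}"
        using x by (intro exI[of _ "A \<inter> T"]) auto
    qed
  qed
next
  assume o: "\<forall>a. openin (top_of_set A) {x \<in> A. a < g x}"
  show "lsc_on A g"
    unfolding lsc_on_def
  proof safe
    fix x a assume x: "x \<in> A" "a < g x"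
    obtain T where "open T" "{x \<in> A. a < g x} = A \<inter> T"
      using o by (auto simp: openin_open)
    then show "\<forall>\<^sub>F y in at x within A. a < g y"
      unfolding eventually_at_topological using x by (intro exI[of _ T]) auto
  qed
qed

lemma lsc_onD: "lsc_on A g \<Longrightarrow> x \<in> A \<Longrightarrow> a < g x \<Longrightarrow> \<forall>\<^sub>F y in at x within A. a < g y"
  by (auto simp: lsc_on_def)

lemma continuous_on_imp_lsc_on: "continuous_on A g \<Longrightarrow> lsc_on A g"
  unfolding lsc_on_def continuous_on_def by (auto intro: order_tendstoD)

lemma lsc_on_add:
  assumes "lsc_on A g" "lsc_on A h"
  shows "lsc_on A (\<lambda>x. g x + h x)"
  unfolding lsc_on_def
proof safe
  fix x a assume x: "x \<in> A" "a < g x + h x"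
  define d where "d = (g x + h x - a) / 2"
  have "\<forall>\<^sub>F y in at x within A. g x - d < g y" "\<forall>\<^sub>F y in at x within A. h x - d < h y"
    using assms x by (auto intro!: lsc_onD simp: d_def)
  then show "\<forall>\<^sub>F y in at x within A. a < g y + h y"
    by eventually_elim (simp add: d_def field_simps)
qed

lemma lsc_on_cmult:
  assumes "lsc_on A g" "0 < (c :: real)"
  shows "lsc_on A (\<lambda>x. c * g x)"
  unfolding lsc_on_def
proof safe
  fix x a assume x: "x \<in> A" "a < c * g x"
  then have "\<forall>\<^sub>F y in at x within A. a / c < g y"
    using assms by (intro lsc_onD) (auto simp: field_simps)
  then show "\<forall>\<^sub>F y in at x within A. a < c * g y"
    by eventually_elim (use assms(2) in \<open>simp add: field_simps\<close>)
qed

lemma lsc_on_cong: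
  assumes "\<And>x. x \<in> A \<Longrightarrow> g x = h x" "lsc_on A g"
  shows "lsc_on A h"
  using assms unfolding lsc_on_iff_openin by (simp cong: conj_cong)

lemma borel_measurable_lsc_on:
  assumes "lsc_on A g"
  shows "g \<in> borel_measurable (restrict_space borel A)"
proof (subst borel_measurable_iff_greater, safe)
  fix a
  obtain T where "open T" "{x \<in> A. a < g x} = A \<inter> T"
    using assms by (auto simp: lsc_on_iff_openin openin_open)
  then show "{x \<in> space (restrict_space borel A). a < g x} \<in> sets (restrict_space borel A)"
    by (auto simp: space_restrict_space sets_restrict_space)
qed

text \<open>Truncated Lipschitz regularisation.\<close>

lemma lsc_on_approx:
  fixes A :: "'a::metric_space set"
  assumes lsc: "lsc_on A \<phi>" and nn: "\<And>x. x \<in> A \<Longrightarrow> 0 \<le> \<phi> x"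
  obtains g :: "nat \<Rightarrow> 'a \<Rightarrow> real" where "\<And>n. continuous_on A (g n)" "\<And>n. bounded (g n ` A)"
    "\<And>n x. x \<in> A \<Longrightarrow> 0 \<le> g n x" "\<And>n x. x \<in> A \<Longrightarrow> g n x \<le> \<phi> x"
    "\<And>x. x \<in> A \<Longrightarrow> (\<lambda>n. g n x) \<longlonglongrightarrow> \<phi> x"
proof -
  \<comment> \<open>Infimal convolution with \<open>real n * dist\<close>: it is
    \<open>n\<close>-Lipschitz, and the truncation below makes it bounded.\<close>
  define h where "h n x = (INF y\<in>A. \<phi> y + real n * dist x y)" for n x
  define g where "g n x = min (real n) (h n x)" for n x
  have bdd: "bdd_below ((\<lambda>y. \<phi> y + real n * dist x y) ` A)" for n x
    using nn by (intro bdd_belowI2[of _ 0]) auto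
  have h_le: "h n x \<le> \<phi> y + real n * dist x y" if "y \<in> A" for n x y
    unfolding h_def by (intro cINF_lower bdd that)
  have h_ge: "a \<le> h n x" if "\<And>y. y \<in> A \<Longrightarrow> a \<le> \<phi> y + real n * dist x y" "x \<in> A" for a n x
    unfolding h_def using that by (intro cINF_greatest) auto
  have h_nn: "0 \<le> h n x" if "x \<in> A" for n x
    using that nn by (intro h_ge) auto
  have lip: "h n x \<le> h n x' + real n * dist x x'" if "x \<in> A" "x' \<in> A" for n x x'
  proof -
    have "h n x - real n * dist x x' \<le> h n x'"
    proof (rule h_ge)
      fix y assume y: "y \<in> A"
      have "real n * dist x y \<le> real n * (dist x x' + dist x' y)"
        by (intro mult_left_mono dist_triangle) auto
      then show "h n x - real n * dist x x' \<le> \<phi> y + real n * dist x' y"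
        using h_le[OF y, of n x] by (simp add: distrib_left)
    qed fact
    then show ?thesis by simp
  qed
  have cont: "continuous_on A (h n)" for n
  proof (rule continuous_on_iff[THEN iffD2], intro ballI allI impI)
    fix x e :: real and x\<^sub>0 assume x: "x\<^sub>0 \<in> A" and e: "0 < e"
    show "\<exists>d>0. \<forall>x'\<in>A. dist x' x\<^sub>0 < d \<longrightarrow> dist (h n x') (h n x\<^sub>0) < e"
    proof (intro exI[of _ "e / (real n + 1)"] conjI ballI impI)
      fix x' assume x': "x' \<in> A" and d: "dist x' x\<^sub>0 < e / (real n + 1)"
      have "\<bar>h n x' - h n x\<^sub>0\<bar> \<le> real n * dist x' x\<^sub>0"
        using lip[OF x x', of n] lip[OF x' x, of n] by (simp add: dist_commute)
      also have "\<dots> \<le> (real n + 1) * dist x' x\<^sub>0" by (intro mult_right_mono) auto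
      also have "\<dots> < e" using d by (simp add: field_simps)
      finally show "dist (h n x') (h n x\<^sub>0) < e" by (simp add: dist_real_def)
    qed (use e in auto)
  qed
  show ?thesis
  proof
    show "continuous_on A (g n)" for n
      unfolding g_def by (intro continuous_intros cont)
    show "bounded (g n ` A)" for n
      using h_nn unfolding g_def by (intro boundedI[of _ "real n"]) (auto simp: min_def)
    show g_nn: "0 \<le> g n x" if "x \<in> A" for n x
      using h_nn[OF that] by (simp add: g_def)
    show g_le: "g n x \<le> \<phi> x" if "x \<in> A" for n x
      using h_le[OF that, of n x] by (simp add: g_def)
    show "(\<lambda>n. g n x) \<longlonglongrightarrow> \<phi> x" if x: "x \<in> A" for x
    proof (rule order_tendstoI)
      fix a assume "\<phi> x < a"
      then show "\<forall>\<^sub>F n in sequentially. g n x < a"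
        using g_le[OF x] by (intro always_eventually) (auto intro: le_less_trans)
    next
      \<comment> \<open>The intermediate \<open>a\<close> is needed because an infimum yields only
        the weak bound \<open>a \<le> h n x\<close>.\<close>
      fix a' assume "a' < \<phi> x"
      then obtain a where a: "a' < a" "a < \<phi> x" using dense by blast
      obtain T where T: "open T" "{x \<in> A. a < \<phi> x} = A \<inter> T"
        using lsc by (auto simp: lsc_on_iff_openin openin_open)
      then have "x \<in> T" using x a by auto
      then obtain \<delta> where \<delta>: "0 < \<delta>" "ball x \<delta> \<subseteq> T" using T by (auto simp: open_contains_ball)
      \<comment> \<open>Within distance \<open>\<delta>\<close> of \<open>x\<close> the function
        itself exceeds \<open>a\<close>; beyond it the penalty is at least
        \<open>n * \<delta>\<close>, which is at least \<open>a\<close>. The other entry of the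
        maximum keeps the truncation level above \<open>a\<close>.\<close>
      obtain n\<^sub>0 where n\<^sub>0: "max a (a / \<delta>) \<le> real n\<^sub>0" using real_arch_simple by blast
      show "\<forall>\<^sub>F n in sequentially. a' < g n x"
        using eventually_ge_at_top[of n\<^sub>0]
      proof eventually_elim
        case (elim n)
        then have n: "a \<le> real n" "a / \<delta> \<le> real n" using n\<^sub>0 by auto
        have "a \<le> h n x"
        proof (rule h_ge[OF _ x])
          fix y assume y: "y \<in> A"
          show "a \<le> \<phi> y + real n * dist x y"
          proof (cases "dist x y < \<delta>")
            case True
            then have "y \<in> A \<inter> T" using \<delta> y by auto
            then have "a < \<phi> y" using T(2) by blast
            then show ?thesis by (simp add: add_increasing2 less_imp_le)
          next
            case False
            have "a \<le> real n * \<delta>" using n(2) \<delta> by (simp add: field_simps)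
            also have "\<dots> \<le> real n * dist x y" using False by (intro mult_left_mono) auto
            finally show ?thesis using nn[OF y] by simp
          qed
        qed
        then show ?case using a n by (simp add: g_def)
      qed
    qed
  qed
qed

context robust_control begin

section \<open>Semicontinuity of the objective in state and input\<close>

lemma Xs_eq: "Xs = restrict_space borel X" by (simp add: state_space_def)

definition lsc_bounded :: "real \<Rightarrow> (real ^ 'n \<Rightarrow> real) \<Rightarrow> bool"
  where "lsc_bounded C v \<longleftrightarrow> bounded_by C v \<and> lsc_on X v"

lemma lsc_bounded_measurable: "lsc_bounded C v \<Longrightarrow> v \<in> borel_measurable Xs"
  unfolding lsc_bounded_def Xs_eq by (auto intro: borel_measurable_lsc_on)

lemma integrable_dyn:
  assumes v: "bounded_by C v" "v \<in> borel_measurable Xs" and \<mu>: "\<mu> \<in> D" and k: "(x, u) \<in> K"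
  shows "integrable \<mu> (\<lambda>w. v (f x u w))"
proof (rule Bochner_Integration.integrable_bound)
  show "integrable \<mu> (\<lambda>w. C * \<xi> (f x u w))" using xi_integrable[OF \<mu> k] by simp
  have "f x u \<in> \<mu> \<rightarrow>\<^sub>M Xs"
    using dyn_section[OF K_state[OF k] K_input[OF k]] D_D(2)[OF \<mu>] by (simp cong: measurable_cong_sets)
  then show "(\<lambda>w. v (f x u w)) \<in> borel_measurable \<mu>" using v by measurable
  show "AE w in \<mu>. norm (v (f x u w)) \<le> norm (C * \<xi> (f x u w))"
    unfolding real_norm_def using bounded_by_dyn[OF v(1) k] D_D(3)[OF \<mu>]
    by (intro AE_I2 order_trans[OF _ abs_ge_self]) (auto simp: abs_le_iff minus_le_iff)
qed

lemma upper_integral_dyn: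
  assumes "bounded_by C v" "v \<in> borel_measurable Xs" "\<mu> \<in> D" "(x, u) \<in> K"
  shows "upper_integral \<mu> (\<lambda>w. v (f x u w)) = (\<integral>w. v (f x u w) \<partial>\<mu>)"
  by (intro upper_integral_eq_lebesgue_integral integrable_dyn[OF assms])

text \<open>Assumption A speaks of bounded continuous functions and of \<open>\<xi>\<close> only.
  Adding \<open>C * \<xi>\<close> makes \<open>v\<close> nonnegative, so it is a limit from below of
  bounded continuous functions, and dominated convergence makes the integral lower semicontinuous.
  The integral of \<open>C * \<xi>\<close> is continuous and can be subtracted again.\<close>

lemma lsc_on_integral:
  assumes v: "lsc_bounded C v" and \<mu>: "\<mu> \<in> D"
  shows "lsc_on K (\<lambda>(x, u). \<integral>w. v (f x u w) \<partial>\<mu>)"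
proof -
  define \<phi> where "\<phi> x = v x + C * \<xi> x" for x
  have b: "bounded_by C v" and vm: "v \<in> borel_measurable Xs" and "lsc_on X v"
    using v lsc_bounded_measurable[OF v] by (auto simp: lsc_bounded_def)
  have "lsc_on X (\<lambda>x. C * \<xi> x)"
    by (intro continuous_on_imp_lsc_on continuous_intros xi_cont)
  then have "lsc_on X \<phi>"
    unfolding \<phi>_def by (rule lsc_on_add[OF \<open>lsc_on X v\<close>])
  moreover have "0 \<le> \<phi> x" if "x \<in> X" for x
    using b that unfolding bounded_by_def \<phi>_def by (force simp: abs_le_iff)
  ultimately obtain g where g: "\<And>n. continuous_on X (g n)" "\<And>n. bounded (g n ` X)"
    "\<And>n x. x \<in> X \<Longrightarrow> 0 \<le> g n x" "\<And>n x. x \<in> X \<Longrightarrow> g n x \<le> \<phi> x"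
    "\<And>x. x \<in> X \<Longrightarrow> (\<lambda>n. g n x) \<longlonglongrightarrow> \<phi> x"
    using lsc_on_approx[of X \<phi>] by metis
  have gm: "g n \<in> borel_measurable Xs" for n
    unfolding Xs_eq by (intro borel_measurable_continuous_on_restrict g)
  have fm: "f x u \<in> \<mu> \<rightarrow>\<^sub>M Xs" if k: "(x, u) \<in> K" for x u
    using dyn_section[OF K_state[OF k] K_input[OF k]] D_D(2)[OF \<mu>] by (simp cong: measurable_cong_sets)
  have fX: "f x u w \<in> X" if "(x, u) \<in> K" "w \<in> space \<mu>" for x u w
    using dyn_in[OF K_state[OF that(1)] K_input[OF that(1)]] that(2) D_D(3)[OF \<mu>] by auto
  have i\<phi>: "integrable \<mu> (\<lambda>w. \<phi> (f x u w))" if "(x, u) \<in> K" for x u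
    unfolding \<phi>_def using integrable_dyn[OF b vm \<mu> that] xi_integrable[OF \<mu> that] by simp
  have ig: "integrable \<mu> (\<lambda>w. g n (f x u w))" if k: "(x, u) \<in> K" for n x u
  proof (rule Bochner_Integration.integrable_bound[OF i\<phi>[OF k]])
    show "(\<lambda>w. g n (f x u w)) \<in> borel_measurable \<mu>"
      by (rule measurable_compose[OF fm[OF k] gm])
    show "AE w in \<mu>. norm (g n (f x u w)) \<le> norm (\<phi> (f x u w))"
      using g(3,4)[OF fX[OF k]] by (intro AE_I2) (simp add: order_trans[OF _ abs_ge_self])
  qed
  have "lsc_on K (\<lambda>(x, u). \<integral>w. \<phi> (f x u w) \<partial>\<mu>)"
    unfolding lsc_on_def
  proof safe
    fix x u a assume k: "(x, u) \<in> K" and a: "a < (\<integral>w. \<phi> (f x u w) \<partial>\<mu>)"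
    have "(\<lambda>n. \<integral>w. g n (f x u w) \<partial>\<mu>) \<longlonglongrightarrow> (\<integral>w. \<phi> (f x u w) \<partial>\<mu>)"
    proof (rule integral_dominated_convergence)
      show "integrable \<mu> (\<lambda>w. \<phi> (f x u w))" by (rule i\<phi>[OF k])
      then show "(\<lambda>w. \<phi> (f x u w)) \<in> borel_measurable \<mu>" by auto
      show "(\<lambda>w. g n (f x u w)) \<in> borel_measurable \<mu>" for n using ig[OF k] by auto
    qed (use g fX[OF k] in \<open>auto intro!: AE_I2\<close>)
    from order_tendstoD(1)[OF this a] obtain n where n: "a < (\<integral>w. g n (f x u w) \<partial>\<mu>)"
      by (auto simp: eventually_sequentially)
    have "continuous_on K (\<lambda>(x, u). \<integral>w. g n (f x u w) \<partial>\<mu>)"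
      using assm g(1,2)[of n] \<mu> by (auto simp: assumption_A_def)
    from lsc_onD[OF continuous_on_imp_lsc_on[OF this] k] n
    have "\<forall>\<^sub>F y in at (x, u) within K. a < (case y of (x, u) \<Rightarrow> \<integral>w. g n (f x u w) \<partial>\<mu>)" by simp
    moreover have "\<forall>\<^sub>F y in at (x, u) within K. y \<in> K"
      by (auto simp: eventually_at_topological)
    ultimately show "\<forall>\<^sub>F y in at (x, u) within K. a < (case y of (x, u) \<Rightarrow> \<integral>w. \<phi> (f x u w) \<partial>\<mu>)"
    proof eventually_elim
      case (elim y)
      obtain x' u' where y: "y = (x', u')" by (cases y)
      have k': "(x', u') \<in> K" using elim y by simp
      have "(\<integral>w. g n (f x' u' w) \<partial>\<mu>) \<le> (\<integral>w. \<phi> (f x' u' w) \<partial>\<mu>)"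
        using g(4) fX[OF k'] by (intro integral_mono ig i\<phi> k') auto
      then show ?case using elim y by simp
    qed
  qed
  moreover have "continuous_on K (\<lambda>(x, u). \<integral>w. \<xi> (f x u w) \<partial>\<mu>)"
    using assm \<mu> by (auto simp: assumption_A_def)
  then have "continuous_on K (\<lambda>z. - C * (case z of (x, u) \<Rightarrow> \<integral>w. \<xi> (f x u w) \<partial>\<mu>))"
    by (intro continuous_intros)
  ultimately have "lsc_on K (\<lambda>z. (case z of (x, u) \<Rightarrow> \<integral>w. \<phi> (f x u w) \<partial>\<mu>)
      + - C * (case z of (x, u) \<Rightarrow> \<integral>w. \<xi> (f x u w) \<partial>\<mu>))"
    by (intro lsc_on_add) (auto intro: continuous_on_imp_lsc_on)
  then show ?thesis
  proof (rule lsc_on_cong[rotated])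
    fix z assume "z \<in> K"
    moreover obtain x u where z: "z = (x, u)" by (cases z)
    ultimately have k: "(x, u) \<in> K" by simp
    show "(case z of (x, u) \<Rightarrow> \<integral>w. \<phi> (f x u w) \<partial>\<mu>) + - C * (case z of (x, u) \<Rightarrow> \<integral>w. \<xi> (f x u w) \<partial>\<mu>)
       = (case z of (x, u) \<Rightarrow> \<integral>w. v (f x u w) \<partial>\<mu>)"
      using integrable_dyn[OF b vm \<mu> k] xi_integrable[OF \<mu> k] by (simp add: z \<phi>_def)
  qed
qed

lemma lsc_on_objective:
  assumes v: "lsc_bounded C v" and \<mu>: "\<mu> \<in> D"
  shows "lsc_on K (\<lambda>(x, u). cost S x u + \<alpha> * (\<integral>w. v (f x u w) \<partial>\<mu>))"
proof -
  have "lsc_on K (\<lambda>(x, u). cost S x u)" using assm by (simp add: assumption_A_def)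
  then have "lsc_on K (\<lambda>z. (case z of (x, u) \<Rightarrow> cost S x u)
     + \<alpha> * (case z of (x, u) \<Rightarrow> \<integral>w. v (f x u w) \<partial>\<mu>))"
    using discount by (intro lsc_on_add lsc_on_cmult lsc_on_integral[OF assms])
  then show ?thesis by (simp add: case_prod_beta')
qed

lemma worst_case_lebesgue:
  assumes v: "lsc_bounded C v" and k: "(x, u) \<in> K"
  shows "worst_case S v x u = (SUP \<mu>\<in>D. cost S x u + \<alpha> * (\<integral>w. v (f x u w) \<partial>\<mu>))"
    and "bdd_above ((\<lambda>\<mu>. cost S x u + \<alpha> * (\<integral>w. v (f x u w) \<partial>\<mu>)) ` D)"
proof -
  have b: "bounded_by C v" using v by (simp add: lsc_bounded_def)
  have eq: "upper_integral \<mu> (\<lambda>w. v (f x u w)) = (\<integral>w. v (f x u w) \<partial>\<mu>)" if "\<mu> \<in> D" for \<mu>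
    using upper_integral_dyn[OF b lsc_bounded_measurable[OF v] that k] .
  then show "worst_case S v x u = (SUP \<mu>\<in>D. cost S x u + \<alpha> * (\<integral>w. v (f x u w) \<partial>\<mu>))"
    unfolding worst_case_def by (intro SUP_cong) auto
  show "bdd_above ((\<lambda>\<mu>. cost S x u + \<alpha> * (\<integral>w. v (f x u w) \<partial>\<mu>)) ` D)"
    using objective_bounds[OF b _ k] eq
    by (intro bdd_aboveI2[of _ _ "(b + \<tau> * C) * \<xi> x"]) (auto simp: abs_le_iff)
qed

text \<open>Near a point, a single law that exceeds the level there already exceeds it in a
  neighbourhood.\<close>

lemma lsc_on_worst_case:
  assumes v: "lsc_bounded C v"
  shows "lsc_on K (\<lambda>(x, u). worst_case S v x u)"
  unfolding lsc_on_def
proof safe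
  fix x u a assume k: "(x, u) \<in> K" and a: "a < worst_case S v x u"
  then obtain \<mu> where \<mu>: "\<mu> \<in> D" "a < cost S x u + \<alpha> * (\<integral>w. v (f x u w) \<partial>\<mu>)"
    using less_cSUP_iff[OF D_nonempty worst_case_lebesgue(2)[OF v k]] worst_case_lebesgue(1)[OF v k] by auto
  have "\<forall>\<^sub>F y in at (x, u) within K. a < (case y of (x, u) \<Rightarrow> cost S x u + \<alpha> * (\<integral>w. v (f x u w) \<partial>\<mu>))"
    using lsc_onD[OF lsc_on_objective[OF v \<mu>(1)] k] \<mu>(2) by simp
  moreover have "\<forall>\<^sub>F y in at (x, u) within K. y \<in> K"
    by (auto simp: eventually_at_topological)
  ultimately show "\<forall>\<^sub>F y in at (x, u) within K. a < (case y of (x, u) \<Rightarrow> worst_case S v x u)"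
  proof eventually_elim
    case (elim y)
    obtain x' u' where y: "y = (x', u')" by (cases y)
    have k': "(x', u') \<in> K" using elim y by simp
    have "cost S x' u' + \<alpha> * (\<integral>w. v (f x' u' w) \<partial>\<mu>) \<le> worst_case S v x' u'"
      unfolding worst_case_lebesgue(1)[OF v k'] by (intro cSUP_upper worst_case_lebesgue(2)[OF v k'] \<mu>)
    then show ?case using elim y by simp
  qed
qed

text \<open>A tube argument: the region where \<open>worst_case\<close> exceeds a level contains a
  uniform neighbourhood of the compact fibre over \<open>x\<close>, and upper semicontinuity of the
  correspondence keeps nearby fibres inside it.\<close>

lemma bellman_lsc_bounded:
  assumes v: "lsc_bounded C v"
  shows "lsc_bounded (b + \<tau> * C) (bellman S v)"
  unfolding lsc_bounded_def
proof
  have bv: "bounded_by C v" using v by (simp add: lsc_bounded_def)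
  then show "bounded_by (b + \<tau> * C) (bellman S v)" by (rule bellman_bounded_by)
  show "lsc_on X (bellman S v)"
    unfolding lsc_on_def
  proof safe
    fix x a assume x: "x \<in> X" and "a < bellman S v x"
    \<comment> \<open>The infimum over the fibre at \<open>y\<close> turns strict bounds into weak
      ones, so room is left below.\<close>
    then obtain a' where a: "a < a'" "a' < bellman S v x" using dense by blast
    obtain T where T: "open T" "{z \<in> K. a' < (case z of (x, u) \<Rightarrow> worst_case S v x u)} = K \<inter> T"
      using lsc_on_worst_case[OF v] unfolding lsc_on_iff_openin openin_open by blast
    have sub: "{x} \<times> admissible S x \<subseteq> T"
    proof safe
      fix u assume "u \<in> admissible S x"
      then have k: "(x, u) \<in> K" using x K_iff by auto
      then have "a' < worst_case S v x u" using bellman_lower[OF bv k] a by simp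
      with k have "(x, u) \<in> K \<inter> T" unfolding T(2)[symmetric] by simp
      then show "(x, u) \<in> T" by simp
    qed
    have "compact ({x} \<times> admissible S x)"
      using assm x by (intro compact_Times) (auto simp: assumption_A_def)
    from compact_subset_open_imp_ball_epsilon_subset[OF this T(1) sub]
    obtain e where e: "0 < e" "(\<Union>z\<in>{x} \<times> admissible S x. ball z e) \<subseteq> T" by blast
    \<comment> \<open>Half of \<open>e\<close> is spent on the input and half on the state.\<close>
    define V where "V = (\<Union>u\<in>admissible S x. ball u (e/2))"
    have "open V" "admissible S x \<subseteq> V" using e by (auto simp: V_def)
    then have "\<forall>\<^sub>F y in at x within X. admissible S y \<subseteq> V"
      using assm x by (auto simp: assumption_A_def usc_correspondence_on_def)
    moreover have "\<forall>\<^sub>F y in at x within X. y \<in> X \<and> dist y x < e / 2"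
      unfolding eventually_at using e by (intro exI[of _ "e/2"]) auto
    ultimately show "\<forall>\<^sub>F y in at x within X. a < bellman S v y"
    proof eventually_elim
      case (elim y)
      have "a' \<le> bellman S v y"
      proof (rule bellman_greatest)
        fix u' assume u': "u' \<in> admissible S y"
        then have k: "(y, u') \<in> K" using elim K_iff by auto
        obtain u where u: "u \<in> admissible S x" "dist u u' < e / 2" using u' elim by (auto simp: V_def)
        have "dist (x, u) (y, u') \<le> dist x y + dist u u'"
          by (simp add: dist_Pair_Pair sqrt_sum_squares_le_sum)
        also have "\<dots> < e" using u elim by (simp add: dist_commute)
        finally have "(y, u') \<in> T" using e(2) u(1) by (intro subsetD[OF e(2)]) auto
        with k have "(y, u') \<in> K \<inter> T" by simp
        then show "a' \<le> worst_case S v y u'" unfolding T(2)[symmetric] by simp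
      qed (use elim in auto)
      then show ?case using a by simp
    qed
  qed
qed

end

section \<open>Discounted costs of a weighted Markov chain\<close>

text \<open>The spaces \<open>Q t\<close> depend on time because the chain will carry its growing
  past. The drift is stated with a nonnegative integral and therefore includes the integrability of
  \<open>w\<close>.\<close>

locale weighted_chain =
  fixes Q :: "nat \<Rightarrow> 'q measure" and K :: "nat \<Rightarrow> 'q \<Rightarrow> 'q measure" and w :: "'q \<Rightarrow> real"
    and c :: "nat \<Rightarrow> 'q \<Rightarrow> real" and \<alpha> \<beta> b :: real and q\<^sub>0 :: 'q
  assumes K_measurable[measurable]: "\<And>t. K t \<in> Q t \<rightarrow>\<^sub>M prob_algebra (Q (Suc t))"
    and w_measurable[measurable]: "\<And>t. w \<in> borel_measurable (Q t)"
    and w_ge_1: "\<And>t q. q \<in> space (Q t) \<Longrightarrow> 1 \<le> w q"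
    and w_drift: "\<And>t q. q \<in> space (Q t) \<Longrightarrow> (\<integral>\<^sup>+y. ennreal (w y) \<partial>K t q) \<le> ennreal (\<beta> * w q)"
    and c_measurable[measurable]: "\<And>t. c t \<in> borel_measurable (Q t)"
    and c_bound: "\<And>t q. q \<in> space (Q t) \<Longrightarrow> \<bar>c t q\<bar> \<le> b * w q"
    and b_nonneg: "0 \<le> b" and \<alpha>: "0 < \<alpha>" and \<beta>: "0 < \<beta>" and contraction: "\<alpha> * \<beta> < 1"
    and q\<^sub>0: "q\<^sub>0 \<in> space (Q 0)"
begin

primrec R :: "nat \<Rightarrow> 'q measure" where
  "R 0 = return (Q 0) q\<^sub>0"
| "R (Suc t) = R t \<bind> K t"

lemma R_prob: "R t \<in> space (prob_algebra (Q t))"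
proof (induction t)
  case 0
  then show ?case using q\<^sub>0 by (auto simp: space_prob_algebra prob_space_return)
next
  case (Suc t)
  then show ?case
    using prob_space_bind'[OF Suc K_measurable] sets_bind'[OF Suc K_measurable]
    by (auto simp: space_prob_algebra)
qed

lemma sets_R[measurable_cong, simp]: "sets (R t) = sets (Q t)"
  using R_prob[of t] by (auto simp: space_prob_algebra)

lemma space_R[simp]: "space (R t) = space (Q t)"
  using sets_eq_imp_space_eq[OF sets_R] .

lemma K_subprob[measurable]: "K t \<in> Q t \<rightarrow>\<^sub>M subprob_algebra (Q (Suc t))"
  by (rule measurable_prob_algebraD[OF K_measurable])

lemma K_subprob_R: "K t \<in> R t \<rightarrow>\<^sub>M subprob_algebra (Q (Suc t))"
  using K_subprob by (simp cong: measurable_cong_sets)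

lemma K_space: assumes "q \<in> space (Q t)"
  shows "sets (K t q) = sets (Q (Suc t))" "prob_space (K t q)" "space (K t q) = space (Q (Suc t))"
  using measurable_space[OF K_measurable assms] by (auto simp: space_prob_algebra dest: sets_eq_imp_space_eq)

definition wbound :: "nat \<Rightarrow> real \<Rightarrow> ('q \<Rightarrow> real) \<Rightarrow> bool"
  where "wbound t C h \<longleftrightarrow> h \<in> borel_measurable (Q t) \<and> 0 \<le> C \<and> (\<forall>q\<in>space (Q t). \<bar>h q\<bar> \<le> C * w q)"

lemma wbound_w: "wbound t 1 w"
  using w_ge_1 unfolding wbound_def by fastforce

lemma nn_integral_wbound:
  assumes "wbound t C h" "sets M = sets (Q t)"
  shows "(\<integral>\<^sup>+y. ennreal \<bar>h y\<bar> \<partial>M) \<le> ennreal C * (\<integral>\<^sup>+y. ennreal (w y) \<partial>M)"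
proof -
  note assms(2)[measurable_cong]
  have sp: "space M = space (Q t)" by (rule sets_eq_imp_space_eq[OF assms(2)])
  have "(\<integral>\<^sup>+y. ennreal \<bar>h y\<bar> \<partial>M) \<le> (\<integral>\<^sup>+y. ennreal C * ennreal (w y) \<partial>M)"
    using assms(1) sp
    by (intro nn_integral_mono) (auto simp: wbound_def ennreal_mult'[symmetric] intro!: ennreal_leI)
  also have "\<dots> = ennreal C * (\<integral>\<^sup>+y. ennreal (w y) \<partial>M)"
    by (rule nn_integral_cmult) measurable
  finally show ?thesis .
qed

lemma integrable_wbound:
  assumes "wbound t C h" "sets M = sets (Q t)" "(\<integral>\<^sup>+y. ennreal (w y) \<partial>M) < \<infinity>"
  shows "integrable M h"
proof (rule integrableI_bounded)
  show "h \<in> borel_measurable M" using assms(1,2) by (simp add: wbound_def cong: measurable_cong_sets)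
  have "ennreal C * (\<integral>\<^sup>+y. ennreal (w y) \<partial>M) < \<infinity>"
    using assms(3) by (simp add: ennreal_mult_less_top)
  then show "(\<integral>\<^sup>+y. ennreal (norm (h y)) \<partial>M) < \<infinity>"
    using nn_integral_wbound[OF assms(1,2)] by (simp add: le_less_trans)
qed

lemma K_finite: "q \<in> space (Q t) \<Longrightarrow> (\<integral>\<^sup>+y. ennreal (w y) \<partial>K t q) < \<infinity>"
  using w_drift[of q t] by (auto simp: le_less_trans)

lemma K_integrable:
  assumes "wbound (Suc t) C h" "q \<in> space (Q t)"
  shows "integrable (K t q) h"
  by (rule integrable_wbound[OF assms(1) K_space(1)[OF assms(2)] K_finite[OF assms(2)]])

lemma K_integral_w:
  assumes "q \<in> space (Q t)"
  shows "(\<integral>y. w y \<partial>K t q) \<le> \<beta> * w q"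
proof -
  have i: "integrable (K t q) w" by (rule K_integrable[OF wbound_w assms])
  have "ennreal (\<integral>y. w y \<partial>K t q) \<le> ennreal (\<beta> * w q)"
    using w_drift[OF assms] w_ge_1 K_space(3)[OF assms]
    by (subst nn_integral_eq_integral[symmetric, OF i]) (force intro!: AE_I2)+
  then show ?thesis
    using \<beta> w_ge_1[OF assms] by (subst (asm) ennreal_le_iff) auto
qed

lemma K_integral_bound:
  assumes "wbound (Suc t) C h" "q \<in> space (Q t)"
  shows "\<bar>\<integral>y. h y \<partial>K t q\<bar> \<le> C * (\<beta> * w q)"
proof -
  have i: "integrable (K t q) w" by (rule K_integrable[OF wbound_w assms(2)])
  have "\<bar>\<integral>y. h y \<partial>K t q\<bar> \<le> (\<integral>y. \<bar>h y\<bar> \<partial>K t q)" by (rule integral_abs_bound)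
  also have "\<dots> \<le> (\<integral>y. C * w y \<partial>K t q)"
    using assms K_space(3)[OF assms(2)] i K_integrable[OF assms]
    by (intro integral_mono) (auto simp: wbound_def)
  also have "\<dots> \<le> C * (\<beta> * w q)"
    using K_integral_w[OF assms(2)] assms(1) by (auto simp: wbound_def intro: mult_left_mono)
  finally show ?thesis .
qed

lemma R_drift: "(\<integral>\<^sup>+q. ennreal (w q) \<partial>R t) \<le> ennreal (\<beta> ^ t * w q\<^sub>0)"
proof (induction t)
  case 0
  then show ?case using q\<^sub>0 by (simp add: nn_integral_return)
next
  case (Suc t)
  have "(\<integral>\<^sup>+q. ennreal (w q) \<partial>R (Suc t)) = (\<integral>\<^sup>+q. \<integral>\<^sup>+y. ennreal (w y) \<partial>K t q \<partial>R t)"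
    by (simp, rule nn_integral_bind[OF _ K_subprob_R]) measurable
  also have "\<dots> \<le> (\<integral>\<^sup>+q. ennreal \<beta> * ennreal (w q) \<partial>R t)"
    using w_drift \<beta> w_ge_1 by (intro nn_integral_mono) (auto simp: ennreal_mult'[symmetric])
  also have "\<dots> = ennreal \<beta> * (\<integral>\<^sup>+q. ennreal (w q) \<partial>R t)"
    by (rule nn_integral_cmult) measurable
  also have "\<dots> \<le> ennreal \<beta> * ennreal (\<beta> ^ t * w q\<^sub>0)"
    by (intro mult_left_mono Suc) auto
  also have "\<dots> = ennreal (\<beta> ^ Suc t * w q\<^sub>0)"
    using \<beta> by (simp add: ennreal_mult'[symmetric] mult.assoc)
  finally show ?case .
qed

lemma R_finite: "(\<integral>\<^sup>+q. ennreal (w q) \<partial>R t) < \<infinity>"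
  using R_drift[of t] by (auto simp: le_less_trans)

lemma R_integral_bound:
  assumes "wbound t C h"
  shows "integrable (R t) h" "\<bar>\<integral>q. h q \<partial>R t\<bar> \<le> C * (\<beta> ^ t * w q\<^sub>0)"
proof -
  show i: "integrable (R t) h" by (rule integrable_wbound[OF assms sets_R R_finite])
  have p: "0 \<le> C * (\<beta> ^ t * w q\<^sub>0)"
    using assms \<beta> w_ge_1[OF q\<^sub>0] by (auto simp: wbound_def)
  have "ennreal \<bar>\<integral>q. h q \<partial>R t\<bar> \<le> (\<integral>\<^sup>+q. ennreal \<bar>h q\<bar> \<partial>R t)"
    using integral_norm_bound_ennreal[OF i] by simp
  also have "\<dots> \<le> ennreal C * (\<integral>\<^sup>+q. ennreal (w q) \<partial>R t)"
    by (rule nn_integral_wbound[OF assms sets_R])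
  also have "\<dots> \<le> ennreal C * ennreal (\<beta> ^ t * w q\<^sub>0)"
    by (intro mult_left_mono R_drift) auto
  also have "\<dots> = ennreal (C * (\<beta> ^ t * w q\<^sub>0))"
    using assms by (simp add: ennreal_mult'[symmetric] wbound_def)
  finally show "\<bar>\<integral>q. h q \<partial>R t\<bar> \<le> C * (\<beta> ^ t * w q\<^sub>0)"
    using p by (subst (asm) ennreal_le_iff) auto
qed

lemma R_Suc_integral:
  assumes h: "wbound (Suc t) C h"
  shows "(\<integral>q. h q \<partial>R (Suc t)) = (\<integral>q. \<integral>y. h y \<partial>K t q \<partial>R t)"
proof -
  have hm: "h \<in> borel_measurable (Q (Suc t))" using h by (simp add: wbound_def)
  have "(\<integral>\<^sup>+q. \<integral>\<^sup>+y. ennreal \<bar>h y\<bar> \<partial>K t q \<partial>R t) = (\<integral>\<^sup>+q. ennreal \<bar>h q\<bar> \<partial>R (Suc t))"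
    using hm by (simp, intro nn_integral_bind[OF _ K_subprob_R, symmetric]) measurable
  also have "\<dots> < \<infinity>"
    by (rule le_less_trans[OF nn_integral_wbound[OF h sets_R]])
      (use R_finite[of "Suc t"] in \<open>simp add: ennreal_mult_less_top del: R.simps\<close>)
  finally show ?thesis
    using integral_bind_kernel[OF K_subprob_R hm] by simp
qed

text \<open>The expected discounted cost of \<open>n\<close> stages started from \<open>q\<close> at
  time \<open>t\<close>.\<close>

primrec H :: "nat \<Rightarrow> nat \<Rightarrow> 'q \<Rightarrow> real" where
  "H 0 t q = 0"
| "H (Suc n) t q = c t q + \<alpha> * (\<integral>y. H n (Suc t) y \<partial>K t q)"

lemma H_0: "H 0 t = (\<lambda>_. 0)"
  by (simp add: fun_eq_iff)

text \<open>The constant is the fixed point of \<open>B = b + \<alpha> * \<beta> * B\<close>, so it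
  is the same for every horizon.\<close>

lemma H_wbound: "wbound t (b / (1 - \<alpha> * \<beta>)) (H n t)"
proof (induction n arbitrary: t)
  case 0
  have "0 \<le> b / (1 - \<alpha> * \<beta>)" using b_nonneg contraction by simp
  moreover have "0 \<le> w q" if "q \<in> space (Q t)" for q using w_ge_1[OF that] by simp
  moreover note H_0[of t]
  ultimately show ?case
    unfolding wbound_def by (auto intro!: mult_nonneg_nonneg simp del: times_divide_eq_left)
next
  case (Suc n)
  let ?B = "b / (1 - \<alpha> * \<beta>)"
  have B: "0 \<le> ?B" using b_nonneg contraction by simp
  have eq: "b + \<alpha> * (?B * \<beta>) = ?B" using contraction by (simp add: field_simps)
  have [measurable]: "H n (Suc t) \<in> borel_measurable (Q (Suc t))" using Suc by (simp add: wbound_def)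
  have [measurable]: "(\<lambda>q. \<integral>y. H n (Suc t) y \<partial>K t q) \<in> borel_measurable (Q t)"
    by (rule measurable_compose[OF K_subprob integral_measurable_subprob_algebra]) measurable
  have "\<bar>H (Suc n) t q\<bar> \<le> ?B * w q" if q: "q \<in> space (Q t)" for q
  proof -
    have "\<alpha> * \<bar>\<integral>y. H n (Suc t) y \<partial>K t q\<bar> \<le> \<alpha> * (?B * (\<beta> * w q))"
      using \<alpha> by (intro mult_left_mono K_integral_bound Suc q) auto
    then have "\<bar>H (Suc n) t q\<bar> \<le> b * w q + \<alpha> * (?B * (\<beta> * w q))"
      using c_bound[OF q] \<alpha> abs_triangle_ineq[of "c t q" "\<alpha> * (\<integral>y. H n (Suc t) y \<partial>K t q)"]
      by (simp add: abs_mult)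
    also have "\<dots> = (b + \<alpha> * (?B * \<beta>)) * w q" by (simp add: algebra_simps)
    finally show ?thesis unfolding eq .
  qed
  moreover have "H (Suc n) t = (\<lambda>q. c t q + \<alpha> * (\<integral>y. H n (Suc t) y \<partial>K t q))"
    by (simp add: fun_eq_iff)
  then have "H (Suc n) t \<in> borel_measurable (Q t)" by simp
  ultimately show ?case using B unfolding wbound_def by blast
qed

lemma c_wbound: "wbound t b (c t)"
  using c_bound b_nonneg by (simp add: wbound_def)

text \<open>The forward sum of expected costs is matched with the backward recursion by the tower
  property. At \<open>t = 0\<close> the law \<open>R 0\<close> is a point mass, so
  \<open>H n 0\<close> at the start is a partial sum of \<open>J\<close>.\<close>

lemma H_sum: "(\<Sum>i<n. \<alpha> ^ i * (\<integral>q. c (t + i) q \<partial>R (t + i))) = (\<integral>q. H n t q \<partial>R t)"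
proof (induction n arbitrary: t)
  case (Suc n)
  have "(\<Sum>i<Suc n. \<alpha> ^ i * (\<integral>q. c (t + i) q \<partial>R (t + i)))
     = (\<integral>q. c t q \<partial>R t) + \<alpha> * (\<Sum>i<n. \<alpha> ^ i * (\<integral>q. c (Suc t + i) q \<partial>R (Suc t + i)))"
    by (simp only: sum.lessThan_Suc_shift) (simp add: sum_distrib_left mult.assoc del: R.simps(2))
  also have "\<dots> = (\<integral>q. c t q \<partial>R t) + \<alpha> * (\<integral>q. H n (Suc t) q \<partial>R (Suc t))"
    by (simp only: Suc.IH)
  also have "\<dots> = (\<integral>q. c t q \<partial>R t) + \<alpha> * (\<integral>q. \<integral>y. H n (Suc t) y \<partial>K t q \<partial>R t)"
    by (simp only: R_Suc_integral[OF H_wbound])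
  also have "\<dots> = (\<integral>q. H (Suc n) t q \<partial>R t)"
  proof -
    have "wbound t (b / (1 - \<alpha> * \<beta>) * \<beta>) (\<lambda>q. \<integral>y. H n (Suc t) y \<partial>K t q)"
      unfolding wbound_def
    proof (intro conjI ballI)
      show "(\<lambda>q. \<integral>y. H n (Suc t) y \<partial>K t q) \<in> borel_measurable (Q t)"
        using H_wbound[of "Suc t" n]
        by (intro measurable_compose[OF K_subprob integral_measurable_subprob_algebra]) (simp add: wbound_def)
      show "0 \<le> b / (1 - \<alpha> * \<beta>) * \<beta>" using b_nonneg contraction \<beta> by simp
    qed (use K_integral_bound[OF H_wbound] in \<open>simp add: mult.assoc\<close>)
    then show ?thesis
      using R_integral_bound(1)[OF c_wbound] R_integral_bound(1) by simp
  qed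
  finally show ?case .
qed (simp add: H_0)

definition J :: real where "J = (\<Sum>t. \<alpha> ^ t * (\<integral>q. c t q \<partial>R t))"

lemma J_summable: "summable (\<lambda>t. \<alpha> ^ t * (\<integral>q. c t q \<partial>R t))"
proof (rule summable_comparison_test')
  show "summable (\<lambda>t. b * w q\<^sub>0 * (\<alpha> * \<beta>) ^ t)"
    using contraction \<alpha> \<beta> by (intro summable_mult summable_geometric) auto
  show "norm (\<alpha> ^ t * (\<integral>q. c t q \<partial>R t)) \<le> b * w q\<^sub>0 * (\<alpha> * \<beta>) ^ t" for t
  proof -
    have "\<alpha> ^ t * \<bar>\<integral>q. c t q \<partial>R t\<bar> \<le> \<alpha> ^ t * (b * (\<beta> ^ t * w q\<^sub>0))"
      using \<alpha> by (intro mult_left_mono R_integral_bound(2)[OF c_wbound]) auto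
    then show ?thesis using \<alpha> by (simp add: abs_mult power_mult_distrib algebra_simps)
  qed
qed

lemma J_limit: "(\<lambda>n. H n 0 q\<^sub>0) \<longlonglongrightarrow> J"
proof -
  have "(\<Sum>i<n. \<alpha> ^ i * (\<integral>q. c i q \<partial>R i)) = H n 0 q\<^sub>0" for n
    using H_sum[where n=n and t=0] H_wbound[of 0 n] q\<^sub>0
    by (simp add: integral_return wbound_def)
  then show ?thesis
    using summable_LIMSEQ[OF J_summable] by (simp add: J_def)
qed

text \<open>
  \<open>V\<close> may be non-measurable: the supersolution property is only tested on measurable minorants
  of \<open>V\<close>, and the finite-horizon costs \<open>H\<close> are measurable.
\<close>

lemma J_le:
  assumes V: "\<And>t q. q \<in> space (Q t) \<Longrightarrow> \<bar>V q\<bar> \<le> C * w q" and C: "0 \<le> C" and \<delta>: "0 \<le> \<delta>"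
    and super: "\<And>t q h C'. q \<in> space (Q t) \<Longrightarrow> wbound (Suc t) C' h \<Longrightarrow>
      (\<And>y. y \<in> space (Q (Suc t)) \<Longrightarrow> h y \<le> V y) \<Longrightarrow> c t q + \<alpha> * (\<integral>y. h y \<partial>K t q) \<le> V q + \<delta> * w q"
  shows "J \<le> V q\<^sub>0 + \<delta> / (1 - \<alpha> * \<beta>) * w q\<^sub>0"
proof (rule LIMSEQ_le[OF J_limit])
  \<comment> \<open>The solution of \<open>\<kappa> (Suc n) = \<delta> + \<alpha> * \<beta> *
    \<kappa> n\<close>. The summand \<open>C\<close> at \<open>n = 0\<close> makes up for
    \<open>V\<close> being possibly negative, since \<open>H 0\<close> vanishes.\<close>
  define \<kappa> where "\<kappa> n = \<delta> / (1 - \<alpha> * \<beta>) + C * (\<alpha> * \<beta>) ^ n" for n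
  have \<kappa>0: "0 \<le> \<kappa> n" for n using \<delta> C contraction \<alpha> \<beta> by (simp add: \<kappa>_def)
  have \<kappa>Suc: "\<delta> + \<alpha> * (\<kappa> n * \<beta>) = \<kappa> (Suc n)" for n
    using contraction by (simp add: \<kappa>_def field_simps)
  have main: "H n t q \<le> V q + \<kappa> n * w q" if "q \<in> space (Q t)" for n t q
    using that
  proof (induction n arbitrary: t q)
    case 0
    have "0 \<le> \<delta> / (1 - \<alpha> * \<beta>) * w q" using \<delta> contraction w_ge_1[OF 0] by simp
    then show ?case using V[OF 0] by (simp add: \<kappa>_def distrib_right abs_le_iff)
  next
    case (Suc n)
    \<comment> \<open>By the induction hypothesis this is a measurable minorant of \<open>V\<close>,
      and so a legitimate test function.\<close>
    define h where "h y = H n (Suc t) y - \<kappa> n * w y" for y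
    let ?B = "b / (1 - \<alpha> * \<beta>)"
    have hb: "wbound (Suc t) (?B + \<kappa> n) h"
      unfolding wbound_def
    proof (intro conjI ballI)
      note Hb = H_wbound[of "Suc t" n, unfolded wbound_def]
      have [measurable]: "H n (Suc t) \<in> borel_measurable (Q (Suc t))" using Hb by simp
      show "h \<in> borel_measurable (Q (Suc t))" unfolding h_def by measurable
      show "0 \<le> ?B + \<kappa> n" using Hb \<kappa>0[of n] by simp
      fix y assume y: "y \<in> space (Q (Suc t))"
      then have "0 \<le> \<kappa> n * w y" using w_ge_1[OF y] \<kappa>0[of n] by simp
      then show "\<bar>h y\<bar> \<le> (?B + \<kappa> n) * w y"
        using Hb y unfolding h_def by (auto simp: distrib_right abs_le_iff)
    qed
    have "(\<integral>y. H n (Suc t) y \<partial>K t q) = (\<integral>y. h y + \<kappa> n * w y \<partial>K t q)" by (simp add: h_def)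
    also have "\<dots> = (\<integral>y. h y \<partial>K t q) + \<kappa> n * (\<integral>y. w y \<partial>K t q)"
      using K_integrable[OF hb Suc.prems] K_integrable[OF wbound_w Suc.prems] by simp
    also have "\<dots> \<le> (\<integral>y. h y \<partial>K t q) + \<kappa> n * (\<beta> * w q)"
      using K_integral_w[OF Suc.prems] \<kappa>0[of n] by (simp add: mult_left_mono)
    finally have "\<alpha> * (\<integral>y. H n (Suc t) y \<partial>K t q) \<le> \<alpha> * ((\<integral>y. h y \<partial>K t q) + \<kappa> n * (\<beta> * w q))"
      using \<alpha> by (intro mult_left_mono) auto
    moreover have "c t q + \<alpha> * (\<integral>y. h y \<partial>K t q) \<le> V q + \<delta> * w q"
    proof (rule super[OF Suc.prems hb])
      fix y assume "y \<in> space (Q (Suc t))"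
      from Suc.IH[OF this] show "h y \<le> V y" by (simp add: h_def)
    qed
    moreover have "\<delta> * w q + \<alpha> * (\<kappa> n * (\<beta> * w q)) = \<kappa> (Suc n) * w q"
      unfolding \<kappa>Suc[symmetric] by (simp add: algebra_simps)
    ultimately show ?case by (simp add: distrib_left)
  qed
  then show "\<exists>N. \<forall>n\<ge>N. H n 0 q\<^sub>0 \<le> V q\<^sub>0 + \<kappa> n * w q\<^sub>0" using q\<^sub>0 by blast
  have "(\<lambda>n. (\<alpha> * \<beta>) ^ n) \<longlonglongrightarrow> 0"
    using contraction \<alpha> \<beta> by (intro LIMSEQ_power_zero) (simp add: abs_mult)
  then have "\<kappa> \<longlonglongrightarrow> \<delta> / (1 - \<alpha> * \<beta>) + C * 0"
    unfolding \<kappa>_def using tendsto_add[OF tendsto_const tendsto_mult[OF tendsto_const]] by blast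
  then show "(\<lambda>n. V q\<^sub>0 + \<kappa> n * w q\<^sub>0) \<longlonglongrightarrow> V q\<^sub>0 + \<delta> / (1 - \<alpha> * \<beta>) * w q\<^sub>0"
    by (intro tendsto_intros) simp
qed

end

section \<open>The law of the play\<close>

locale robust_play = robust_control S \<xi> \<beta> b
  for S :: "('n::finite, 'm::finite, 'l::finite) control_problem" and \<xi> \<beta> b +
  fixes \<pi> :: "('n, 'm) policy" and \<gamma> :: "('n, 'm, 'l) adversary" and x\<^sub>0 :: "real ^ 'n"
  assumes policy: "\<pi> \<in> policies S" and adversary: "\<gamma> \<in> adversaries S" and x\<^sub>0: "x\<^sub>0 \<in> X"
begin

abbreviation "Ss \<equiv> step_space S"
abbreviation "PA \<equiv> prob_algebra Ws"
text \<open>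
  The chain runs on pairs of the past steps \<open>\<omega>\<close> and the current state.  A transition first draws
  the input and the law of the disturbance (\<open>act_kernel\<close>) and then the next state
  (\<open>state_kernel\<close>), whereas \<^const>\<open>step_kernel\<close> draws the state first.
\<close>

definition "Pt (t :: nat) = PiM {0..<t} (\<lambda>_. Ss)"
definition "Qt t = Pt t \<Otimes>\<^sub>M Xs"

lemma policy_measurable: "\<pi> t \<in> history_space S t \<rightarrow>\<^sub>M prob_algebra Us"
  and policy_admissible: "h \<in> space (history_space S t) \<Longrightarrow> AE u in \<pi> t h. u \<in> admissible S (snd h)"
  using policy by (auto simp: policies_def)

lemma adversary_measurable: "\<gamma> t \<in> Pt t \<Otimes>\<^sub>M (Xs \<Otimes>\<^sub>M Us) \<rightarrow>\<^sub>M prob_algebra PA"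
  and adversary_ambiguity: "h \<in> space (Pt t \<Otimes>\<^sub>M (Xs \<Otimes>\<^sub>M Us)) \<Longrightarrow> AE \<mu> in \<gamma> t h. \<mu> \<in> D"
  using adversary by (auto simp: adversaries_def ext_history_space_def Pt_def)

lemma component_measurable[measurable]: "i < t \<Longrightarrow> (\<lambda>\<omega>. \<omega> i) \<in> Pt t \<rightarrow>\<^sub>M Ss"
  unfolding Pt_def by (rule measurable_component_singleton) simp

lemma step_parts[measurable]:
  "fst \<in> Ss \<rightarrow>\<^sub>M Xs" "(\<lambda>y. fst (snd y)) \<in> Ss \<rightarrow>\<^sub>M Us" "(\<lambda>y. snd (snd y)) \<in> Ss \<rightarrow>\<^sub>M PA"
  unfolding step_space_def by measurable

lemma step_measurable:
  assumes "g \<in> M \<rightarrow>\<^sub>M Xs" "h \<in> M \<rightarrow>\<^sub>M Us" "k \<in> M \<rightarrow>\<^sub>M PA"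
  shows "(\<lambda>z. (g z, h z, k z)) \<in> M \<rightarrow>\<^sub>M Ss"
  unfolding step_space_def using assms by measurable

lemma input_history_measurable[measurable]:
  "input_history t \<in> Pt t \<rightarrow>\<^sub>M PiM {0..<t} (\<lambda>_. Xs \<Otimes>\<^sub>M Us)"
  unfolding input_history_def
proof (rule measurable_restrict)
  fix i assume "i \<in> {0..<t}"
  then have [measurable]: "(\<lambda>\<omega>. \<omega> i) \<in> Pt t \<rightarrow>\<^sub>M Ss" by (intro component_measurable) simp
  have "(\<lambda>y. (fst y, fst (snd y))) \<in> Ss \<rightarrow>\<^sub>M Xs \<Otimes>\<^sub>M Us"
    by (intro measurable_Pair step_parts)
  then show "(\<lambda>\<omega>. (fst (\<omega> i), fst (snd (\<omega> i)))) \<in> Pt t \<rightarrow>\<^sub>M Xs \<Otimes>\<^sub>M Us"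
    by (rule measurable_compose[rotated]) measurable
qed

section \<open>The kernels of one transition\<close>

definition input_kernel :: "nat \<Rightarrow> (nat \<Rightarrow> ('n, 'm, 'l) play_step) \<times> (real ^ 'n) \<Rightarrow> (real ^ 'm) measure"
  where "input_kernel t q = \<pi> t (input_history t (fst q), snd q)"

definition law_kernel ::
    "nat \<Rightarrow> (nat \<Rightarrow> ('n, 'm, 'l) play_step) \<times> (real ^ 'n) \<Rightarrow> real ^ 'm \<Rightarrow> (real ^ 'l) measure measure"
  where "law_kernel t q u = \<gamma> t (fst q, snd q, u)"

definition extend ::
    "nat \<Rightarrow> (nat \<Rightarrow> ('n, 'm, 'l) play_step) \<times> (real ^ 'n) \<Rightarrow> real ^ 'm \<Rightarrow> (real ^ 'l) measure \<Rightarrow>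
      nat \<Rightarrow> ('n, 'm, 'l) play_step"
  where "extend t q u \<mu> = (fst q)(t := (snd q, u, \<mu>))"

lemma input_kernel_measurable[measurable]: "input_kernel t \<in> Qt t \<rightarrow>\<^sub>M prob_algebra Us"
proof -
  have "(\<lambda>q. (input_history t (fst q), snd q)) \<in> Qt t \<rightarrow>\<^sub>M history_space S t"
    unfolding Qt_def history_space_def by measurable
  from measurable_compose[OF this policy_measurable] show ?thesis
    unfolding input_kernel_def[abs_def] .
qed

lemma law_kernel_measurable[measurable]:
  "(\<lambda>(q, u). law_kernel t q u) \<in> Qt t \<Otimes>\<^sub>M Us \<rightarrow>\<^sub>M prob_algebra PA"
proof -
  have "(\<lambda>z. (fst (fst z), snd (fst z), snd z)) \<in> Qt t \<Otimes>\<^sub>M Us \<rightarrow>\<^sub>M Pt t \<Otimes>\<^sub>M (Xs \<Otimes>\<^sub>M Us)"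
    unfolding Qt_def by measurable
  from measurable_compose[OF this adversary_measurable] show ?thesis
    by (simp add: law_kernel_def split_beta')
qed

lemma extend_measurable[measurable]:
  "(\<lambda>((q, u), \<mu>). extend t q u \<mu>) \<in> (Qt t \<Otimes>\<^sub>M Us) \<Otimes>\<^sub>M PA \<rightarrow>\<^sub>M Pt (Suc t)"
proof -
  let ?M = "(Qt t \<Otimes>\<^sub>M Us) \<Otimes>\<^sub>M PA"
  have 1: "(\<lambda>z. fst (fst (fst z))) \<in> ?M \<rightarrow>\<^sub>M PiM {0..<t} (\<lambda>_. Ss)"
    unfolding Qt_def Pt_def by measurable
  have 2: "(\<lambda>z. (snd (fst (fst z)), snd (fst z), snd z)) \<in> ?M \<rightarrow>\<^sub>M Ss"
    unfolding Qt_def by (rule step_measurable) measurable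
  have "(\<lambda>z. (fst (fst (fst z)))(t := (snd (fst (fst z)), snd (fst z), snd z))) \<in> ?M \<rightarrow>\<^sub>M PiM {0..<Suc t} (\<lambda>_. Ss)"
    by (rule measurable_fun_upd[OF _ 1 2]) auto
  then show ?thesis by (simp add: extend_def Pt_def split_beta')
qed

definition act_kernel ::
    "nat \<Rightarrow> (nat \<Rightarrow> ('n, 'm, 'l) play_step) \<times> (real ^ 'n) \<Rightarrow> (nat \<Rightarrow> ('n, 'm, 'l) play_step) measure"
  where "act_kernel t q = input_kernel t q \<bind> (\<lambda>u. distr (law_kernel t q u) (Pt (Suc t)) (extend t q u))"

definition state_kernel ::
    "nat \<Rightarrow> (nat \<Rightarrow> ('n, 'm, 'l) play_step) \<Rightarrow> ((nat \<Rightarrow> ('n, 'm, 'l) play_step) \<times> (real ^ 'n)) measure"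
  where "state_kernel t \<omega> = distr (next_state_law S x\<^sub>0 t \<omega>) (Qt t) (\<lambda>x. (\<omega>, x))"

definition move_kernel where "move_kernel t q = act_kernel t q \<bind> state_kernel (Suc t)"

lemma act_kernel_inner[measurable]:
  "(\<lambda>(q, u). distr (law_kernel t q u) (Pt (Suc t)) (extend t q u)) \<in> Qt t \<Otimes>\<^sub>M Us \<rightarrow>\<^sub>M prob_algebra (Pt (Suc t))"
  unfolding split_beta'
  by (rule measurable_distr_prob_space2[where M=PA])
    (use law_kernel_measurable extend_measurable in \<open>simp_all add: split_beta'\<close>)

lemma act_kernel_measurable[measurable]: "act_kernel t \<in> Qt t \<rightarrow>\<^sub>M prob_algebra (Pt (Suc t))"
  unfolding act_kernel_def[abs_def]
  by (rule measurable_bind_prob_space2[OF input_kernel_measurable act_kernel_inner])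

lemma next_state_measurable[measurable]: "next_state_law S x\<^sub>0 t \<in> Pt t \<rightarrow>\<^sub>M prob_algebra Xs"
proof (cases t)
  case 0
  have "return Xs x\<^sub>0 \<in> space (prob_algebra Xs)"
    using x\<^sub>0 by (simp add: space_prob_algebra prob_space_return)
  then show ?thesis by (simp add: next_state_law_def[abs_def] 0)
next
  case (Suc t')
  have c: "(\<lambda>\<omega>. \<omega> t') \<in> Pt t \<rightarrow>\<^sub>M Ss" by (rule component_measurable) (simp add: Suc)
  have "(\<lambda>z. (fst (fst z t'), fst (snd (fst z t')), snd z)) \<in> Pt t \<Otimes>\<^sub>M Ws \<rightarrow>\<^sub>M Xs \<Otimes>\<^sub>M (Us \<Otimes>\<^sub>M Ws)"
    using c by measurable
  from measurable_compose[OF this dyn_measurable]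
  have "(\<lambda>(\<omega>, w). f (fst (\<omega> t')) (fst (snd (\<omega> t'))) w) \<in> Pt t \<Otimes>\<^sub>M Ws \<rightarrow>\<^sub>M Xs"
    by (simp add: split_beta')
  then have "(\<lambda>\<omega>. distr (snd (snd (\<omega> t'))) Xs (f (fst (\<omega> t')) (fst (snd (\<omega> t'))))) \<in> Pt t \<rightarrow>\<^sub>M prob_algebra Xs"
    by (intro measurable_distr_prob_space2[where M=Ws] measurable_compose[OF c step_parts(3)])
  then show ?thesis by (simp add: next_state_law_def[abs_def] Suc split_beta')
qed

lemma state_kernel_measurable[measurable]: "state_kernel t \<in> Pt t \<rightarrow>\<^sub>M prob_algebra (Qt t)"
  unfolding state_kernel_def[abs_def]
  by (rule measurable_distr_prob_space2[OF next_state_measurable]) (simp add: Qt_def)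

lemma move_kernel_measurable: "move_kernel t \<in> Qt t \<rightarrow>\<^sub>M prob_algebra (Qt (Suc t))"
  unfolding move_kernel_def[abs_def]
  by (rule measurable_bind_prob_space[OF act_kernel_measurable state_kernel_measurable])

lemma space_Qt: "q \<in> space (Qt t) \<longleftrightarrow> fst q \<in> space (Pt t) \<and> snd q \<in> X"
  by (auto simp: Qt_def space_pair_measure mem_Times_iff)

context
  fixes t :: nat and q assumes q: "q \<in> space (Qt t)"
begin

lemma input_kernel_prob: "input_kernel t q \<in> space (prob_algebra Us)"
  by (rule measurable_space[OF input_kernel_measurable q])

lemma sets_input_kernel: "sets (input_kernel t q) = sets Us" "space (input_kernel t q) = U"
    "prob_space (input_kernel t q)"
  using input_kernel_prob by (auto simp: space_prob_algebra dest: sets_eq_imp_space_eq)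

lemma input_kernel_admissible: "AE u in input_kernel t q. (snd q, u) \<in> K"
proof -
  have "fst q \<in> space (Pt t)" using q space_Qt by blast
  then have "(input_history t (fst q), snd q) \<in> space (history_space S t)"
    using q measurable_space[OF input_history_measurable] space_Qt[of q t]
    by (auto simp: history_space_def space_pair_measure)
  from policy_admissible[OF this] show ?thesis
    unfolding input_kernel_def using q space_Qt K_iff by auto
qed

lemma law_kernel_section: "law_kernel t q \<in> Us \<rightarrow>\<^sub>M prob_algebra PA"
proof -
  have "(\<lambda>u. (q, u)) \<in> Us \<rightarrow>\<^sub>M Qt t \<Otimes>\<^sub>M Us" using q by measurable
  from measurable_compose[OF this law_kernel_measurable] show ?thesis by simp
qed

lemma law_kernel_D: "u \<in> U \<Longrightarrow> AE \<mu> in law_kernel t q u. \<mu> \<in> D"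
  unfolding law_kernel_def using q space_Qt
  by (intro adversary_ambiguity) (auto simp: space_pair_measure)

lemma law_kernel_prob: assumes "u \<in> U"
  shows "law_kernel t q u \<in> space (prob_algebra PA)" "sets (law_kernel t q u) = sets PA"
    "space (law_kernel t q u) = space PA" "prob_space (law_kernel t q u)"
  using measurable_space[OF law_kernel_section, of u] assms
  by (auto simp: space_prob_algebra[of PA] dest: sets_eq_imp_space_eq)

lemma extend_section: assumes "u \<in> U" shows "extend t q u \<in> PA \<rightarrow>\<^sub>M Pt (Suc t)"
proof -
  have "(\<lambda>\<mu>. ((q, u), \<mu>)) \<in> PA \<rightarrow>\<^sub>M (Qt t \<Otimes>\<^sub>M Us) \<Otimes>\<^sub>M PA"
    using q assms by (intro measurable_Pair measurable_const) (auto simp: space_pair_measure)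
  from measurable_compose[OF this extend_measurable] show ?thesis by simp
qed

lemma act_inner_section: "(\<lambda>u. distr (law_kernel t q u) (Pt (Suc t)) (extend t q u)) \<in> Us \<rightarrow>\<^sub>M prob_algebra (Pt (Suc t))"
proof -
  have "(\<lambda>u. (q, u)) \<in> Us \<rightarrow>\<^sub>M Qt t \<Otimes>\<^sub>M Us" using q by measurable
  from measurable_compose[OF this act_kernel_inner] show ?thesis by simp
qed

lemma act_inner_section': "(\<lambda>u. distr (law_kernel t q u) (Pt (Suc t)) (extend t q u)) \<in> input_kernel t q \<rightarrow>\<^sub>M subprob_algebra (Pt (Suc t))"
  using measurable_prob_algebraD[OF act_inner_section] sets_input_kernel(1) by (simp cong: measurable_cong_sets)

lemma extend_section': "u \<in> U \<Longrightarrow> extend t q u \<in> law_kernel t q u \<rightarrow>\<^sub>M Pt (Suc t)"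
  using extend_section law_kernel_prob(2) by (simp cong: measurable_cong_sets)

lemma nn_integral_act:
  assumes F: "F \<in> borel_measurable (Pt (Suc t))"
  shows "(\<integral>\<^sup>+\<omega>. F \<omega> \<partial>act_kernel t q)
    = (\<integral>\<^sup>+u. \<integral>\<^sup>+\<mu>. F (extend t q u \<mu>) \<partial>law_kernel t q u \<partial>input_kernel t q)"
  unfolding act_kernel_def nn_integral_bind[OF F act_inner_section']
  using F extend_section' sets_input_kernel(2)
  by (intro nn_integral_cong nn_integral_distr) auto

lemma act_kernel_prob: "act_kernel t q \<in> space (prob_algebra (Pt (Suc t)))"
  by (rule measurable_space[OF act_kernel_measurable q])

lemma state_kernel_act: "state_kernel (Suc t) \<in> act_kernel t q \<rightarrow>\<^sub>M subprob_algebra (Qt (Suc t))"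
  using measurable_prob_algebraD[OF state_kernel_measurable] act_kernel_prob
  by (simp add: space_prob_algebra cong: measurable_cong_sets)

end

text \<open>The step appended by \<open>extend\<close> is the one that \<open>next_state_law\<close>
  reads at time \<open>Suc t\<close>, so the next state is driven by the law just drawn.\<close>

lemma state_kernel_extend:
  assumes "q \<in> space (Qt t)" "u \<in> U" "\<mu> \<in> space PA"
  shows "state_kernel (Suc t) (extend t q u \<mu>) = distr \<mu> (Qt (Suc t)) (\<lambda>w. (extend t q u \<mu>, f (snd q) u w))"
    and "(\<lambda>w. (extend t q u \<mu>, f (snd q) u w)) \<in> \<mu> \<rightarrow>\<^sub>M Qt (Suc t)"
proof -
  have [measurable_cong]: "sets \<mu> = sets Ws" using assms(3) by (simp add: space_prob_algebra)
  have e: "extend t q u \<mu> \<in> space (Pt (Suc t))"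
    by (rule measurable_space[OF extend_section[OF assms(1,2)] assms(3)])
  have [measurable]: "f (snd q) u \<in> Ws \<rightarrow>\<^sub>M Xs" using assms space_Qt by (intro dyn_section) auto
  have p: "(\<lambda>x. (extend t q u \<mu>, x)) \<in> Xs \<rightarrow>\<^sub>M Qt (Suc t)" using e unfolding Qt_def by measurable
  have f\<mu>: "f (snd q) u \<in> \<mu> \<rightarrow>\<^sub>M Xs" by measurable
  show "(\<lambda>w. (extend t q u \<mu>, f (snd q) u w)) \<in> \<mu> \<rightarrow>\<^sub>M Qt (Suc t)"
    by (rule measurable_compose[OF f\<mu> p])
  show "state_kernel (Suc t) (extend t q u \<mu>) = distr \<mu> (Qt (Suc t)) (\<lambda>w. (extend t q u \<mu>, f (snd q) u w))"
    using distr_distr[OF p f\<mu>]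
    by (simp add: state_kernel_def next_state_law_def extend_def comp_def)
qed

lemma nn_integral_move:
  assumes q: "q \<in> space (Qt t)" and F: "F \<in> borel_measurable (Qt (Suc t))"
  shows "(\<integral>\<^sup>+y. F y \<partial>move_kernel t q)
    = (\<integral>\<^sup>+u. \<integral>\<^sup>+\<mu>. \<integral>\<^sup>+w. F (extend t q u \<mu>, f (snd q) u w) \<partial>\<mu> \<partial>law_kernel t q u \<partial>input_kernel t q)"
proof -
  have m: "(\<lambda>\<omega>. \<integral>\<^sup>+y. F y \<partial>state_kernel (Suc t) \<omega>) \<in> borel_measurable (Pt (Suc t))"
    by (rule measurable_compose[OF measurable_prob_algebraD[OF state_kernel_measurable]
          nn_integral_measurable_subprob_algebra[OF F]])
  have "(\<integral>\<^sup>+y. F y \<partial>move_kernel t q)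
    = (\<integral>\<^sup>+u. \<integral>\<^sup>+\<mu>. \<integral>\<^sup>+y. F y \<partial>state_kernel (Suc t) (extend t q u \<mu>) \<partial>law_kernel t q u \<partial>input_kernel t q)"
    unfolding move_kernel_def nn_integral_bind[OF F state_kernel_act[OF q]] nn_integral_act[OF q m] ..
  also have "\<dots> = (\<integral>\<^sup>+u. \<integral>\<^sup>+\<mu>. \<integral>\<^sup>+w. F (extend t q u \<mu>, f (snd q) u w) \<partial>\<mu> \<partial>law_kernel t q u \<partial>input_kernel t q)"
  proof (intro nn_integral_cong)
    fix u \<mu> assume "u \<in> space (input_kernel t q)" "\<mu> \<in> space (law_kernel t q u)"
    then have u: "u \<in> U" and \<mu>: "\<mu> \<in> space PA"
      using sets_input_kernel[OF q] law_kernel_prob[OF q] by auto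
    show "(\<integral>\<^sup>+y. F y \<partial>state_kernel (Suc t) (extend t q u \<mu>)) = (\<integral>\<^sup>+w. F (extend t q u \<mu>, f (snd q) u w) \<partial>\<mu>)"
      unfolding state_kernel_extend(1)[OF q u \<mu>]
      by (rule nn_integral_distr[OF state_kernel_extend(2)[OF q u \<mu>]]) (use F in simp)
  qed
  finally show ?thesis .
qed

lemma xi_nn_integral_le:
  assumes "\<mu> \<in> D" "(x, u) \<in> K"
  shows "(\<integral>\<^sup>+w. ennreal (\<xi> (f x u w)) \<partial>\<mu>) \<le> ennreal (\<beta> * \<xi> x)"
proof -
  have "AE w in \<mu>. 0 \<le> \<xi> (f x u w)"
    using xi_ge_1[OF dyn_in[OF K_state[OF assms(2)] K_input[OF assms(2)]]] D_D(3)[OF assms(1)]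
    by (intro AE_I2) force
  then show ?thesis
    by (simp add: nn_integral_eq_integral[OF xi_integrable[OF assms]] xi_integral_le[OF assms] ennreal_leI)
qed

text \<open>Admissibility of the input and membership of the law in \<open>D\<close> hold almost
  surely, so the drift condition on \<open>\<xi>\<close> can be integrated fibre by fibre.\<close>

lemma move_drift:
  assumes q: "q \<in> space (Qt t)"
  shows "(\<integral>\<^sup>+y. ennreal (\<xi> (snd y)) \<partial>move_kernel t q) \<le> ennreal (\<beta> * \<xi> (snd q))"
proof -
  have m: "(\<lambda>y. ennreal (\<xi> (snd y))) \<in> borel_measurable (Qt (Suc t))"
    unfolding Qt_def by measurable
  interpret i: prob_space "input_kernel t q" by (rule sets_input_kernel[OF q])
  show ?thesis
    unfolding nn_integral_move[OF q m] snd_conv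
  proof (rule i.nn_integral_le_const)
    show "AE u in input_kernel t q. (\<integral>\<^sup>+\<mu>. \<integral>\<^sup>+w. ennreal (\<xi> (f (snd q) u w)) \<partial>\<mu> \<partial>law_kernel t q u) \<le> ennreal (\<beta> * \<xi> (snd q))"
      using input_kernel_admissible[OF q]
    proof eventually_elim
      case (elim u)
      then have u: "u \<in> U" by (rule K_input)
      interpret l: prob_space "law_kernel t q u" by (rule law_kernel_prob[OF q u])
      show ?case
        using law_kernel_D[OF q u] xi_nn_integral_le[OF _ elim]
        by (intro l.nn_integral_le_const) (auto elim: eventually_mono)
    qed
  qed simp
qed

text \<open>
  The cost is bounded only on the graph of the admissible inputs, where the play stays almost
  surely; clipping makes the bound hold everywhere.
\<close>

definition clipped_cost :: "real ^ 'n \<Rightarrow> real ^ 'm \<Rightarrow> real"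
  where "clipped_cost x u = max (- (b * \<xi> x)) (min (b * \<xi> x) (cost S x u))"

lemma clipped_cost_measurable[measurable]:
  "(\<lambda>(x, u). clipped_cost x u) \<in> borel_measurable (Xs \<Otimes>\<^sub>M Us)"
  using cost_measurable unfolding clipped_cost_def[abs_def] split_beta' by measurable

lemma clipped_cost_bound: "x \<in> X \<Longrightarrow> \<bar>clipped_cost x u\<bar> \<le> b * \<xi> x"
  using b_nonneg xi_ge_1[of x] by (auto simp: clipped_cost_def abs_le_iff min_def max_def)

lemma clipped_cost_eq: "(x, u) \<in> K \<Longrightarrow> clipped_cost x u = cost S x u"
  using cost_bound[of x u] by (auto simp: clipped_cost_def abs_le_iff)

lemma clipped_cost_section: "x \<in> X \<Longrightarrow> clipped_cost x \<in> borel_measurable Us"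
proof -
  assume "x \<in> X"
  then have "(\<lambda>u. (x, u)) \<in> Us \<rightarrow>\<^sub>M Xs \<Otimes>\<^sub>M Us" by (intro measurable_Pair measurable_const) auto
  from measurable_compose[OF this clipped_cost_measurable] show ?thesis by simp
qed

definition stage_cost where "stage_cost t q = (\<integral>u. clipped_cost (snd q) u \<partial>input_kernel t q)"

lemma integrable_clipped_cost:
  assumes q: "q \<in> space (Qt t)" shows "integrable (input_kernel t q) (clipped_cost (snd q))"
proof -
  have x: "snd q \<in> X" using q space_Qt by auto
  show ?thesis
    by (rule finite_measure.integrable_const_bound[OF prob_space.finite_measure[OF sets_input_kernel(3)[OF q]],
            where B="b * \<xi> (snd q)"])
      (use clipped_cost_bound[OF x] clipped_cost_section[OF x] sets_input_kernel(1)[OF q]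
        in \<open>auto cong: measurable_cong_sets\<close>)
qed

lemma stage_cost_bound:
  assumes q: "q \<in> space (Qt t)" shows "\<bar>stage_cost t q\<bar> \<le> b * \<xi> (snd q)"
proof -
  have x: "snd q \<in> X" using q space_Qt by auto
  interpret prob_space "input_kernel t q" by (rule sets_input_kernel[OF q])
  have "\<bar>stage_cost t q\<bar> \<le> (\<integral>u. \<bar>clipped_cost (snd q) u\<bar> \<partial>input_kernel t q)"
    unfolding stage_cost_def by (rule integral_abs_bound)
  also have "\<dots> \<le> b * \<xi> (snd q)"
    using integrable_clipped_cost[OF q] clipped_cost_bound[OF x]
    by (intro integral_le_const) auto
  finally show ?thesis .
qed

lemma stage_cost_measurable[measurable]: "stage_cost t \<in> borel_measurable (Qt t)"
proof -
  have "(\<lambda>q. distr (input_kernel t q) (Xs \<Otimes>\<^sub>M Us) (\<lambda>u. (snd q, u))) \<in> Qt t \<rightarrow>\<^sub>M prob_algebra (Xs \<Otimes>\<^sub>M Us)"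
    by (rule measurable_distr_prob_space2[OF input_kernel_measurable]) (simp add: Qt_def split_beta')
  from measurable_compose[OF measurable_prob_algebraD[OF this]
      integral_measurable_subprob_algebra[OF clipped_cost_measurable]]
  have "(\<lambda>q. \<integral>z. (case z of (x, u) \<Rightarrow> clipped_cost x u) \<partial>distr (input_kernel t q) (Xs \<Otimes>\<^sub>M Us) (\<lambda>u. (snd q, u)))
    \<in> borel_measurable (Qt t)" .
  then show ?thesis
  proof (rule measurable_cong[THEN iffD1, rotated])
    fix q assume q: "q \<in> space (Qt t)"
    have "(\<lambda>u. (snd q, u)) \<in> input_kernel t q \<rightarrow>\<^sub>M Xs \<Otimes>\<^sub>M Us"
      using q space_Qt sets_input_kernel(1)[OF q] by (simp cong: measurable_cong_sets)
    then show "(\<integral>z. (case z of (x, u) \<Rightarrow> clipped_cost x u) \<partial>distr (input_kernel t q) (Xs \<Otimes>\<^sub>M Us) (\<lambda>u. (snd q, u)))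
       = stage_cost t q"
      by (simp add: integral_distr[OF _ clipped_cost_measurable] stage_cost_def)
  qed
qed

text \<open>Costs and negated costs satisfy the same bounds, so the one-sided comparison
  \<open>J_le\<close> works in both directions.\<close>

lemma chain:
  assumes "\<sigma> \<in> {1, -1 :: real}"
  shows "weighted_chain Qt move_kernel (\<lambda>q. \<xi> (snd q)) (\<lambda>t q. \<sigma> * stage_cost t q) \<alpha> \<beta> b ((\<lambda>_. undefined), x\<^sub>0)"
proof
  show "move_kernel t \<in> Qt t \<rightarrow>\<^sub>M prob_algebra (Qt (Suc t))" for t by (rule move_kernel_measurable)
  show "(\<lambda>q. \<xi> (snd q)) \<in> borel_measurable (Qt t)" for t unfolding Qt_def by measurable
  show "1 \<le> \<xi> (snd q)" if "q \<in> space (Qt t)" for t q using that space_Qt xi_ge_1 by auto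
  show "(\<integral>\<^sup>+y. ennreal (\<xi> (snd y)) \<partial>move_kernel t q) \<le> ennreal (\<beta> * \<xi> (snd q))" if "q \<in> space (Qt t)" for t q
    by (rule move_drift[OF that])
  show "(\<lambda>q. \<sigma> * stage_cost t q) \<in> borel_measurable (Qt t)" for t by measurable
  show "\<bar>\<sigma> * stage_cost t q\<bar> \<le> b * \<xi> (snd q)" if "q \<in> space (Qt t)" for t q
    using stage_cost_bound[OF that] assms by (auto simp: abs_mult)
  show "((\<lambda>_. undefined), x\<^sub>0) \<in> space (Qt 0)"
    using x\<^sub>0 by (simp add: space_Qt Pt_def space_PiM PiE_def extensional_def)
qed (use b_nonneg discount beta tau in \<open>auto simp: \<tau>_def\<close>)

sublocale pos: weighted_chain Qt move_kernel "\<lambda>q. \<xi> (snd q)" "\<lambda>t q. stage_cost t q" \<alpha> \<beta> b "((\<lambda>_. undefined), x\<^sub>0)"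
  using chain[of 1] by simp

section \<open>The Ionescu-Tulcea law and its finite-time marginals\<close>

lemma step_kernel_measurable: "step_kernel S \<pi> \<gamma> x\<^sub>0 t \<in> Pt t \<rightarrow>\<^sub>M prob_algebra Ss"
proof -
  have eq: "step_kernel S \<pi> \<gamma> x\<^sub>0 t = (\<lambda>\<omega>. next_state_law S x\<^sub>0 t \<omega> \<bind> (\<lambda>x.
     input_kernel t (\<omega>, x) \<bind> (\<lambda>u. law_kernel t (\<omega>, x) u \<bind> (\<lambda>\<mu>. return Ss (x, u, \<mu>)))))"
    by (simp add: step_kernel_def[abs_def] input_kernel_def law_kernel_def)
  have r: "(\<lambda>z. return Ss (snd (fst (fst z)), snd (fst z), snd z)) \<in> (Qt t \<Otimes>\<^sub>M Us) \<Otimes>\<^sub>M PA \<rightarrow>\<^sub>M prob_algebra Ss"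
    by (rule measurable_compose[OF step_measurable measurable_return_prob_space])
      (simp_all add: Qt_def)
  have l: "(\<lambda>z. law_kernel t (fst z) (snd z) \<bind> (\<lambda>\<mu>. return Ss (snd (fst z), snd z, \<mu>))) \<in> Qt t \<Otimes>\<^sub>M Us \<rightarrow>\<^sub>M prob_algebra Ss"
    using law_kernel_measurable r by (intro measurable_bind_prob_space2[where N=PA]) (simp_all add: split_beta')
  have i: "(\<lambda>q. input_kernel t q \<bind> (\<lambda>u. law_kernel t q u \<bind> (\<lambda>\<mu>. return Ss (snd q, u, \<mu>)))) \<in> Qt t \<rightarrow>\<^sub>M prob_algebra Ss"
    using l by (intro measurable_bind_prob_space2[OF input_kernel_measurable]) (simp add: split_beta')
  show ?thesis
    unfolding eq using i unfolding Qt_def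
    by (intro measurable_bind_prob_space2[OF next_state_measurable]) (simp add: split_beta')
qed

sublocale IT: Ionescu_Tulcea "step_kernel S \<pi> \<gamma> x\<^sub>0" "\<lambda>_. Ss"
proof (rule Ionescu_Tulcea.intro)
  show "step_kernel S \<pi> \<gamma> x\<^sub>0 i \<in> PiM {0..<i} (\<lambda>_. Ss) \<rightarrow>\<^sub>M subprob_algebra Ss" for i
    using measurable_prob_algebraD[OF step_kernel_measurable] by (simp add: Pt_def)
  show "prob_space (step_kernel S \<pi> \<gamma> x\<^sub>0 i x)" if "x \<in> space (PiM {0..<i} (\<lambda>_. Ss))" for i x
    using measurable_space[OF step_kernel_measurable, of x i] that by (simp add: Pt_def space_prob_algebra)
qed

text \<open>State, input and law are drawn in the same order on both sides. Only the bookkeeping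
  differs: \<open>eP\<close> draws a whole step and then appends it, whereas the chain carries the
  past along. Pushing the update through the binds is all that is required.\<close>

lemma eP_eq:
  assumes \<omega>: "\<omega> \<in> space (Pt t)"
  shows "IT.eP t \<omega> = state_kernel t \<omega> \<bind> act_kernel t"
proof -
  let ?n = "next_state_law S x\<^sub>0 t \<omega>"
  let ?B = "\<lambda>x u. law_kernel t (\<omega>, x) u \<bind> (\<lambda>\<mu>. return Ss (x, u, \<mu>))"
  let ?D = "\<lambda>x u. distr (law_kernel t (\<omega>, x) u) Ss (\<lambda>\<mu>. (x, u, \<mu>))"
  let ?E = "\<lambda>x. input_kernel t (\<omega>, x) \<bind> ?D x"
  let ?F = "\<lambda>x. input_kernel t (\<omega>, x) \<bind> ?B x"
  have n: "sets ?n = sets Xs" "space ?n = X" and "prob_space ?n"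
    using measurable_space[OF next_state_measurable \<omega>]
    by (auto simp: space_prob_algebra dest: sets_eq_imp_space_eq)
  have ne: "X \<noteq> {}" using x\<^sub>0 by auto
  have upd: "fun_upd \<omega> t \<in> Ss \<rightarrow>\<^sub>M Pt (Suc t)"
    using \<omega> unfolding Pt_def by (intro measurable_fun_upd[where J="{0..<t}"] measurable_const) auto
  have qx: "(\<omega>, x) \<in> space (Qt t)" if "x \<in> X" for x using \<omega> that by (simp add: space_Qt)
  have i: "?B x u = ?D x u"
    and im: "(\<lambda>\<mu>. (x, u, \<mu>)) \<in> law_kernel t (\<omega>, x) u \<rightarrow>\<^sub>M Ss"
    if "x \<in> X" "u \<in> U" for x u
  proof -
    note l = law_kernel_prob[OF qx[OF that(1)] that(2)]
    have "(\<lambda>\<mu>. (x, u, \<mu>)) \<in> PA \<rightarrow>\<^sub>M Ss"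
      using that by (intro step_measurable measurable_const) auto
    then show im: "(\<lambda>\<mu>. (x, u, \<mu>)) \<in> law_kernel t (\<omega>, x) u \<rightarrow>\<^sub>M Ss"
      using l by (simp cong: measurable_cong_sets)
    show "?B x u = ?D x u"
      by (rule bind_return_distr'[OF prob_space.not_empty[OF l(4)] im])
  qed
  have inner: "?F x
      = ?E x" if "x \<in> X" for x
    using i[OF that] sets_input_kernel(2)[OF qx[OF that]] by (intro bind_cong refl) auto
  have law2: "(\<lambda>z. law_kernel t (\<omega>, fst z) (snd z)) \<in> Xs \<Otimes>\<^sub>M Us \<rightarrow>\<^sub>M prob_algebra PA"
  proof -
    have "(\<lambda>z. ((\<omega>, fst z), snd z)) \<in> Xs \<Otimes>\<^sub>M Us \<rightarrow>\<^sub>M Qt t \<Otimes>\<^sub>M Us"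
      using \<omega> unfolding Qt_def by measurable
    from measurable_compose[OF this law_kernel_measurable] show ?thesis by simp
  qed
  have inp: "(\<lambda>x. input_kernel t (\<omega>, x)) \<in> Xs \<rightarrow>\<^sub>M prob_algebra Us"
  proof -
    have "(\<lambda>x. (\<omega>, x)) \<in> Xs \<rightarrow>\<^sub>M Qt t" using \<omega> unfolding Qt_def by measurable
    from measurable_compose[OF this input_kernel_measurable] show ?thesis .
  qed
  have d2: "(\<lambda>z. ?D (fst z) (snd z)) \<in> Xs \<Otimes>\<^sub>M Us \<rightarrow>\<^sub>M prob_algebra Ss"
    by (rule measurable_distr_prob_space2[OF law2]) (unfold split_beta', rule step_measurable, measurable)
  have d1: "(\<lambda>u. ?D x u) \<in> Us \<rightarrow>\<^sub>M prob_algebra Ss" if "x \<in> X" for x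
  proof -
    have "(\<lambda>u. (x, u)) \<in> Us \<rightarrow>\<^sub>M Xs \<Otimes>\<^sub>M Us" using that by (intro measurable_Pair measurable_const) auto
    from measurable_compose[OF this d2] show ?thesis by simp
  qed
  have b2: "(\<lambda>x. ?E x) \<in> Xs \<rightarrow>\<^sub>M prob_algebra Ss"
    by (rule measurable_bind_prob_space2[OF inp]) (use d2 in \<open>simp add: split_beta'\<close>)
  then have b2n: "(\<lambda>x. ?E x) \<in> ?n \<rightarrow>\<^sub>M subprob_algebra Ss"
    using n by (auto dest: measurable_prob_algebraD cong: measurable_cong_sets)
  have "step_kernel S \<pi> \<gamma> x\<^sub>0 t \<omega> = ?n \<bind> (\<lambda>x.
     ?F x)"
    by (simp add: step_kernel_def input_kernel_def law_kernel_def)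
  also have "\<dots> = ?n \<bind> (\<lambda>x. ?E x)"
    by (rule bind_cong[OF refl]) (use inner n in simp)
  finally have "IT.eP t \<omega> = distr (?n \<bind> (\<lambda>x. ?E x))
      (Pt (Suc t)) (fun_upd \<omega> t)"
    by (simp add: IT.eP_def Pt_def)
  also have "\<dots> = ?n \<bind> (\<lambda>x. distr (?E x) (Pt (Suc t)) (fun_upd \<omega> t))"
    using n ne by (intro distr_bind[OF b2n _ upd]) auto
  also have "\<dots> = ?n \<bind> (\<lambda>x. act_kernel t (\<omega>, x))"
  proof (intro bind_cong refl)
    fix x assume "x \<in> space ?n"
    then have x: "x \<in> X" using n by simp
    note ik = sets_input_kernel[OF qx[OF x]]
    have "distr (?E x) (Pt (Suc t)) (fun_upd \<omega> t)
      = input_kernel t (\<omega>, x) \<bind> (\<lambda>u. distr (?D x u) (Pt (Suc t)) (fun_upd \<omega> t))"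
      using d1[OF x] ik(1) prob_space.not_empty[OF ik(3)]
      by (intro distr_bind[OF _ _ upd]) (auto dest: measurable_prob_algebraD cong: measurable_cong_sets)
    also have "\<dots> = act_kernel t (\<omega>, x)"
      unfolding act_kernel_def
    proof (intro bind_cong refl)
      fix u assume "u \<in> space (input_kernel t (\<omega>, x))"
      then have u: "u \<in> U" using ik by simp
      show "distr (?D x u) (Pt (Suc t)) (fun_upd \<omega> t)
        = distr (law_kernel t (\<omega>, x) u) (Pt (Suc t)) (extend t (\<omega>, x) u)"
        unfolding distr_distr[OF upd im[OF x u]]
        by (simp add: extend_def[abs_def] comp_def)
    qed
    finally show "distr (?E x) (Pt (Suc t)) (fun_upd \<omega> t)
      = act_kernel t (\<omega>, x)" .
  qed
  also have "\<dots> = state_kernel t \<omega> \<bind> act_kernel t"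
  proof -
    have "(\<lambda>x. (\<omega>, x)) \<in> Xs \<rightarrow>\<^sub>M Qt t" using \<omega> unfolding Qt_def by measurable
    then have "(\<lambda>x. (\<omega>, x)) \<in> ?n \<rightarrow>\<^sub>M Qt t" using n by (simp cong: measurable_cong_sets)
    then show ?thesis
      unfolding state_kernel_def using n ne
      by (intro bind_distr[symmetric, OF _ measurable_prob_algebraD[OF act_kernel_measurable]]) auto
  qed
  finally show ?thesis .
qed

text \<open>The law of the first \<open>t\<close> steps; the starting point is the only element of
  the empty product.\<close>

definition path_law :: "nat \<Rightarrow> (nat \<Rightarrow> ('n, 'm, 'l) play_step) measure"
  where "path_law t = IT.C 0 t (\<lambda>_. undefined)"

lemma undefined_in: "(\<lambda>_. undefined) \<in> space (PiM {0..<0::nat} (\<lambda>_. Ss))"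
  by (simp add: space_PiM PiE_def extensional_def)

lemma path_law_sets: "sets (path_law t) = sets (Pt t)" "space (path_law t) = space (Pt t)"
  unfolding path_law_def Pt_def using IT.sets_C[OF undefined_in, of t] IT.space_C[OF undefined_in, of t] by auto

text \<open>Play and chain alternate between the same two kernels. \<open>path_law\<close> cuts the
  sequence before a state is drawn and \<open>R\<close> cuts it afterwards, so associativity of bind
  translates one into the other.\<close>

lemma path_law_Suc: "path_law (Suc t) = pos.R t \<bind> act_kernel t"
proof -
  have Suc: "path_law (Suc t) = (path_law t \<bind> state_kernel t) \<bind> act_kernel t" for t
  proof -
    have "path_law (Suc t) = path_law t \<bind> IT.eP t" by (simp add: path_law_def)
    also have "\<dots> = path_law t \<bind> (\<lambda>\<omega>. state_kernel t \<omega> \<bind> act_kernel t)"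
      using path_law_sets eP_eq by (intro bind_cong refl) auto
    also have "\<dots> = (path_law t \<bind> state_kernel t) \<bind> act_kernel t"
    proof (rule bind_assoc[symmetric, OF _ measurable_prob_algebraD[OF act_kernel_measurable]])
      show "state_kernel t \<in> path_law t \<rightarrow>\<^sub>M subprob_algebra (Qt t)"
        using measurable_prob_algebraD[OF state_kernel_measurable] path_law_sets(1)
        by (simp cong: measurable_cong_sets)
    qed
    finally show ?thesis .
  qed
  have R: "path_law t \<bind> state_kernel t = pos.R t" for t
  proof (induction t)
    case 0
    have u: "(\<lambda>_. undefined) \<in> space (Pt 0)" using undefined_in by (simp add: Pt_def)
    have "path_law 0 \<bind> state_kernel 0 = state_kernel 0 (\<lambda>_. undefined)"
      unfolding path_law_def IT.C.simps Pt_def[symmetric]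
      by (rule bind_return[OF measurable_prob_algebraD[OF state_kernel_measurable] u])
    also have "\<dots> = return (Qt 0) ((\<lambda>_. undefined), x\<^sub>0)"
      unfolding state_kernel_def next_state_law_def using u x\<^sub>0
      by (simp add: distr_return Qt_def)
    finally show ?case by simp
  next
    case (Suc t)
    have "path_law (Suc t) \<bind> state_kernel (Suc t) = pos.R t \<bind> act_kernel t \<bind> state_kernel (Suc t)"
      by (simp only: Suc.IH \<open>\<And>t. path_law (Suc t) = _\<close>)
    also have "\<dots> = pos.R t \<bind> (\<lambda>q. act_kernel t q \<bind> state_kernel (Suc t))"
    proof -
      have "act_kernel t \<in> pos.R t \<rightarrow>\<^sub>M subprob_algebra (Pt (Suc t))"
        using measurable_prob_algebraD[OF act_kernel_measurable]
        by (simp cong: measurable_cong_sets)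
      from bind_assoc[OF this measurable_prob_algebraD[OF state_kernel_measurable]] show ?thesis .
    qed
    also have "\<dots> = pos.R t \<bind> move_kernel t"
      unfolding move_kernel_def[abs_def] ..
    finally show ?case by simp
  qed
  show "path_law (Suc t) = pos.R t \<bind> act_kernel t" by (simp only: Suc R)
qed

abbreviation "play \<equiv> play_law S \<pi> \<gamma> x\<^sub>0"

lemma play_law_eq: "play = IT.PF.lim"
  by (simp add: play_law_def)

lemma sets_play_law[measurable_cong]: "sets (play) = sets (PiM UNIV (\<lambda>_. Ss))"
  by (simp add: play_law_eq)

lemma path_law_distr: "path_law n = distr (play) (Pt n) (\<lambda>\<omega>. restrict \<omega> {0..<n})"
proof -
  have up: "IT.up_to {0..<n} = n"
    using IT.up_to[of "{0..<n}"] by (intro antisym) (auto simp: IT.up_to_iff)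
  have "distr (play) (Pt n) (\<lambda>\<omega>. restrict \<omega> {0..<n}) = IT.CI {0..<n}"
    unfolding play_law_eq Pt_def by (rule IT.distr_lim) simp
  also have "\<dots> = path_law n"
    using IT.distr_C[OF order_refl undefined_in, of n] by (simp add: IT.CI_def up path_law_def)
  finally show ?thesis ..
qed

lemma restrict_play_measurable: "(\<lambda>\<omega>. restrict \<omega> {0..<n}) \<in> play \<rightarrow>\<^sub>M Pt n"
  unfolding Pt_def measurable_cong_sets[OF sets_play_law refl]
  by (intro measurable_restrict measurable_component_singleton) simp

lemma component_play_measurable: "(\<lambda>\<omega>. \<omega> t) \<in> play \<rightarrow>\<^sub>M Ss"
  unfolding measurable_cong_sets[OF sets_play_law refl]
  by (intro measurable_component_singleton) simp

lemma act_kernel_R: "act_kernel t \<in> pos.R t \<rightarrow>\<^sub>M subprob_algebra (Pt (Suc t))"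
  using measurable_prob_algebraD[OF act_kernel_measurable] by (simp cong: measurable_cong_sets)

lemma last_component: "(\<lambda>\<omega>. \<omega> t) \<in> Pt (Suc t) \<rightarrow>\<^sub>M Ss"
  by (rule component_measurable) simp

lemma nn_integral_play:
  assumes G: "G \<in> borel_measurable Ss"
  shows "(\<integral>\<^sup>+\<omega>. G (\<omega> t) \<partial>play)
    = (\<integral>\<^sup>+q. \<integral>\<^sup>+u. \<integral>\<^sup>+\<mu>. G (snd q, u, \<mu>) \<partial>law_kernel t q u \<partial>input_kernel t q \<partial>pos.R t)"
proof -
  have m: "(\<lambda>\<omega>. G (\<omega> t)) \<in> borel_measurable (Pt (Suc t))"
    by (rule measurable_compose[OF last_component G])
  have "(\<integral>\<^sup>+\<omega>. G (\<omega> t) \<partial>play) = (\<integral>\<^sup>+\<omega>. G (\<omega> t) \<partial>path_law (Suc t))"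
    unfolding path_law_distr by (subst nn_integral_distr[OF restrict_play_measurable]) (use m in auto)
  also have "\<dots> = (\<integral>\<^sup>+q. \<integral>\<^sup>+\<omega>. G (\<omega> t) \<partial>act_kernel t q \<partial>pos.R t)"
    unfolding path_law_Suc by (rule nn_integral_bind[OF m act_kernel_R])
  also have "\<dots> = (\<integral>\<^sup>+q. \<integral>\<^sup>+u. \<integral>\<^sup>+\<mu>. G (snd q, u, \<mu>) \<partial>law_kernel t q u \<partial>input_kernel t q \<partial>pos.R t)"
    by (intro nn_integral_cong) (simp add: nn_integral_act[OF _ m] extend_def)
  finally show ?thesis .
qed

lemma nn_integral_play_state:
  "(\<integral>\<^sup>+\<omega>. ennreal (\<xi> (fst (\<omega> t))) \<partial>play) \<le> ennreal (\<beta> ^ t * \<xi> x\<^sub>0)"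
proof -
  have G: "(\<lambda>y. ennreal (\<xi> (fst y))) \<in> borel_measurable Ss"
    by (intro measurable_compose[OF measurable_compose[OF step_parts(1) xi_measurable]] measurable_ennreal)
  have "(\<integral>\<^sup>+\<omega>. ennreal (\<xi> (fst (\<omega> t))) \<partial>play) \<le> (\<integral>\<^sup>+q. ennreal (\<xi> (snd q)) \<partial>pos.R t)"
    unfolding nn_integral_play[OF G] fst_conv
  proof (rule nn_integral_mono)
    fix q assume "q \<in> space (pos.R t)"
    then have q: "q \<in> space (Qt t)" by simp
    interpret i: prob_space "input_kernel t q" by (rule sets_input_kernel[OF q])
    show "(\<integral>\<^sup>+u. \<integral>\<^sup>+\<mu>. ennreal (\<xi> (snd q)) \<partial>law_kernel t q u \<partial>input_kernel t q) \<le> ennreal (\<xi> (snd q))"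
    proof (rule i.nn_integral_le_const)
      show "AE u in input_kernel t q. (\<integral>\<^sup>+\<mu>. ennreal (\<xi> (snd q)) \<partial>law_kernel t q u) \<le> ennreal (\<xi> (snd q))"
      proof (rule AE_I2)
        fix u assume "u \<in> space (input_kernel t q)"
        then have "u \<in> U" using sets_input_kernel[OF q] by simp
        then interpret l: prob_space "law_kernel t q u" by (rule law_kernel_prob[OF q])
        show "(\<integral>\<^sup>+\<mu>. ennreal (\<xi> (snd q)) \<partial>law_kernel t q u) \<le> ennreal (\<xi> (snd q))"
          by (intro l.nn_integral_le_const) auto
      qed
    qed simp
  qed
  also have "\<dots> \<le> ennreal (\<beta> ^ t * \<xi> x\<^sub>0)" using pos.R_drift[of t] by simp
  finally show ?thesis .
qed

section \<open>Expected costs along the play\<close>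

definition step_cost :: "('n, 'm, 'l) play_step \<Rightarrow> real"
  where "step_cost y = clipped_cost (fst y) (fst (snd y))"

lemma step_cost_measurable: "step_cost \<in> borel_measurable Ss"
proof -
  have "(\<lambda>y. (fst y, fst (snd y))) \<in> Ss \<rightarrow>\<^sub>M Xs \<Otimes>\<^sub>M Us" by (intro measurable_Pair step_parts)
  from measurable_compose[OF this clipped_cost_measurable] show ?thesis by (simp add: step_cost_def[abs_def])
qed

lemma step_cost_bound: "y \<in> space Ss \<Longrightarrow> \<bar>step_cost y\<bar> \<le> b * \<xi> (fst y)"
  unfolding step_cost_def using measurable_space[OF step_parts(1)] by (intro clipped_cost_bound) simp

lemma play_component_in: "\<omega> \<in> space (play) \<Longrightarrow> \<omega> t \<in> space Ss"
  by (rule measurable_space[OF component_play_measurable])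

lemma nn_integral_step_cost:
  "(\<integral>\<^sup>+\<omega>. ennreal \<bar>step_cost (\<omega> t)\<bar> \<partial>play) \<le> ennreal (b * (\<beta> ^ t * \<xi> x\<^sub>0))"
proof -
  have m: "(\<lambda>\<omega>. ennreal (\<xi> (fst (\<omega> t)))) \<in> borel_measurable (play)"
    by (intro measurable_ennreal measurable_compose[OF component_play_measurable
          measurable_compose[OF step_parts(1) xi_measurable]] measurable_compose[OF _ measurable_ennreal])
  have "(\<integral>\<^sup>+\<omega>. ennreal \<bar>step_cost (\<omega> t)\<bar> \<partial>play)
     \<le> (\<integral>\<^sup>+\<omega>. ennreal b * ennreal (\<xi> (fst (\<omega> t))) \<partial>play)"
    using step_cost_bound[OF play_component_in] b_nonneg
    by (intro nn_integral_mono) (simp add: ennreal_mult'[symmetric] ennreal_leI)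
  also have "\<dots> = ennreal b * (\<integral>\<^sup>+\<omega>. ennreal (\<xi> (fst (\<omega> t))) \<partial>play)"
    by (rule nn_integral_cmult[OF m])
  also have "\<dots> \<le> ennreal b * ennreal (\<beta> ^ t * \<xi> x\<^sub>0)"
    by (intro mult_left_mono nn_integral_play_state) simp
  finally show ?thesis using b_nonneg by (simp add: ennreal_mult'[symmetric])
qed

lemma integrable_step_cost: "integrable (play) (\<lambda>\<omega>. step_cost (\<omega> t))"
  using nn_integral_step_cost[of t]
  by (intro integrableI_bounded measurable_compose[OF component_play_measurable step_cost_measurable])
    (auto simp: le_less_trans)

lemma integral_act_step_cost:
  assumes q: "q \<in> space (Qt t)"
  shows "(\<integral>\<omega>. step_cost (\<omega> t) \<partial>act_kernel t q) = stage_cost t q"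
proof -
  have x: "snd q \<in> X" using q space_Qt by auto
  have m: "(\<lambda>\<omega>. step_cost (\<omega> t)) \<in> borel_measurable (Pt (Suc t))"
    by (rule measurable_compose[OF last_component step_cost_measurable])
  have sc: "step_cost (extend t q u \<mu> t) = clipped_cost (snd q) u" for u \<mu>
    by (simp add: step_cost_def extend_def)
  have inner: "(\<integral>\<omega>. step_cost (\<omega> t) \<partial>distr (law_kernel t q u) (Pt (Suc t)) (extend t q u)) = clipped_cost (snd q) u"
    if "u \<in> U" for u
    using prob_space.prob_space[OF law_kernel_prob(4)[OF q that]]
    by (simp add: integral_distr[OF extend_section'[OF q that] m] sc)
  interpret i: prob_space "input_kernel t q" by (rule sets_input_kernel[OF q])
  have "(\<integral>\<^sup>+u. \<integral>\<^sup>+\<omega>. ennreal \<bar>step_cost (\<omega> t)\<bar> \<partial>distr (law_kernel t q u) (Pt (Suc t)) (extend t q u) \<partial>input_kernel t q)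
     \<le> ennreal (b * \<xi> (snd q))"
  proof (intro i.nn_integral_le_const AE_I2)
    fix u assume "u \<in> space (input_kernel t q)"
    then have u: "u \<in> U" using sets_input_kernel[OF q] by simp
    interpret l: prob_space "law_kernel t q u" by (rule law_kernel_prob[OF q u])
    have "(\<integral>\<^sup>+\<omega>. ennreal \<bar>step_cost (\<omega> t)\<bar> \<partial>distr (law_kernel t q u) (Pt (Suc t)) (extend t q u))
       = (\<integral>\<^sup>+\<mu>. ennreal \<bar>clipped_cost (snd q) u\<bar> \<partial>law_kernel t q u)"
      using m by (subst nn_integral_distr[OF extend_section'[OF q u]]) (simp_all add: sc)
    also have "\<dots> \<le> ennreal (b * \<xi> (snd q))"
      using clipped_cost_bound[OF x] by (intro l.nn_integral_le_const AE_I2 ennreal_leI) auto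
    finally show "(\<integral>\<^sup>+\<omega>. ennreal \<bar>step_cost (\<omega> t)\<bar> \<partial>distr (law_kernel t q u) (Pt (Suc t)) (extend t q u))
       \<le> ennreal (b * \<xi> (snd q))" .
  qed simp
  then have "(\<integral>\<omega>. step_cost (\<omega> t) \<partial>act_kernel t q)
    = (\<integral>u. \<integral>\<omega>. step_cost (\<omega> t) \<partial>distr (law_kernel t q u) (Pt (Suc t)) (extend t q u) \<partial>input_kernel t q)"
    unfolding act_kernel_def
    by (intro integral_bind_kernel[OF act_inner_section'[OF q] m]) (auto simp: le_less_trans)
  also have "\<dots> = stage_cost t q"
    unfolding stage_cost_def using inner sets_input_kernel(2)[OF q] by (intro Bochner_Integration.integral_cong) auto
  finally show ?thesis .
qed

lemma integral_play_step_cost: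
  "(\<integral>\<omega>. step_cost (\<omega> t) \<partial>play) = (\<integral>q. stage_cost t q \<partial>pos.R t)"
proof -
  have m: "(\<lambda>\<omega>. step_cost (\<omega> t)) \<in> borel_measurable (Pt (Suc t))"
    by (rule measurable_compose[OF last_component step_cost_measurable])
  have "(\<integral>\<^sup>+q. \<integral>\<^sup>+\<omega>. ennreal \<bar>step_cost (\<omega> t)\<bar> \<partial>act_kernel t q \<partial>pos.R t)
     = (\<integral>\<^sup>+\<omega>. ennreal \<bar>step_cost (\<omega> t)\<bar> \<partial>path_law (Suc t))"
    unfolding path_law_Suc using m by (intro nn_integral_bind[OF _ act_kernel_R, symmetric]) measurable
  also have "\<dots> = (\<integral>\<^sup>+\<omega>. ennreal \<bar>step_cost (\<omega> t)\<bar> \<partial>play)"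
    unfolding path_law_distr by (subst nn_integral_distr[OF restrict_play_measurable]) (use m in auto)
  also have "\<dots> < \<infinity>" using nn_integral_step_cost[of t] by (auto simp: le_less_trans)
  finally have fin: "(\<integral>\<^sup>+q. \<integral>\<^sup>+\<omega>. ennreal \<bar>step_cost (\<omega> t)\<bar> \<partial>act_kernel t q \<partial>pos.R t) < \<infinity>" .
  have "(\<integral>\<omega>. step_cost (\<omega> t) \<partial>play) = (\<integral>\<omega>. step_cost (\<omega> t) \<partial>path_law (Suc t))"
    unfolding path_law_distr by (subst integral_distr[OF restrict_play_measurable m]) simp
  also have "\<dots> = (\<integral>q. \<integral>\<omega>. step_cost (\<omega> t) \<partial>act_kernel t q \<partial>pos.R t)"
    unfolding path_law_Suc by (rule integral_bind_kernel[OF act_kernel_R m fin])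
  also have "\<dots> = (\<integral>q. stage_cost t q \<partial>pos.R t)"
    using integral_act_step_cost by (intro Bochner_Integration.integral_cong) auto
  finally show ?thesis .
qed

lemma AE_play_cost:
  "AE \<omega> in play. cost S (fst (\<omega> t)) (fst (snd (\<omega> t))) = step_cost (\<omega> t)"
proof -
  \<comment> \<open>Equality of two measurable functions is a measurable event, which
    \<open>AE_bind\<close> demands; membership in \<open>K\<close> is not known to be one.\<close>
  define P where "P y \<longleftrightarrow> cost S (fst y) (fst (snd y)) = step_cost y" for y :: "('n, 'm, 'l) play_step"
  have c: "(\<lambda>y. cost S (fst y) (fst (snd y))) \<in> borel_measurable Ss"
    using measurable_compose[OF measurable_Pair[OF step_parts(1,2)] cost_measurable] by simp
  have Pm: "Measurable.pred Ss P"
    unfolding P_def using c step_cost_measurable by measurable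
  have m: "Measurable.pred (Pt (Suc t)) (\<lambda>\<omega>. P (\<omega> t))"
    by (rule measurable_compose[OF last_component Pm])
  have act: "AE \<omega> in act_kernel t q. P (\<omega> t)" if q: "q \<in> space (Qt t)" for q
    unfolding act_kernel_def AE_bind[OF act_inner_section'[OF q] m]
    using input_kernel_admissible[OF q]
  proof eventually_elim
    case (elim u)
    then have "P (extend t q u \<mu> t)" for \<mu>
      by (simp add: P_def step_cost_def extend_def clipped_cost_eq)
    then show ?case
      using m by (subst AE_distr_iff[OF extend_section'[OF q K_input[OF elim]]]) (auto simp: pred_def)
  qed
  then have "AE \<omega> in path_law (Suc t). P (\<omega> t)"
    unfolding path_law_Suc AE_bind[OF act_kernel_R m] by (rule AE_I2) (simp add: act)
  from AE_distrD[OF restrict_play_measurable this[unfolded path_law_distr]]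
  show ?thesis by (simp add: P_def)
qed

text \<open>The expected moduli of the discounted costs are dominated by a geometric series of ratio
  \<open>\<tau>\<close>, which justifies exchanging sum and integral.\<close>

lemma total_cost_eq: "total_cost S \<pi> \<gamma> x\<^sub>0 = pos.J"
proof -
  let ?f = "\<lambda>t \<omega>. \<alpha> ^ t * step_cost (\<omega> t)"
  have cm: "(\<lambda>\<omega>. cost S (fst (\<omega> t)) (fst (snd (\<omega> t)))) \<in> borel_measurable play" for t
    using measurable_compose[OF component_play_measurable
        measurable_compose[OF measurable_Pair[OF step_parts(1,2)] cost_measurable], of t] by simp
  have sm: "(\<lambda>\<omega>. step_cost (\<omega> t)) \<in> borel_measurable play" for t
    by (rule measurable_compose[OF component_play_measurable step_cost_measurable])
  have norm: "(\<integral>\<^sup>+\<omega>. ennreal (norm (?f t \<omega>)) \<partial>play) \<le> ennreal (b * \<xi> x\<^sub>0 * \<tau> ^ t)" for t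
  proof -
    have "(\<integral>\<^sup>+\<omega>. ennreal (norm (?f t \<omega>)) \<partial>play) = ennreal (\<alpha> ^ t) * (\<integral>\<^sup>+\<omega>. ennreal \<bar>step_cost (\<omega> t)\<bar> \<partial>play)"
      using sm[of t] discount by (subst nn_integral_cmult[symmetric]) (auto simp: abs_mult ennreal_mult')
    also have "\<dots> \<le> ennreal (\<alpha> ^ t) * ennreal (b * (\<beta> ^ t * \<xi> x\<^sub>0))"
      by (intro mult_left_mono nn_integral_step_cost) simp
    also have "\<dots> = ennreal (b * \<xi> x\<^sub>0 * \<tau> ^ t)"
      using discount by (simp add: ennreal_mult'[symmetric] \<tau>_def power_mult_distrib mult_ac)
    finally show ?thesis .
  qed
  have geo: "summable (\<lambda>t. b * \<xi> x\<^sub>0 * \<tau> ^ t)"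
    using tau by (intro summable_mult summable_geometric) auto
  have nonneg: "0 \<le> b * \<xi> x\<^sub>0 * \<tau> ^ t" for t
    using b_nonneg xi_ge_1[OF x\<^sub>0] tau by simp
  have int: "integrable play (?f t)" for t
    using integrable_step_cost by simp
  have sumAE: "AE \<omega> in play. summable (\<lambda>t. norm (?f t \<omega>))"
  proof -
    have "(\<integral>\<^sup>+\<omega>. (\<Sum>t. ennreal (norm (?f t \<omega>))) \<partial>play) = (\<Sum>t. \<integral>\<^sup>+\<omega>. ennreal (norm (?f t \<omega>)) \<partial>play)"
      using sm by (intro nn_integral_suminf) simp
    also have "\<dots> \<le> (\<Sum>t. ennreal (b * \<xi> x\<^sub>0 * \<tau> ^ t))"
      by (intro suminf_le norm) auto
    also have "\<dots> < \<infinity>"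
      using suminf_ennreal2[OF nonneg geo] by simp
    finally have "AE \<omega> in play. (\<Sum>t. ennreal (norm (?f t \<omega>))) \<noteq> \<infinity>"
      using sm by (intro nn_integral_PInf_AE) auto
    then show ?thesis
      by eventually_elim (auto intro!: summable_suminf_not_top)
  qed
  have sums: "summable (\<lambda>t. \<integral>\<omega>. norm (?f t \<omega>) \<partial>play)"
  proof (rule summable_comparison_test'[OF geo])
    fix t
    have "ennreal (\<integral>\<omega>. norm (?f t \<omega>) \<partial>play) = (\<integral>\<^sup>+\<omega>. ennreal (norm (?f t \<omega>)) \<partial>play)"
      by (rule nn_integral_eq_integral[symmetric]) (use int in auto)
    also note norm[of t]
    finally show "norm (\<integral>\<omega>. norm (?f t \<omega>) \<partial>play) \<le> b * \<xi> x\<^sub>0 * \<tau> ^ t"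
      using nonneg[of t] by (simp add: ennreal_le_iff)
  qed
  have "AE \<omega> in play. \<forall>t. cost S (fst (\<omega> t)) (fst (snd (\<omega> t))) = step_cost (\<omega> t)"
    using AE_play_cost by (simp add: AE_all_countable)
  then have "total_cost S \<pi> \<gamma> x\<^sub>0 = (\<integral>\<omega>. (\<Sum>t. ?f t \<omega>) \<partial>play)"
    unfolding total_cost_def using cm sm by (intro integral_cong_AE) auto
  also have "\<dots> = (\<Sum>t. \<integral>\<omega>. ?f t \<omega> \<partial>play)"
    by (rule integral_suminf[OF int sumAE sums])
  also have "\<dots> = pos.J"
    by (simp add: pos.J_def integral_play_step_cost)
  finally show ?thesis .
qed

text \<open>The integral of \<open>V\<close> may be meaningless, so the inequality is tested on
  measurable minorants. Admissibility and ambiguity are premises because along a play they hold only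
  almost surely.\<close>

definition supersolution_at :: "real \<Rightarrow> (real ^ 'n \<Rightarrow> real) \<Rightarrow> real \<Rightarrow> real ^ 'n \<Rightarrow> real ^ 'm \<Rightarrow> (real ^ 'l) measure \<Rightarrow> bool"
  where "supersolution_at \<sigma> V \<delta> x u \<mu> \<longleftrightarrow> ((x, u) \<in> K \<longrightarrow> \<mu> \<in> D \<longrightarrow> (\<forall>h C'. h \<in> borel_measurable Xs \<longrightarrow>
    bounded_by C' h \<longrightarrow> (\<forall>x\<in>X. h x \<le> V x) \<longrightarrow>
    \<sigma> * cost S x u + \<alpha> * (\<integral>w. h (f x u w) \<partial>\<mu>) \<le> V x + \<delta> * \<xi> x))"

text \<open>
  With \<open>\<sigma> = 1\<close> this bounds the cost from above by a supersolution \<open>V\<close>, with \<open>\<sigma> = -1\<close> from below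
  by \<open>-V\<close>.
\<close>

lemma play_le:
  assumes \<sigma>: "\<sigma> \<in> {1, -1 :: real}" and V: "bounded_by C V" and \<delta>: "0 \<le> \<delta>"
    and super: "\<And>t q. q \<in> space (Qt t) \<Longrightarrow> AE u in input_kernel t q. AE \<mu> in law_kernel t q u.
      supersolution_at \<sigma> V \<delta> (snd q) u \<mu>"
  shows "\<sigma> * total_cost S \<pi> \<gamma> x\<^sub>0 \<le> V x\<^sub>0 + \<delta> / (1 - \<tau>) * \<xi> x\<^sub>0"
proof -
  interpret ch: weighted_chain Qt move_kernel "\<lambda>q. \<xi> (snd q)" "\<lambda>t q. \<sigma> * stage_cost t q" \<alpha> \<beta> b "((\<lambda>_. undefined), x\<^sub>0)"
    by (rule chain[OF \<sigma>])
  have "ch.J = (\<Sum>t. \<sigma> * (\<alpha> ^ t * (\<integral>q. stage_cost t q \<partial>pos.R t)))"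
    by (simp add: ch.J_def mult_ac)
  also have "\<dots> = \<sigma> * total_cost S \<pi> \<gamma> x\<^sub>0"
    unfolding total_cost_eq pos.J_def by (rule suminf_mult[OF pos.J_summable])
  finally have J: "\<sigma> * total_cost S \<pi> \<gamma> x\<^sub>0 = ch.J" ..
  have "ch.J \<le> V (snd ((\<lambda>_. undefined) :: nat \<Rightarrow> ('n, 'm, 'l) play_step, x\<^sub>0))
      + \<delta> / (1 - \<alpha> * \<beta>) * \<xi> (snd ((\<lambda>_. undefined) :: nat \<Rightarrow> ('n, 'm, 'l) play_step, x\<^sub>0))"
  proof (rule ch.J_le[OF _ _ \<delta>])
    show "\<bar>V (snd q)\<bar> \<le> C * \<xi> (snd q)" if "q \<in> space (Qt t)" for t and q :: "(nat \<Rightarrow> ('n, 'm, 'l) play_step) \<times> (real ^ 'n)"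
      using V that space_Qt by (auto simp: bounded_by_def)
    show "0 \<le> C" using V by (simp add: bounded_by_def)
    fix t q h C'
    assume q: "q \<in> space (Qt t)" and h: "ch.wbound (Suc t) C' h"
      and hV: "\<And>y. y \<in> space (Qt (Suc t)) \<Longrightarrow> h y \<le> V (snd y)"
    \<comment> \<open>The conditional expectation of \<open>h\<close> once the step is fixed and
      before the next state is drawn.\<close>
    define \<phi> where "\<phi> \<omega> = (\<integral>y. h y \<partial>state_kernel (Suc t) \<omega>)" for \<omega>
    let ?d = "\<lambda>u. distr (law_kernel t q u) (Pt (Suc t)) (extend t q u)"
    have x: "snd q \<in> X" using q space_Qt by auto
    have hm: "h \<in> borel_measurable (Qt (Suc t))" and C': "0 \<le> C'"
      and hb: "\<And>y. y \<in> space (Qt (Suc t)) \<Longrightarrow> \<bar>h y\<bar> \<le> C' * \<xi> (snd y)"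
      using h by (auto simp: ch.wbound_def)
    have sk: "state_kernel (Suc t) \<in> Pt (Suc t) \<rightarrow>\<^sub>M subprob_algebra (Qt (Suc t))"
      by (rule measurable_prob_algebraD[OF state_kernel_measurable])
    have \<phi>m: "\<phi> \<in> borel_measurable (Pt (Suc t))"
      unfolding \<phi>_def by (rule measurable_compose[OF sk integral_measurable_subprob_algebra[OF hm]])
    have "(\<integral>\<^sup>+y. ennreal \<bar>h y\<bar> \<partial>move_kernel t q) < \<infinity>"
      using ch.nn_integral_wbound[OF h ch.K_space(1)[OF q]] ch.K_finite[OF q]
      by (auto simp: ennreal_mult_less_top intro: le_less_trans)
    then have fin1: "(\<integral>\<^sup>+\<omega>. \<integral>\<^sup>+y. ennreal \<bar>h y\<bar> \<partial>state_kernel (Suc t) \<omega> \<partial>act_kernel t q) < \<infinity>"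
      unfolding move_kernel_def using hm
      by (subst (asm) nn_integral_bind[OF _ state_kernel_act[OF q]]) auto
    have mv: "(\<integral>y. h y \<partial>move_kernel t q) = (\<integral>\<omega>. \<phi> \<omega> \<partial>act_kernel t q)"
      unfolding move_kernel_def \<phi>_def by (rule integral_bind_kernel[OF state_kernel_act[OF q] hm fin1])
    have "(\<integral>\<^sup>+\<omega>. ennreal \<bar>\<phi> \<omega>\<bar> \<partial>act_kernel t q)
       \<le> (\<integral>\<^sup>+\<omega>. \<integral>\<^sup>+y. ennreal \<bar>h y\<bar> \<partial>state_kernel (Suc t) \<omega> \<partial>act_kernel t q)"
    proof (rule nn_integral_mono)
      fix \<omega>
      show "ennreal \<bar>\<phi> \<omega>\<bar> \<le> (\<integral>\<^sup>+y. ennreal \<bar>h y\<bar> \<partial>state_kernel (Suc t) \<omega>)"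
      \<comment> \<open>The integral of a non-integrable function is 0, for which the bound is
        trivial.\<close>
      proof (cases "integrable (state_kernel (Suc t) \<omega>) h")
        case True
        then show ?thesis using integral_norm_bound_ennreal[OF True] by (simp add: \<phi>_def)
      qed (simp add: \<phi>_def not_integrable_integral_eq)
    qed
    then have "(\<integral>\<^sup>+\<omega>. ennreal \<bar>\<phi> \<omega>\<bar> \<partial>act_kernel t q) < \<infinity>" using fin1 by (rule le_less_trans)
    then have fin2: "(\<integral>\<^sup>+u. \<integral>\<^sup>+\<omega>. ennreal \<bar>\<phi> \<omega>\<bar> \<partial>?d u \<partial>input_kernel t q) < \<infinity>"
      unfolding act_kernel_def using \<phi>m
      by (subst (asm) nn_integral_bind[OF _ act_inner_section'[OF q]]) auto
    have av: "(\<integral>\<omega>. \<phi> \<omega> \<partial>act_kernel t q) = (\<integral>u. \<integral>\<omega>. \<phi> \<omega> \<partial>?d u \<partial>input_kernel t q)"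
      unfolding act_kernel_def by (rule integral_bind_kernel[OF act_inner_section'[OF q] \<phi>m fin2])
    have ai: "integrable (input_kernel t q) (\<lambda>u. \<integral>\<omega>. \<phi> \<omega> \<partial>?d u)"
      by (rule integrable_integral_kernel[OF act_inner_section'[OF q] \<phi>m fin2])
    interpret i: prob_space "input_kernel t q" by (rule sets_input_kernel[OF q])
    have AE: "AE u in input_kernel t q. \<sigma> * clipped_cost (snd q) u + \<alpha> * (\<integral>\<omega>. \<phi> \<omega> \<partial>?d u) \<le> V (snd q) + \<delta> * \<xi> (snd q)"
      using input_kernel_admissible[OF q] super[OF q]
    proof eventually_elim
      case (elim u)
      then have k: "(snd q, u) \<in> K" and u: "u \<in> U" by (auto intro: K_input)
      interpret l: prob_space "law_kernel t q u" by (rule law_kernel_prob[OF q u])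
      have dist: "(\<integral>\<omega>. \<phi> \<omega> \<partial>?d u) = (\<integral>\<mu>. \<phi> (extend t q u \<mu>) \<partial>law_kernel t q u)"
        by (rule integral_distr[OF extend_section'[OF q u] \<phi>m])
      \<comment> \<open>\<open>h\<close> depends on the whole past, but with the past frozen it is a
        function of the state alone, measurable and below \<open>V\<close>; this is what the
        supersolution test accepts.\<close>
      have sec: "\<phi> (extend t q u \<mu>) = (\<integral>w. h (extend t q u \<mu>, f (snd q) u w) \<partial>\<mu>)"
        and secb: "(\<lambda>x. h (extend t q u \<mu>, x)) \<in> borel_measurable Xs"
          "bounded_by C' (\<lambda>x. h (extend t q u \<mu>, x))" "\<forall>x\<in>X. h (extend t q u \<mu>, x) \<le> V x"
        if \<mu>: "\<mu> \<in> space PA" for \<mu>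
      proof -
        show "\<phi> (extend t q u \<mu>) = (\<integral>w. h (extend t q u \<mu>, f (snd q) u w) \<partial>\<mu>)"
          unfolding \<phi>_def state_kernel_extend(1)[OF q u \<mu>]
          by (rule integral_distr[OF state_kernel_extend(2)[OF q u \<mu>] hm])
        have e: "extend t q u \<mu> \<in> space (Pt (Suc t))"
          by (rule measurable_space[OF extend_section[OF q u] \<mu>])
        then have "(\<lambda>x. (extend t q u \<mu>, x)) \<in> Xs \<rightarrow>\<^sub>M Qt (Suc t)" unfolding Qt_def by measurable
        from measurable_compose[OF this hm] show "(\<lambda>x. h (extend t q u \<mu>, x)) \<in> borel_measurable Xs" .
        have "(extend t q u \<mu>, x) \<in> space (Qt (Suc t))" if "x \<in> X" for x
          using e that by (simp add: space_Qt)
        then show "bounded_by C' (\<lambda>x. h (extend t q u \<mu>, x))" "\<forall>x\<in>X. h (extend t q u \<mu>, x) \<le> V x"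
          using hb hV C' by (fastforce simp: bounded_by_def)+
      qed
      \<comment> \<open>The second conjunct makes \<open>\<phi>\<close> integrable over the random
        law.\<close>
      have AE\<mu>: "AE \<mu> in law_kernel t q u. \<sigma> * clipped_cost (snd q) u + \<alpha> * \<phi> (extend t q u \<mu>) \<le> V (snd q) + \<delta> * \<xi> (snd q)
          \<and> \<bar>\<phi> (extend t q u \<mu>)\<bar> \<le> C' * (\<beta> * \<xi> (snd q))"
        using elim(2) law_kernel_D[OF q u] AE_space
      proof eventually_elim
        case (elim \<mu>)
        then have \<mu>: "\<mu> \<in> space PA" using law_kernel_prob(3)[OF q u] by simp
        have "\<bar>\<phi> (extend t q u \<mu>)\<bar> \<le> (\<integral>w. C' * \<xi> (f (snd q) u w) \<partial>\<mu>)"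
        proof -
          have ih: "integrable \<mu> (\<lambda>w. h (extend t q u \<mu>, f (snd q) u w))"
            by (rule integrable_dyn[OF secb(2)[OF \<mu>] secb(1)[OF \<mu>] elim(2) k])
          have "\<bar>\<phi> (extend t q u \<mu>)\<bar> \<le> (\<integral>w. \<bar>h (extend t q u \<mu>, f (snd q) u w)\<bar> \<partial>\<mu>)"
            unfolding sec[OF \<mu>] by (rule integral_abs_bound)
          also have "\<dots> \<le> (\<integral>w. C' * \<xi> (f (snd q) u w) \<partial>\<mu>)"
            using ih xi_integrable[OF elim(2) k] bounded_by_dyn[OF secb(2)[OF \<mu>] k] D_D(3)[OF elim(2)]
            by (intro integral_mono) (auto simp: abs_le_iff minus_le_iff)
          finally show ?thesis .
        qed
        also have "\<dots> \<le> C' * (\<beta> * \<xi> (snd q))"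
          using xi_integral_le[OF elim(2) k] C' by (simp add: mult_left_mono)
        finally have "\<bar>\<phi> (extend t q u \<mu>)\<bar> \<le> C' * (\<beta> * \<xi> (snd q))" .
        moreover have "\<sigma> * cost S (snd q) u + \<alpha> * \<phi> (extend t q u \<mu>) \<le> V (snd q) + \<delta> * \<xi> (snd q)"
          unfolding sec[OF \<mu>] using elim(1) k elim(2) secb[OF \<mu>] unfolding supersolution_at_def by blast
        ultimately show ?case by (simp add: clipped_cost_eq[OF k])
      qed
      have i\<phi>: "integrable (law_kernel t q u) (\<lambda>\<mu>. \<phi> (extend t q u \<mu>))"
        by (rule l.integrable_const_bound[where B="C' * (\<beta> * \<xi> (snd q))"])
          (use AE\<mu> measurable_compose[OF extend_section'[OF q u] \<phi>m] in \<open>auto elim: eventually_mono\<close>)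
      have "(\<integral>\<mu>. \<sigma> * clipped_cost (snd q) u + \<alpha> * \<phi> (extend t q u \<mu>) \<partial>law_kernel t q u) \<le> V (snd q) + \<delta> * \<xi> (snd q)"
        using i\<phi> AE\<mu> by (intro l.integral_le_const) (auto elim: eventually_mono)
      then show ?case using i\<phi> l.prob_space by (simp add: dist)
    qed
    have "\<sigma> * stage_cost t q + \<alpha> * (\<integral>y. h y \<partial>move_kernel t q)
       = (\<integral>u. \<sigma> * clipped_cost (snd q) u + \<alpha> * (\<integral>\<omega>. \<phi> \<omega> \<partial>?d u) \<partial>input_kernel t q)"
      using ai integrable_clipped_cost[OF q] by (simp add: mv av stage_cost_def)
    also have "\<dots> \<le> V (snd q) + \<delta> * \<xi> (snd q)"
      using ai integrable_clipped_cost[OF q] AE by (intro i.integral_le_const) auto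
    finally show "\<sigma> * stage_cost t q + \<alpha> * (\<integral>y. h y \<partial>move_kernel t q) \<le> V (snd q) + \<delta> * \<xi> (snd q)" .
  qed
  then show ?thesis by (simp add: J \<tau>_def)
qed

end

section \<open>Comparison with the value functions\<close>

context robust_control begin

text \<open>A minorant of \<open>V\<close> lies below every integrable majorant of \<open>V\<close>.
  This turns inequalities for \<open>worst_case\<close>, stated with upper integrals, into the test
  on measurable minorants.\<close>

lemma integral_le_upper_integral_dyn:
  assumes h: "h \<in> borel_measurable Xs" "bounded_by C' h" "\<forall>x\<in>X. h x \<le> V x"
    and V: "bounded_by C V" and \<mu>: "\<mu> \<in> D" and k: "(x, u) \<in> K"
  shows "(\<integral>w. h (f x u w) \<partial>\<mu>) \<le> upper_integral \<mu> (\<lambda>w. V (f x u w))"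
proof (rule le_upper_integral)
  show "integrable \<mu> (\<lambda>w. C * \<xi> (f x u w))" using xi_integrable[OF \<mu> k] by simp
  show "V (f x u w) \<le> C * \<xi> (f x u w)" if "w \<in> space \<mu>" for w
    using bounded_by_dyn[OF V k] that D_D(3)[OF \<mu>] by auto
  fix g assume g: "integrable \<mu> g" "\<And>w. w \<in> space \<mu> \<Longrightarrow> V (f x u w) \<le> g w"
  show "(\<integral>w. h (f x u w) \<partial>\<mu>) \<le> integral\<^sup>L \<mu> g"
  proof (rule integral_mono[OF integrable_dyn[OF h(2,1) \<mu> k] g(1)])
    fix w assume w: "w \<in> space \<mu>"
    then have "f x u w \<in> X" using dyn_in[OF K_state[OF k] K_input[OF k]] D_D(3)[OF \<mu>] by auto
    then show "h (f x u w) \<le> g w" using h(3) g(2)[OF w] by fastforce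
  qed
qed

text \<open>With \<open>?B = b + \<tau> * ?B\<close>, the function \<open>?B * \<xi>\<close> is a
  supersolution for both signs of the cost, whatever the players do. The bound keeps the suprema and
  infima in the value functions within bounded sets.\<close>

lemma total_cost_bound:
  assumes "\<pi> \<in> policies S" "\<gamma> \<in> adversaries S" "x\<^sub>0 \<in> X"
  shows "\<bar>total_cost S \<pi> \<gamma> x\<^sub>0\<bar> \<le> b / (1 - \<tau>) * \<xi> x\<^sub>0"
proof -
  interpret robust_play S \<xi> \<beta> b \<pi> \<gamma> x\<^sub>0 by unfold_locales (use assms in auto)
  let ?B = "b / (1 - \<tau>)"
  have B: "0 \<le> ?B" and eq: "b + \<tau> * ?B = ?B" using b_nonneg tau by (auto simp: field_simps)
  have V: "bounded_by ?B (\<lambda>x. ?B * \<xi> x)"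
  proof -
    have "0 \<le> ?B * \<xi> x" if "x \<in> X" for x using B xi_ge_1[OF that] by (intro mult_nonneg_nonneg) auto
    then show ?thesis using B by (simp add: bounded_by_def abs_of_nonneg del: times_divide_eq_left)
  qed
  have "\<sigma> * total_cost S \<pi> \<gamma> x\<^sub>0 \<le> ?B * \<xi> x\<^sub>0 + 0 / (1 - \<tau>) * \<xi> x\<^sub>0" if \<sigma>: "\<sigma> \<in> {1, -1}" for \<sigma>
  proof (rule play_le[OF \<sigma> V order_refl], unfold supersolution_at_def, intro AE_I2 impI allI)
    fix t q u \<mu> h C'
    assume k: "(snd q, u) \<in> K" and \<mu>: "\<mu> \<in> D"
      and h: "h \<in> borel_measurable Xs" "bounded_by C' h" "\<forall>x\<in>X. h x \<le> ?B * \<xi> x"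
    have "\<alpha> * (\<integral>w. h (f (snd q) u w) \<partial>\<mu>) \<le> \<alpha> * upper_integral \<mu> (\<lambda>w. ?B * \<xi> (f (snd q) u w))"
      using discount by (intro mult_left_mono integral_le_upper_integral_dyn[OF h V \<mu> k]) auto
    also have "\<dots> \<le> \<tau> * ?B * \<xi> (snd q)"
      using upper_integral_bounds[OF V \<mu> k] by (simp add: abs_le_iff)
    finally have "\<alpha> * (\<integral>w. h (f (snd q) u w) \<partial>\<mu>) \<le> \<tau> * ?B * \<xi> (snd q)" .
    moreover have "\<sigma> * cost S (snd q) u \<le> b * \<xi> (snd q)"
      using cost_bound[OF k] \<sigma> by (auto simp: abs_le_iff)
    moreover have "b * \<xi> (snd q) + \<tau> * ?B * \<xi> (snd q) = ?B * \<xi> (snd q)"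
      unfolding distrib_right[symmetric] eq ..
    ultimately show "\<sigma> * cost S (snd q) u + \<alpha> * (\<integral>w. h (f (snd q) u w) \<partial>\<mu>)
       \<le> ?B * \<xi> (snd q) + 0 * \<xi> (snd q)" by linarith
  qed
  from this[of 1] this[of "-1"] show ?thesis by (simp add: abs_le_iff)
qed

section \<open>Stationary policies and nearly worst-case adversaries\<close>

lemma det_stationary_K: "p \<in> det_stationary S \<Longrightarrow> x \<in> X \<Longrightarrow> (x, p x) \<in> K"
  by (auto simp: det_stationary_def K_iff)

lemma singleton_sets_Us: "u \<in> U \<Longrightarrow> {u} \<in> sets Us"
  by (simp add: input_space_def sets_restrict_space_iff borel_sets)

lemma stationary_policy_in:
  assumes p: "p \<in> det_stationary S" shows "stationary_policy S p \<in> policies S"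
  unfolding policies_def
proof (intro CollectI allI conjI ballI)
  fix t
  have pm: "p \<in> Xs \<rightarrow>\<^sub>M Us" using p by (simp add: det_stationary_def)
  show "stationary_policy S p t \<in> history_space S t \<rightarrow>\<^sub>M prob_algebra Us"
    unfolding stationary_policy_def history_space_def
    by (intro measurable_compose[OF measurable_compose[OF measurable_snd pm] measurable_return_prob_space])
  fix h assume "h \<in> space (history_space S t)"
  then have x: "snd h \<in> X" by (auto simp: history_space_def space_pair_measure)
  have "(snd h, p (snd h)) \<in> K" by (rule det_stationary_K[OF p x])
  then have "p (snd h) \<in> U" "p (snd h) \<in> admissible S (snd h)" using K_input K_iff by auto
  then show "AE u in stationary_policy S p t h. u \<in> admissible S (snd h)"
    unfolding stationary_policy_def by (intro AE_return_singleton singleton_sets_Us) auto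
qed

text \<open>A slack \<open>\<delta>\<close> in each stage is discounted by \<open>\<tau>\<close> per
  stage, and the geometric series gives \<open>\<delta> / (1 - \<tau>)\<close>.\<close>

lemma stationary_total_cost_le:
  assumes p: "p \<in> det_stationary S" and \<gamma>: "\<gamma> \<in> adversaries S" and x: "x\<^sub>0 \<in> X"
    and V: "bounded_by C V" and \<delta>: "0 \<le> \<delta>"
    and le: "\<And>x. x \<in> X \<Longrightarrow> policy_bellman S p V x \<le> V x + \<delta> * \<xi> x"
  shows "total_cost S (stationary_policy S p) \<gamma> x\<^sub>0 \<le> V x\<^sub>0 + \<delta> / (1 - \<tau>) * \<xi> x\<^sub>0"
proof -
  interpret robust_play S \<xi> \<beta> b "stationary_policy S p" \<gamma> x\<^sub>0
    by unfold_locales (use assms stationary_policy_in in auto)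
  have "1 * total_cost S (stationary_policy S p) \<gamma> x\<^sub>0 \<le> V x\<^sub>0 + \<delta> / (1 - \<tau>) * \<xi> x\<^sub>0"
  proof (rule play_le[OF _ V \<delta>])
    fix t :: nat and q assume "q \<in> space (Qt t)"
    then have x: "snd q \<in> X" using space_Qt by auto
    note k = det_stationary_K[OF p x]
    have ik: "input_kernel t q = return Us (p (snd q))"
      unfolding input_kernel_def by (simp add: stationary_policy_def)
    show "AE u in input_kernel t q. AE \<mu> in law_kernel t q u.
      supersolution_at 1 V \<delta> (snd q) u \<mu>"
      unfolding ik
    proof (rule AE_return_singleton)
      show "p (snd q) \<in> space Us" "{p (snd q)} \<in> sets Us"
        using K_input[OF k] singleton_sets_Us by auto
      show "AE \<mu> in law_kernel t q (p (snd q)).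
        supersolution_at 1 V \<delta> (snd q) (p (snd q)) \<mu>"
      proof (unfold supersolution_at_def, intro AE_I2 impI allI)
        fix \<mu> h C'
        assume \<mu>: "\<mu> \<in> D" and h: "h \<in> borel_measurable Xs" "bounded_by C' h" "\<forall>x\<in>X. h x \<le> V x"
        have "\<alpha> * (\<integral>w. h (f (snd q) (p (snd q)) w) \<partial>\<mu>) \<le> \<alpha> * upper_integral \<mu> (\<lambda>w. V (f (snd q) (p (snd q)) w))"
          using discount by (intro mult_left_mono integral_le_upper_integral_dyn[OF h V \<mu> k]) auto
        then show "1 * cost S (snd q) (p (snd q)) + \<alpha> * (\<integral>w. h (f (snd q) (p (snd q)) w) \<partial>\<mu>) \<le> V (snd q) + \<delta> * \<xi> (snd q)"
          using worst_case_upper[OF V \<mu> k] le[OF x] by (simp add: policy_bellman_def)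
      qed
    qed
  qed simp
  then show ?thesis by simp
qed

lemma objective_measurable:
  assumes w: "w \<in> borel_measurable Xs" and \<mu>: "\<mu> \<in> D"
  shows "(\<lambda>z. cost S (fst z) (snd z) + \<alpha> * (\<integral>y. w (f (fst z) (snd z) y) \<partial>\<mu>)) \<in> borel_measurable (Xs \<Otimes>\<^sub>M Us)"
proof -
  have "(\<lambda>z. (fst (fst z), snd (fst z), snd z)) \<in> (Xs \<Otimes>\<^sub>M Us) \<Otimes>\<^sub>M Ws \<rightarrow>\<^sub>M Xs \<Otimes>\<^sub>M (Us \<Otimes>\<^sub>M Ws)"
    by measurable
  from measurable_compose[OF this dyn_measurable]
  have "(\<lambda>z. distr \<mu> Xs (f (fst z) (snd z))) \<in> Xs \<Otimes>\<^sub>M Us \<rightarrow>\<^sub>M prob_algebra Xs"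
    using D_prob[OF \<mu>] by (intro measurable_distr_prob_space2[where M=Ws]) (auto simp: split_beta')
  from measurable_compose[OF measurable_prob_algebraD[OF this] integral_measurable_subprob_algebra[OF w]]
  have "(\<lambda>z. \<integral>x. w x \<partial>distr \<mu> Xs (f (fst z) (snd z))) \<in> borel_measurable (Xs \<Otimes>\<^sub>M Us)" .
  then have "(\<lambda>z. \<integral>y. w (f (fst z) (snd z) y) \<partial>\<mu>) \<in> borel_measurable (Xs \<Otimes>\<^sub>M Us)"
  proof (rule measurable_cong[THEN iffD1, rotated])
    fix z assume "z \<in> space (Xs \<Otimes>\<^sub>M Us)"
    then have "f (fst z) (snd z) \<in> \<mu> \<rightarrow>\<^sub>M Xs"
      using dyn_section[of "fst z" "snd z"] D_D(2)[OF \<mu>]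
      by (auto simp: space_pair_measure cong: measurable_cong_sets)
    then show "(\<integral>x. w x \<partial>distr \<mu> Xs (f (fst z) (snd z))) = (\<integral>y. w (f (fst z) (snd z) y) \<partial>\<mu>)"
      by (rule integral_distr[OF _ w])
  qed
  then show ?thesis using cost_measurable by (simp add: split_beta')
qed

text \<open>
  The objective is lower semicontinuous in \<open>(x, u)\<close> for each law, so by the Lindelof property countably
  many laws suffice; a measurable selection for the adversary is then a least index.
\<close>

lemma countable_worst_case:
  assumes w: "lsc_bounded C w"
  obtains \<mu>s :: "nat \<Rightarrow> (real ^ 'l) measure" where "\<And>n. \<mu>s n \<in> D"
    "\<And>x u a. (x, u) \<in> K \<Longrightarrow> a < worst_case S w x u \<Longrightarrow>
       \<exists>n. a < cost S x u + \<alpha> * (\<integral>y. w (f x u y) \<partial>\<mu>s n)"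
proof -
  \<comment> \<open>Rational levels suffice to separate \<open>a\<close> from the supremum, so
    countably many open covers are reduced, one for each \<open>q\<close>.\<close>
  define L where "L \<mu> q = {z \<in> K. real_of_rat q < (case z of (x, u) \<Rightarrow> cost S x u + \<alpha> * (\<integral>y. w (f x u y) \<partial>\<mu>))}" for \<mu> q
  have "\<exists>D'. D' \<subseteq> D \<and> countable D' \<and> (\<Union>\<mu>\<in>D'. L \<mu> q) = (\<Union>\<mu>\<in>D. L \<mu> q)" for q
  proof -
    have "openin (top_of_set K) A" if "A \<in> (\<lambda>\<mu>. L \<mu> q) ` D" for A
      using lsc_on_objective[OF w] that unfolding lsc_on_iff_openin L_def by auto
    from Lindelof_openin[OF this] obtain F where F: "F \<subseteq> (\<lambda>\<mu>. L \<mu> q) ` D" "countable F" "\<Union>F = (\<Union>\<mu>\<in>D. L \<mu> q)"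
      by metis
    then obtain D' where "countable D'" "D' \<subseteq> D" "F = (\<lambda>\<mu>. L \<mu> q) ` D'"
      using countable_subset_image[of F "\<lambda>\<mu>. L \<mu> q" D] by auto
    with F(3) show ?thesis by blast
  qed
  then obtain D' where D': "\<And>q. D' q \<subseteq> D" "\<And>q. countable (D' q)" "\<And>q. (\<Union>\<mu>\<in>D' q. L \<mu> q) = (\<Union>\<mu>\<in>D. L \<mu> q)"
    by metis
  \<comment> \<open>The empirical law keeps \<open>E\<close> nonempty, so
    \<open>from_nat_into\<close> enumerates it.\<close>
  define E where "E = insert (empirical S) (\<Union>q. D' q)"
  have E: "countable E" "E \<noteq> {}" "E \<subseteq> D"
    unfolding E_def using D'(1,2) empirical_in_D by auto
  show ?thesis
  proof
    show "from_nat_into E n \<in> D" for n using from_nat_into[OF E(2)] E(3) by blast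
    fix x u a assume k: "(x, u) \<in> K" and a: "a < worst_case S w x u"
    from of_rat_dense[OF a] obtain q where q: "a < real_of_rat q" "real_of_rat q < worst_case S w x u" by blast
    then obtain \<mu> where "\<mu> \<in> D" "real_of_rat q < cost S x u + \<alpha> * (\<integral>y. w (f x u y) \<partial>\<mu>)"
      using less_cSUP_iff[OF D_nonempty worst_case_lebesgue(2)[OF w k]] worst_case_lebesgue(1)[OF w k] by auto
    then have "(x, u) \<in> (\<Union>\<mu>\<in>D. L \<mu> q)" using k by (auto simp: L_def)
    then have "(x, u) \<in> (\<Union>\<mu>\<in>D' q. L \<mu> q)" using D'(3) by simp
    then obtain \<mu>' where \<mu>': "\<mu>' \<in> D' q" "real_of_rat q < cost S x u + \<alpha> * (\<integral>y. w (f x u y) \<partial>\<mu>')"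
      by (auto simp: L_def)
    then have "\<mu>' \<in> E" by (auto simp: E_def)
    then obtain n where "\<mu>' = from_nat_into E n" using from_nat_into_surj[OF E(1)] by metis
    then show "\<exists>n. a < cost S x u + \<alpha> * (\<integral>y. w (f x u y) \<partial>from_nat_into E n)"
      using \<mu>' q(1) by (intro exI[of _ n]) auto
  qed
qed

text \<open>Player II sees the input before choosing the law, so a response to the current pair
  \<open>(x, u)\<close> is nearly worst for every input. One adversary therefore serves against all
  policies, and the bound survives the infimum over them. The proof reads \<open>- w\<close> as a
  supersolution for the negated cost.\<close>

lemma adversary_total_cost_ge:
  assumes w: "lsc_bounded C w" and \<delta>: "0 < \<delta>"
    and le: "\<And>x. x \<in> X \<Longrightarrow> w x - \<delta> * \<xi> x < bellman S w x"
  obtains \<gamma> where "\<gamma> \<in> adversaries S"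
    "\<And>\<pi> x. \<pi> \<in> policies S \<Longrightarrow> x \<in> X \<Longrightarrow> w x - \<delta> / (1 - \<tau>) * \<xi> x \<le> total_cost S \<pi> \<gamma> x"
proof -
  have bw: "bounded_by C w" and wm: "w \<in> borel_measurable Xs"
    using w lsc_bounded_measurable[OF w] by (auto simp: lsc_bounded_def)
  obtain \<mu>s :: "nat \<Rightarrow> (real ^ 'l) measure" where \<mu>s: "\<And>n. \<mu>s n \<in> D"
    "\<And>x u a. (x, u) \<in> K \<Longrightarrow> a < worst_case S w x u \<Longrightarrow>
       \<exists>n. a < cost S x u + \<alpha> * (\<integral>y. w (f x u y) \<partial>\<mu>s n)"
    using countable_worst_case[OF w] by metis
  define P where "P n z \<longleftrightarrow> w (fst z) - \<delta> * \<xi> (fst z)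
     < cost S (fst z) (snd z) + \<alpha> * (\<integral>y. w (f (fst z) (snd z) y) \<partial>\<mu>s n)" for n z
  \<comment> \<open>Off \<open>K\<close> no index need satisfy \<open>P\<close>; whatever is
    selected there, the law is a member of \<open>D\<close>.\<close>
  define sel where "sel z = (LEAST n. P n z)" for z
  have Pm: "Measurable.pred (Xs \<Otimes>\<^sub>M Us) (P n)" for n
  proof -
    note objective_measurable[OF wm \<mu>s(1)[of n], measurable]
    note wm[measurable]
    show ?thesis unfolding P_def by measurable
  qed
  have selm: "sel \<in> Xs \<Otimes>\<^sub>M Us \<rightarrow>\<^sub>M count_space UNIV"
    unfolding sel_def by (rule measurable_Least) (rule Pm)
  have sel: "P (sel (x, u)) (x, u)" if k: "(x, u) \<in> K" for x u
  proof -
    have "w x - \<delta> * \<xi> x < worst_case S w x u"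
      using le[OF K_state[OF k]] bellman_lower[OF bw k] by simp
    from \<mu>s(2)[OF k this] have "\<exists>n. P n (x, u)" by (simp add: P_def)
    then show ?thesis unfolding sel_def by (rule LeastI_ex)
  qed
  let ?PA = "prob_algebra Ws"
  \<comment> \<open>The past is ignored: \<open>snd h\<close> is the current pair of state and
    input.\<close>
  define \<gamma> :: "('n, 'm, 'l) adversary" where "\<gamma> t h = return ?PA (\<mu>s (sel (snd h)))" for t h
  have sing: "{\<mu>s n} \<in> sets ?PA" "\<mu>s n \<in> space ?PA" for n
    using sets_prob_algebra_singleton[OF borel_sets(3), of "\<mu>s n"] D_prob[OF \<mu>s(1)]
    by (simp_all add: dist_space_def)
  have adv: "\<gamma> \<in> adversaries S"
    unfolding adversaries_def
  proof (intro CollectI allI conjI ballI)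
    fix t
    have "(\<lambda>h. sel (snd h)) \<in> ext_history_space S t \<rightarrow>\<^sub>M count_space UNIV"
      unfolding ext_history_space_def by (rule measurable_compose[OF measurable_snd selm])
    moreover have "(\<lambda>n. return ?PA (\<mu>s n)) \<in> count_space UNIV \<rightarrow>\<^sub>M prob_algebra ?PA"
      using sing by (intro measurable_count_space_eq1[THEN iffD2]) (auto simp: space_prob_algebra[of ?PA] prob_space_return)
    ultimately show "\<gamma> t \<in> ext_history_space S t \<rightarrow>\<^sub>M prob_algebra ?PA"
      unfolding \<gamma>_def[abs_def] by (rule measurable_compose)
    show "AE \<mu> in \<gamma> t h. \<mu> \<in> D" for h
      unfolding \<gamma>_def by (intro AE_return_singleton sing \<mu>s)
  qed
  show ?thesis
  proof (rule that[OF adv])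
    fix \<pi> x\<^sub>0 assume \<pi>: "\<pi> \<in> policies S" and x: "x\<^sub>0 \<in> X"
    interpret robust_play S \<xi> \<beta> b \<pi> \<gamma> x\<^sub>0 by unfold_locales (use \<pi> x adv in auto)
    have V: "bounded_by C (\<lambda>x. - w x)" using bw by (simp add: bounded_by_def)
    have "(-1) * total_cost S \<pi> \<gamma> x\<^sub>0 \<le> - w x\<^sub>0 + \<delta> / (1 - \<tau>) * \<xi> x\<^sub>0"
    proof (rule play_le[OF _ V less_imp_le[OF \<delta>]])
      fix t :: nat and q assume "q \<in> space (Qt t)"
      show "AE u in input_kernel t q. AE \<mu> in law_kernel t q u.
        supersolution_at (-1) (\<lambda>x. - w x) \<delta> (snd q) u \<mu>"
        unfolding law_kernel_def \<gamma>_def snd_conv supersolution_at_def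
      proof (rule AE_I2, rule AE_return_singleton[OF sing(2,1)], intro impI allI)
        fix u h C' assume k: "(snd q, u) \<in> K"
          and h: "h \<in> borel_measurable Xs" "bounded_by C' h" "\<forall>x\<in>X. h x \<le> - w x"
        let ?\<mu> = "\<mu>s (sel (snd q, u))"
        have "(\<integral>y. h (f (snd q) u y) \<partial>?\<mu>) \<le> (\<integral>y. - w (f (snd q) u y) \<partial>?\<mu>)"
        proof (rule integral_mono)
          show "integrable ?\<mu> (\<lambda>y. h (f (snd q) u y))" by (rule integrable_dyn[OF h(2,1) \<mu>s(1) k])
          show "integrable ?\<mu> (\<lambda>y. - w (f (snd q) u y))" using integrable_dyn[OF bw wm \<mu>s(1) k] by simp
          show "h (f (snd q) u y) \<le> - w (f (snd q) u y)" if "y \<in> space ?\<mu>" for y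
            using h(3) dyn_in[OF K_state[OF k] K_input[OF k]] that D_D(3)[OF \<mu>s(1)] by auto
        qed
        then have "\<alpha> * (\<integral>y. h (f (snd q) u y) \<partial>?\<mu>) \<le> \<alpha> * - (\<integral>y. w (f (snd q) u y) \<partial>?\<mu>)"
          using discount by (intro mult_left_mono) auto
        then show "(-1) * cost S (snd q) u + \<alpha> * (\<integral>w. h (f (snd q) u w) \<partial>?\<mu>) \<le> - w (snd q) + \<delta> * \<xi> (snd q)"
          using sel[OF k] by (simp add: P_def)
      qed
    qed simp
    then show "w x\<^sub>0 - \<delta> / (1 - \<tau>) * \<xi> x\<^sub>0 \<le> total_cost S \<pi> \<gamma> x\<^sub>0" by simp
  qed
qed

section \<open>Order properties of the value functions\<close>

lemma policy_value_le:
  assumes "adversaries S \<noteq> {}" "\<And>\<gamma>. \<gamma> \<in> adversaries S \<Longrightarrow> total_cost S \<pi> \<gamma> x \<le> a"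
  shows "policy_value S \<pi> x \<le> a"
  unfolding policy_value_def using assms by (intro cSUP_least)

lemma total_cost_le_policy_value:
  assumes "\<pi> \<in> policies S" "\<gamma> \<in> adversaries S" "x \<in> X"
  shows "total_cost S \<pi> \<gamma> x \<le> policy_value S \<pi> x"
  unfolding policy_value_def using total_cost_bound[OF assms(1) _ assms(3)] assms(2)
  by (intro cSUP_upper bdd_aboveI2[of _ _ "b / (1 - \<tau>) * \<xi> x"]) (auto simp: abs_le_iff)

lemma optimal_value_le:
  assumes "adversaries S \<noteq> {}" "\<pi> \<in> policies S" "x \<in> X"
  shows "optimal_value S x \<le> policy_value S \<pi> x"
  unfolding optimal_value_def policy_value_def[symmetric]
proof (rule cINF_lower[OF _ assms(2)])
  obtain \<gamma> where \<gamma>: "\<gamma> \<in> adversaries S" using assms(1) by auto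
  show "bdd_below ((\<lambda>\<pi>. policy_value S \<pi> x) ` policies S)"
  proof (rule bdd_belowI2)
    fix \<pi> assume \<pi>: "\<pi> \<in> policies S"
    show "- (b / (1 - \<tau>) * \<xi> x) \<le> policy_value S \<pi> x"
      using total_cost_le_policy_value[OF \<pi> \<gamma> assms(3)] total_cost_bound[OF \<pi> \<gamma> assms(3)]
      by linarith
  qed
qed

lemma le_optimal_value:
  assumes "policies S \<noteq> {}" "\<And>\<pi>. \<pi> \<in> policies S \<Longrightarrow> a \<le> policy_value S \<pi> x"
  shows "a \<le> optimal_value S x"
  unfolding optimal_value_def policy_value_def[symmetric] using assms by (intro cINF_greatest)

section \<open>Error propagation in modified policy iteration\<close>

lemma policy_bellman_bounded_by:
  assumes "bounded_by C v" "p \<in> det_stationary S"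
  shows "bounded_by (b + \<tau> * C) (policy_bellman S p v)"
  using worst_case_bounds[OF assms(1) det_stationary_K[OF assms(2)]] assms(1) b_nonneg tau
  by (auto simp: bounded_by_def policy_bellman_def)

lemma policy_bellman_mono:
  assumes "bounded_by C v" "bounded_by C' v'" "0 \<le> a" "p \<in> det_stationary S" "x \<in> X"
    and "\<And>x. x \<in> X \<Longrightarrow> v x \<le> v' x + a * \<xi> x"
  shows "policy_bellman S p v x \<le> policy_bellman S p v' x + \<tau> * a * \<xi> x"
  unfolding policy_bellman_def
  by (rule worst_case_mono[OF assms(1,2) det_stationary_K[OF assms(4,5)] assms(3,6)])

lemma policy_iterates_bounded:
  assumes "bounded_by C v" "p \<in> det_stationary S"
  shows "\<exists>C. bounded_by C ((policy_bellman S p ^^ i) v)"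
  by (induction i) (use assms policy_bellman_bounded_by in auto)

lemma policy_iterates_step:
  assumes v: "bounded_by C v" and p: "p \<in> det_stationary S" and a: "0 \<le> a"
    and le: "\<And>x. x \<in> X \<Longrightarrow> policy_bellman S p v x \<le> v x + a * \<xi> x"
  shows "x \<in> X \<Longrightarrow> (policy_bellman S p ^^ Suc i) v x \<le> (policy_bellman S p ^^ i) v x + \<tau> ^ i * a * \<xi> x"
proof (induction i arbitrary: x)
  case (Suc i)
  obtain C1 C2 where "bounded_by C1 ((policy_bellman S p ^^ Suc i) v)" "bounded_by C2 ((policy_bellman S p ^^ i) v)"
    using policy_iterates_bounded[OF v p] by metis
  from policy_bellman_mono[OF this _ p Suc.prems, of "\<tau> ^ i * a"]
  show ?case using Suc.IH a tau by (simp add: mult.assoc)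
qed (use le in simp)

text \<open>The residuals from \<open>\<tau> * a\<close> to \<open>\<tau>^i * a\<close> telescope.
  The sum starts at the first iterate instead of \<open>v\<close>, because that iterate is the one
  which greediness identifies with \<open>T v\<close>.\<close>

lemma policy_iterates_upper:
  assumes v: "bounded_by C v" and p: "p \<in> det_stationary S" and a: "0 \<le> a"
    and le: "\<And>x. x \<in> X \<Longrightarrow> policy_bellman S p v x \<le> v x + a * \<xi> x" and x: "x \<in> X"
  shows "(policy_bellman S p ^^ Suc i) v x \<le> policy_bellman S p v x + (\<tau> - \<tau> ^ Suc i) / (1 - \<tau>) * a * \<xi> x"
proof (induction i)
  case (Suc i)
  have eq: "(\<tau> - \<tau> ^ Suc i) / (1 - \<tau>) + \<tau> ^ Suc i = (\<tau> - \<tau> ^ Suc (Suc i)) / (1 - \<tau>)"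
    using tau by (simp add: field_simps)
  have "(policy_bellman S p ^^ Suc (Suc i)) v x \<le> policy_bellman S p v x
      + (\<tau> - \<tau> ^ Suc i) / (1 - \<tau>) * a * \<xi> x + \<tau> ^ Suc i * a * \<xi> x"
    using policy_iterates_step[OF v p a le x, of "Suc i"] Suc by linarith
  also have "\<dots> = policy_bellman S p v x + ((\<tau> - \<tau> ^ Suc i) / (1 - \<tau>) + \<tau> ^ Suc i) * a * \<xi> x"
    by (simp only: distrib_right add.assoc)
  finally show ?case unfolding eq .
qed simp

text \<open>Residuals of both signs shrink by \<open>\<tau>\<close> with every application of
  \<open>T\<close>; the last claim is the geometric sum of the lower ones.\<close>

lemma bellman_iterates:
  assumes v: "lsc_bounded C v" and r: "0 \<le> r"
    and up: "\<And>x. x \<in> X \<Longrightarrow> bellman S v x \<le> v x + r * \<xi> x"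
    and lo: "\<And>x. x \<in> X \<Longrightarrow> v x \<le> bellman S v x + r * \<xi> x"
  shows "\<exists>C. lsc_bounded C ((bellman S ^^ n) v)"
    and "x \<in> X \<Longrightarrow> (bellman S ^^ Suc n) v x \<le> (bellman S ^^ n) v x + \<tau> ^ n * r * \<xi> x"
    and "x \<in> X \<Longrightarrow> (bellman S ^^ n) v x \<le> (bellman S ^^ Suc n) v x + \<tau> ^ n * r * \<xi> x"
    and "x \<in> X \<Longrightarrow> v x \<le> (bellman S ^^ n) v x + (1 - \<tau> ^ n) / (1 - \<tau>) * r * \<xi> x"
proof -
  have lsc: "\<exists>C. lsc_bounded C ((bellman S ^^ n) v)" for n
    by (induction n) (use v bellman_lsc_bounded in auto)
  then show "\<exists>C. lsc_bounded C ((bellman S ^^ n) v)" .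
  have bd: "\<exists>C. bounded_by C ((bellman S ^^ n) v)" for n
    using lsc[of n] by (auto simp: lsc_bounded_def)
  show "x \<in> X \<Longrightarrow> (bellman S ^^ Suc n) v x \<le> (bellman S ^^ n) v x + \<tau> ^ n * r * \<xi> x" for x
  proof (induction n arbitrary: x)
    case (Suc n)
    obtain C1 C2 where "bounded_by C1 ((bellman S ^^ Suc n) v)" "bounded_by C2 ((bellman S ^^ n) v)"
      using bd by metis
    from bellman_mono[OF this _ Suc.prems, of "\<tau> ^ n * r"]
    show ?case using Suc.IH r tau by (simp add: mult.assoc)
  qed (use up in simp)
  show lo': "x \<in> X \<Longrightarrow> (bellman S ^^ n) v x \<le> (bellman S ^^ Suc n) v x + \<tau> ^ n * r * \<xi> x" for n x
  proof (induction n arbitrary: x)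
    case (Suc n)
    obtain C1 C2 where "bounded_by C1 ((bellman S ^^ n) v)" "bounded_by C2 ((bellman S ^^ Suc n) v)"
      using bd by metis
    from bellman_mono[OF this _ Suc.prems, of "\<tau> ^ n * r"]
    show ?case using Suc.IH r tau by (simp add: mult.assoc)
  qed (use lo in simp)
  show "x \<in> X \<Longrightarrow> v x \<le> (bellman S ^^ n) v x + (1 - \<tau> ^ n) / (1 - \<tau>) * r * \<xi> x"
  proof (induction n)
    case (Suc n)
    have eq: "(1 - \<tau> ^ n) / (1 - \<tau>) + \<tau> ^ n = (1 - \<tau> ^ Suc n) / (1 - \<tau>)"
      using tau by (simp add: field_simps)
    have "v x \<le> (bellman S ^^ Suc n) v x + \<tau> ^ n * r * \<xi> x + (1 - \<tau> ^ n) / (1 - \<tau>) * r * \<xi> x"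
      using Suc lo'[OF Suc.prems, of n] by linarith
    also have "\<dots> = (bellman S ^^ Suc n) v x + ((1 - \<tau> ^ n) / (1 - \<tau>) + \<tau> ^ n) * r * \<xi> x"
      by (simp only: distrib_right add.assoc add.commute[of "\<tau> ^ n * r * \<xi> x"])
    finally show ?case unfolding eq .
  qed simp
qed

lemma weighted_norm_bound:
  assumes "weighted_norm S \<xi> g \<le> ennreal a" "0 \<le> a" "x \<in> X"
  shows "\<bar>g x\<bar> \<le> a * \<xi> x"
proof -
  have "ennreal (\<bar>g x\<bar> / \<xi> x) \<le> ennreal a"
    using assms(1,3) unfolding weighted_norm_def by (meson SUP_upper order_trans)
  then have "\<bar>g x\<bar> / \<xi> x \<le> a" using assms(2) by (simp add: ennreal_le_iff)
  then show ?thesis using xi_ge_1[OF assms(3)] by (simp add: divide_le_eq)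
qed

lemma weighted_norm_less:
  assumes "\<And>x. x \<in> X \<Longrightarrow> \<bar>g x\<bar> \<le> a * \<xi> x" "a < e" "0 < e"
  shows "weighted_norm S \<xi> g < ennreal e"
proof -
  have "weighted_norm S \<xi> g \<le> ennreal a"
    unfolding weighted_norm_def
  proof (intro SUP_least ennreal_leI)
    fix x assume x: "x \<in> X"
    show "\<bar>g x\<bar> / \<xi> x \<le> a" using assms(1)[OF x] xi_ge_1[OF x] by (simp add: divide_le_eq)
  qed
  also have "\<dots> < ennreal e" using assms by (simp add: ennreal_lessI)
  finally show ?thesis .
qed

lemma B_lsc_bounded:
  assumes "v \<in> B_lsc S \<xi>" shows "\<exists>C. lsc_bounded C v"
proof -
  have fin: "weighted_norm S \<xi> v < \<infinity>" and "lsc_on X v" using assms by (auto simp: B_lsc_def B_space_def)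
  moreover have "weighted_norm S \<xi> v \<le> ennreal (enn2real (weighted_norm S \<xi> v))" using fin by simp
  then have "\<bar>v x\<bar> \<le> enn2real (weighted_norm S \<xi> v) * \<xi> x" if "x \<in> X" for x
    using weighted_norm_bound that by auto
  ultimately show ?thesis by (auto simp: lsc_bounded_def bounded_by_def intro!: exI[of _ "enn2real (weighted_norm S \<xi> v)"])
qed

text \<open>Finiteness of \<open>n\<close> is essential to the argument: the reference
  \<open>T^n v_0\<close> is lower semicontinuous by induction, and its error is an explicit multiple
  of \<open>\<tau>^n\<close> that disappears only at the end.\<close>

lemma modified_PI_bound:
  assumes PI: "modified_PI S \<xi> M k v \<pi>" and k: "1 \<le> k" and r: "0 < r"
    and norm: "weighted_norm S \<xi> (\<lambda>x. v 0 x - bellman S (v 0) x) \<le> ennreal r"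
    and x: "x \<in> X"
  shows "\<bar>policy_value S (stationary_policy S (\<pi> k)) x - optimal_value S x\<bar>
    \<le> (real k + 1) * \<tau> ^ k * r / (1 - \<tau>) * \<xi> x"
proof -
  obtain C\<^sub>0 where v0: "lsc_bounded C\<^sub>0 (v 0)"
    using PI B_lsc_bounded[of "v 0"] unfolding modified_PI_def by blast
  then have v0b: "bounded_by C\<^sub>0 (v 0)" by (simp add: lsc_bounded_def)
  have res: "bellman S (v 0) x \<le> v 0 x + r * \<xi> x" "v 0 x \<le> bellman S (v 0) x + r * \<xi> x" if "x \<in> X" for x
    using weighted_norm_bound[OF norm _ that] r by (auto simp: abs_le_iff)
  have M: "0 < M j" if "1 \<le> j" for j using PI that by (auto simp: modified_PI_def)
  have \<pi>: "\<pi> (Suc j) \<in> det_stationary S"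
    and opt: "\<And>x. x \<in> X \<Longrightarrow> sip_optimal_input S (v j) x (\<pi> (Suc j) x)"
    and ev: "\<And>x. x \<in> X \<Longrightarrow> v (Suc j) x = (policy_bellman S (\<pi> (Suc j)) ^^ M (Suc j)) (v j) x"
    if "j < k" for j
    using PI that unfolding modified_PI_def by (auto dest!: bspec[of _ _ "Suc j"])
  have vb: "\<exists>C. bounded_by C (v j)" if "j \<le> k" for j
    using that
  proof (induction j)
    case (Suc j)
    then obtain C where "bounded_by C (v j)" by auto
    moreover have j: "j < k" using Suc.prems by simp
    ultimately obtain C' where "bounded_by C' ((policy_bellman S (\<pi> (Suc j)) ^^ M (Suc j)) (v j))"
      using policy_iterates_bounded \<pi> by blast
    then show ?case unfolding bounded_by_def using ev[OF j] by auto
  qed (use v0b in auto)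
  have greedy: "policy_bellman S (\<pi> (Suc j)) (v j) x = bellman S (v j) x" if j: "j < k" and x: "x \<in> X" for j x
  proof -
    obtain C where "bounded_by C (v j)" using vb[of j] j by auto
    from sip_optimal_worst_case[OF this x opt[OF j x]] show ?thesis by (simp add: policy_bellman_def)
  qed
  \<comment> \<open>\<open>T\<close> at the new iterate is at most the policy operator there, that
    is, one more evaluation step. The residual has by then been contracted \<open>M (Suc j)\<close>
    times; only one factor \<open>\<tau>\<close> is kept, as the depth may be 1.\<close>
  have a: "bellman S (v j) x \<le> v j x + \<tau> ^ j * r * \<xi> x" if "j \<le> k" "x \<in> X" for j x
    using that
  proof (induction j arbitrary: x)
    case (Suc j)
    let ?p = "\<pi> (Suc j)"
    have j: "j < k" using Suc.prems by simp
    obtain C where C: "bounded_by C (v j)" using vb[of j] j by auto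
    obtain C' where C': "bounded_by C' (v (Suc j))" using vb[of "Suc j"] j by auto
    obtain C2 where C2: "bounded_by C2 ((policy_bellman S ?p ^^ M (Suc j)) (v j))"
      using policy_iterates_bounded[OF C \<pi>[OF j]] by blast
    have "bellman S (v (Suc j)) x \<le> policy_bellman S ?p (v (Suc j)) x"
      unfolding policy_bellman_def by (rule bellman_lower[OF C' det_stationary_K[OF \<pi>[OF j] Suc.prems(2)]])
    also have "\<dots> \<le> (policy_bellman S ?p ^^ Suc (M (Suc j))) (v j) x"
      using policy_bellman_mono[OF C' C2 order_refl \<pi>[OF j] Suc.prems(2)] ev[OF j] by simp
    also have "\<dots> \<le> (policy_bellman S ?p ^^ M (Suc j)) (v j) x + \<tau> ^ M (Suc j) * (\<tau> ^ j * r) * \<xi> x"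
      using Suc.IH j greedy[OF j] r tau by (intro policy_iterates_step[OF C \<pi>[OF j]] Suc.prems(2)) auto
    also have "\<dots> \<le> (policy_bellman S ?p ^^ M (Suc j)) (v j) x + \<tau> * (\<tau> ^ j * r) * \<xi> x"
    proof -
      have "\<tau> ^ M (Suc j) \<le> \<tau> ^ 1" using M[of "Suc j"] tau by (intro power_decreasing) auto
      then show ?thesis
        using r tau xi_ge_1[OF Suc.prems(2)] by (intro add_left_mono mult_right_mono) auto
    qed
    finally show ?case using ev[OF j Suc.prems(2)] by (simp add: mult.assoc)
  qed (use res in simp)
  have bound: "policy_value S (stationary_policy S (\<pi> k)) x - optimal_value S x
    \<le> ((real k + 1) * \<tau> ^ k + 3 * \<tau> ^ n) * r / (1 - \<tau>) * \<xi> x" for n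
  proof -
    define w where "w = (bellman S ^^ n) (v 0)"
    \<comment> \<open>Built to satisfy \<open>E (Suc j) = \<tau> * E j + \<tau> / (1 - \<tau>) *
      \<tau>^j * r + \<tau>^n * r\<close>: contraction of the old error, surplus of the evaluation,
      residual of the reference \<open>w\<close>. \<open>E 0\<close> covers the distance from
      \<open>v 0\<close> to \<open>w\<close>.\<close>
    define E where "E j = ((real j + 1) * \<tau> ^ j + \<tau> ^ n) * r / (1 - \<tau>)" for j
    have E0: "0 \<le> E j" for j using tau r by (simp add: E_def)
    have ESuc: "\<tau> ^ n * r + \<tau> * E j + \<tau> / (1 - \<tau>) * (\<tau> ^ j * r) = E (Suc j)" for j
    proof -
      have "\<tau> ^ n * r = \<tau> ^ n * r * (1 - \<tau>) / (1 - \<tau>)" using tau by simp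
      then have "\<tau> ^ n * r + \<tau> * E j + \<tau> / (1 - \<tau>) * (\<tau> ^ j * r)
        = (\<tau> ^ n * r * (1 - \<tau>) + \<tau> * (((real j + 1) * \<tau> ^ j + \<tau> ^ n) * r) + \<tau> * (\<tau> ^ j * r)) / (1 - \<tau>)"
        unfolding E_def by (simp only: add_divide_distrib times_divide_eq_right times_divide_eq_left)
      also have "\<dots> = E (Suc j)"
        unfolding E_def by (rule arg_cong[where f="\<lambda>z. z / (1 - \<tau>)"]) (simp add: algebra_simps)
      finally show ?thesis .
    qed
    note it = bellman_iterates[OF v0 less_imp_le[OF r], where n=n]
    obtain C where w: "lsc_bounded C w" using it(1) res unfolding w_def by blast
    then have wb: "bounded_by C w" by (simp add: lsc_bounded_def)
    have Tw: "bellman S w x \<le> w x + \<tau> ^ n * r * \<xi> x" "w x \<le> bellman S w x + \<tau> ^ n * r * \<xi> x"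
      and vw: "v 0 x \<le> w x + (1 - \<tau> ^ n) / (1 - \<tau>) * r * \<xi> x" if "x \<in> X" for x
      using it(2-4)[where x=x] res that by (simp_all add: w_def)
    \<comment> \<open>Used twice: the surplus \<open>\<tau> / (1 - \<tau>) * (\<tau>^j * r)\<close>
      bounds partial evaluations of any depth as well as the full evaluation of the policy.\<close>
    have Tv: "bellman S (v j) x + \<tau> / (1 - \<tau>) * (\<tau> ^ j * r) * \<xi> x \<le> w x + E (Suc j) * \<xi> x"
      if j: "j < k" and x: "x \<in> X" and le: "\<And>x. x \<in> X \<Longrightarrow> v j x \<le> w x + E j * \<xi> x" for j x
    proof -
      obtain C' where "bounded_by C' (v j)" using vb[of j] j by auto
      from bellman_mono[OF this wb E0 x le]
      have "bellman S (v j) x + \<tau> / (1 - \<tau>) * (\<tau> ^ j * r) * \<xi> x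
         \<le> w x + \<tau> ^ n * r * \<xi> x + \<tau> * E j * \<xi> x + \<tau> / (1 - \<tau>) * (\<tau> ^ j * r) * \<xi> x"
        using Tw(1)[OF x] by linarith
      also have "\<dots> = w x + (\<tau> ^ n * r + \<tau> * E j + \<tau> / (1 - \<tau>) * (\<tau> ^ j * r)) * \<xi> x"
        by (simp only: distrib_right add.assoc)
      finally show ?thesis unfolding ESuc .
    qed
    have vE: "v j x \<le> w x + E j * \<xi> x" if "j \<le> k" "x \<in> X" for j x
      using that
    proof (induction j arbitrary: x)
      case 0
      have "(1 - \<tau> ^ n) / (1 - \<tau>) * r \<le> E 0"
        unfolding E_def using tau r by (simp add: divide_right_mono mult_right_mono)
      then have "(1 - \<tau> ^ n) / (1 - \<tau>) * r * \<xi> x \<le> E 0 * \<xi> x"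
        using xi_ge_1[OF 0(2)] by (intro mult_right_mono) auto
      then show ?case using vw[OF 0(2)] by linarith
    next
      case (Suc j)
      let ?p = "\<pi> (Suc j)"
      have j: "j < k" using Suc.prems by simp
      obtain C' where C': "bounded_by C' (v j)" using vb[of j] j by auto
      \<comment> \<open>Positive depth means that at least one greedy step is taken, which becomes
        \<open>T\<close> applied to \<open>v j\<close>.\<close>
      obtain m where m: "M (Suc j) = Suc m" using M[of "Suc j"] by (cases "M (Suc j)") auto
      have "v (Suc j) x \<le> policy_bellman S ?p (v j) x + (\<tau> - \<tau> ^ Suc m) / (1 - \<tau>) * (\<tau> ^ j * r) * \<xi> x"
        unfolding ev[OF j Suc.prems(2)] m using a[of j] j greedy[OF j] r tau
        by (intro policy_iterates_upper[OF C' \<pi>[OF j]] Suc.prems(2)) auto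
      also have "\<dots> \<le> bellman S (v j) x + \<tau> / (1 - \<tau>) * (\<tau> ^ j * r) * \<xi> x"
        using tau r xi_ge_1[OF Suc.prems(2)]
        by (intro add_mono mult_right_mono divide_right_mono) (simp_all add: greedy[OF j Suc.prems(2)])
      also have "\<dots> \<le> w x + E (Suc j) * \<xi> x"
        using Suc.IH j by (intro Tv Suc.prems(2)) auto
      finally show ?case .
    qed
    obtain j where j: "k = Suc j" using k by (cases k) auto
    obtain C' where C': "bounded_by C' (v j)" using vb[of j] j by auto
    have jk: "j < k" using j by simp
    let ?p = "\<pi> k"
    have p: "?p \<in> det_stationary S" using \<pi>[OF jk] j by simp
    \<comment> \<open>One step of the last policy gives a supersolution with residual
      \<open>\<tau>^k * r\<close>, independently of the final depth \<open>M k\<close>.\<close>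
    define V where "V = policy_bellman S ?p (v j)"
    have V: "bounded_by (b + \<tau> * C') V" unfolding V_def by (rule policy_bellman_bounded_by[OF C' p])
    have TV: "policy_bellman S ?p V y \<le> V y + \<tau> * (\<tau> ^ j * r) * \<xi> y" if "y \<in> X" for y
      using policy_iterates_step[OF C' p, of "\<tau> ^ j * r" y 1] a[of j] greedy[OF jk] j r tau that
      by (simp add: V_def)
    \<comment> \<open>Twice the residual of \<open>w\<close>, because the adversary needs a strict
      inequality. Together with the term in \<open>E k\<close> this explains the coefficient 3 of
      \<open>\<tau>^n\<close>.\<close>
    define \<delta> where "\<delta> = 2 * \<tau> ^ n * r"
    have \<delta>: "0 < \<delta>" using tau r by (simp add: \<delta>_def)
    have "w y - \<delta> * \<xi> y < bellman S w y" if "y \<in> X" for y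
    proof -
      have "0 < \<tau> ^ n * r * \<xi> y" using tau r xi_ge_1[OF that] by simp
      then show ?thesis using Tw(2)[OF that] by (simp add: \<delta>_def)
    qed
    from adversary_total_cost_ge[OF w \<delta> this] obtain \<gamma> where \<gamma>: "\<gamma> \<in> adversaries S"
      "\<And>\<pi> x. \<pi> \<in> policies S \<Longrightarrow> x \<in> X \<Longrightarrow> w x - \<delta> / (1 - \<tau>) * \<xi> x \<le> total_cost S \<pi> \<gamma> x" by metis
    have lower: "w x - \<delta> / (1 - \<tau>) * \<xi> x \<le> optimal_value S x"
    proof (rule le_optimal_value)
      show "policies S \<noteq> {}" using stationary_policy_in[OF p] by auto
      fix \<pi>' assume "\<pi>' \<in> policies S"
      then show "w x - \<delta> / (1 - \<tau>) * \<xi> x \<le> policy_value S \<pi>' x"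
        using \<gamma> total_cost_le_policy_value x by (meson order_trans)
    qed
    have "policy_value S (stationary_policy S ?p) x \<le> V x + \<tau> * (\<tau> ^ j * r) / (1 - \<tau>) * \<xi> x"
    proof (rule policy_value_le)
      show "adversaries S \<noteq> {}" using \<gamma> by auto
      fix \<gamma>' assume "\<gamma>' \<in> adversaries S"
      then show "total_cost S (stationary_policy S ?p) \<gamma>' x \<le> V x + \<tau> * (\<tau> ^ j * r) / (1 - \<tau>) * \<xi> x"
        using tau r by (intro stationary_total_cost_le[OF p _ x V _ TV]) auto
    qed
    also have "\<dots> = bellman S (v j) x + \<tau> / (1 - \<tau>) * (\<tau> ^ j * r) * \<xi> x"
      using greedy[OF jk x] j by (simp add: V_def)
    also have "\<dots> \<le> w x + E k * \<xi> x"
      using Tv[OF jk x vE[of j]] j by simp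
    finally have "policy_value S (stationary_policy S ?p) x - optimal_value S x \<le> E k * \<xi> x + \<delta> / (1 - \<tau>) * \<xi> x"
      using lower by linarith
    also have "\<dots> = (E k + \<delta> / (1 - \<tau>)) * \<xi> x" by (simp only: distrib_right)
    also have "E k + \<delta> / (1 - \<tau>) = ((real k + 1) * \<tau> ^ k + 3 * \<tau> ^ n) * r / (1 - \<tau>)"
      unfolding E_def \<delta>_def add_divide_distrib[symmetric] by (simp add: algebra_simps)
    finally show ?thesis .
  qed
  have "(\<lambda>n. ((real k + 1) * \<tau> ^ k + 3 * \<tau> ^ n) * r / (1 - \<tau>) * \<xi> x)
      \<longlonglongrightarrow> ((real k + 1) * \<tau> ^ k + 3 * 0) * r / (1 - \<tau>) * \<xi> x"
    using tau by (intro tendsto_intros LIMSEQ_power_zero) auto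
  then have "policy_value S (stationary_policy S (\<pi> k)) x - optimal_value S x
     \<le> ((real k + 1) * \<tau> ^ k + 3 * 0) * r / (1 - \<tau>) * \<xi> x"
    by (rule LIMSEQ_le_const) (use bound in auto)
  moreover have "optimal_value S x \<le> policy_value S (stationary_policy S (\<pi> k)) x"
  proof (rule optimal_value_le[OF _ stationary_policy_in x])
    obtain j where j: "k = Suc j" using k by (cases k) auto
    then show "\<pi> k \<in> det_stationary S" using \<pi>[of j] by simp
    \<comment> \<open>Here the construction only has to show that some adversary exists;
      \<open>v 0\<close> with doubled residual suffices.\<close>
    have "v 0 y - (2 * r) * \<xi> y < bellman S (v 0) y" if "y \<in> X" for y
    proof -
      have "0 < r * \<xi> y" using r xi_ge_1[OF that] by simp
      then show ?thesis using res(2)[OF that] by simp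
    qed
    from adversary_total_cost_ge[OF v0 _ this] show "adversaries S \<noteq> {}" using r by auto
  qed
  ultimately show ?thesis by simp
qed

end

theorem proposition4:
  fixes S :: "('n::finite, 'm::finite, 'l::finite) control_problem"
    and \<xi> :: "real ^ 'n \<Rightarrow> real" and \<beta> \<tau> r \<epsilon> :: real
    and M :: "nat \<Rightarrow> nat" and k :: nat
    and v :: "nat \<Rightarrow> real ^ 'n \<Rightarrow> real" and \<pi> :: "nat \<Rightarrow> real ^ 'n \<Rightarrow> real ^ 'm"
  assumes "well_posed S"
    and "assumption_A S \<xi> \<beta>"
    and "1 \<le> k"
    and "modified_PI S \<xi> M k v \<pi>"
    and "0 < r"
    and "weighted_norm S \<xi> (\<lambda>x. v 0 x - bellman S (v 0) x) \<le> ennreal r"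
    and "0 < \<epsilon>"
    and "\<tau> = discount S * \<beta>"
    and "real k * \<tau> ^ k < (1 - \<tau>)\<^sup>2 / (2 * r) * \<epsilon>"
  shows "weighted_norm S \<xi>
           (\<lambda>x. policy_value S (stationary_policy S (\<pi> k)) x - optimal_value S x) < ennreal \<epsilon>"
proof -
  obtain b where "0 \<le> b" "\<forall>(x, u)\<in>graph_set S. \<bar>cost S x u\<bar> \<le> b * \<xi> x"
    using assms(2) unfolding assumption_A_def by blast
  \<comment> \<open>The first policy of the run selects an admissible input at every state, and it
    exists because \<open>1 \<le> k\<close>.\<close>
  moreover have "admissible S x \<noteq> {}" if "x \<in> state_set S" for x
    using assms(3,4) that by (force simp: modified_PI_def det_stationary_def)
  ultimately interpret robust_control S \<xi> \<beta> b
    using assms(1,2) by unfold_locales auto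
  have \<tau>: "\<tau> = robust_control.\<tau> S \<beta>" using assms(8) \<tau>_def by simp
  have t: "0 < \<tau>" "\<tau> < 1" unfolding \<tau> by (rule tau)+
  show ?thesis
  proof (rule weighted_norm_less[OF _ _ assms(7)])
    show "\<bar>policy_value S (stationary_policy S (\<pi> k)) x - optimal_value S x\<bar>
       \<le> (real k + 1) * \<tau> ^ k * r / (1 - \<tau>) * \<xi> x" if "x \<in> state_set S" for x
      unfolding \<tau> by (rule modified_PI_bound[OF assms(4,3,5,6) that])
    \<comment> \<open>\<open>k + 1 \<le> 2 * k\<close> is where at least one iteration is needed;
      this is the origin of the 2 in the stopping condition.\<close>
    have "(real k + 1) * \<tau> ^ k * r / (1 - \<tau>) \<le> 2 * (real k * \<tau> ^ k) * r / (1 - \<tau>)"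
    proof -
      have "(real k + 1) * \<tau> ^ k \<le> (2 * real k) * \<tau> ^ k"
        using assms(3) t by (intro mult_right_mono) auto
      then show ?thesis using t assms(5) by (intro divide_right_mono mult_right_mono) auto
    qed
    also have "\<dots> \<le> 2 * (real k * \<tau> ^ k) * r / (1 - \<tau>)\<^sup>2"
      using t assms(5) by (intro divide_left_mono) (auto simp: power2_eq_square mult_le_one)
    also have "\<dots> < \<epsilon>"
      using assms(5,9) t by (simp add: field_simps)
    finally show "(real k + 1) * \<tau> ^ k * r / (1 - \<tau>) < \<epsilon>" .
  qed
qed

end
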